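(* Let $X^\delta\subset X$ and $Y^\delta\subset Y$ be closed non-trivial subspaces, either both finite dimensional, or $X^\delta=X$ and $Y^\delta=Y$. Then $N^\delta\colon Y^\delta\times X^\delta\to(Y^\delta)'\times(X^\delta)'$ is invertible, and $(N^\delta)^{-1}$ is Lipschitz continuous with constant $$L_{(N^\delta)^{-1}}=L_{N^{-1}}:=\tfrac1{m_A}+\max\big(1,\tfrac1{m_A}\big)\,\tfrac1{m_S}\big(1+\tfrac1{m_A}\big),\qquad m_S:=\min\big(1,m_A,\tfrac{m_A}{L_A^2}\big).$$
   Context: All linear spaces are over $\mathbb R$. Any Cartesian product of normed spaces $\mathcal X\times\mathcal Y$ is equipped with $\|(x,y)\|:=\|x\|_{\mathcal X}+\|y\|_{\mathcal Y}$. $V\hookrightarrow H\simeq H'\hookrightarrow V'$ is a Gelfand triple of Hilbert spaces, $T>0$, $\Xi:=(0,T)$. Set $Y:=L_2(\Xi;V)$ and $X:=L_2(\Xi;V)\cap H^1(\Xi;V')$. It is known that $X\hookrightarrow C(\overline\Xi;H)$, and $\gamma_t\colon X\to H$ denotes the trace $w\mapsto w(t)$. Define $\mathrm{d}_t\colon X\to Y'$ by $(\mathrm{d}_t w)(v):=\int_\Xi (\tfrac{\mathrm{d}w}{\mathrm{d}t}(t))(v(t))\,\mathrm{d}t$. For a.e. $t\in\Xi$, $A(t)\colon V\to V'$ is a possibly nonlinear operator, and $A\colon Y\to Y'$ is defined by $(Aw)(v):=\int_\Xi (A(t)w(t))(v(t))\,\mathrm{d}t$. It is assumed that $A\colon Y\to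 Y'$ is Lipschitz continuous, $\|Aw-Av\|_{Y'}\le L_A\|w-v\|_Y$, and strongly monotone, $(Aw-Av)(w-v)\ge m_A\|w-v\|_Y^2$, for all $w,v\in Y$, with constants $L_A,m_A>0$. Functionals in $Y'$ are viewed in $X'$ by restriction. $E_X^\delta\colon X^\delta\to X$ and $E_Y^\delta\colon Y^\delta\to Y$ are the trivial embeddings, and primes denote duals/adjoints (so $(E_Y^\delta)'$, $(E_X^\delta)'$ restrict functionals to $Y^\delta$, $X^\delta$). $Y^\delta$ is equipped with $\|\cdot\|_{Y^\delta}:=\|E_Y^\delta\cdot\|_Y$, and $X^\delta$ with the $Y^\delta$-dependent norm $\|z\|_{X^\delta}:=\sqrt{\|z\|_Y^2+\|(E_Y^\delta)'\mathrm{d}_tz\|_{(Y^\delta)'}^2+\|\gamma_Tz\|_H^2}$; $(Y^\delta)'$ and $(X^\delta)'$ carry the corresponding dual norms. Set $A_Y^\delta:=(E_Y^\delta)'AE_Y^\delta$, $A_X^\delta:=(E_X^\delta)'AE_X^\delta$, $\mathrm{d}_t^\delta:=(E_Y^\delta)'\mathrm{d}_tE_X^\delta$, $\gamma_t^\delta:=\gamma_tE_X^\delta$, and $$N^\delta(\theta,u):=\big(A_Y^\delta\theta+\mathrm{d}_t^\delta u,\ (\mathrm{d}_t^\delta)'\theta-(A_X^\delta u+(\gamma_T^\delta)'\gamma_T^\delta u)\big).$$ *)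

theory Defs
  imports "HOL-Analysis.Analysis"
begin

section \<open>Bochner spaces of square integrable functions\<close>

text \<open>
  The library's Bochner integral lives on second countable spaces, which is not available for
  the dual of a Hilbert space and would force separability. Strong measurability is therefore
  defined here for arbitrary normed spaces; all integrals that are needed are scalar.
\<close>

definition strongly_measurable :: "'m measure \<Rightarrow> ('m \<Rightarrow> 'a::topological_space) \<Rightarrow> bool" where
  "strongly_measurable M f \<longleftrightarrow>
     (\<exists>s. (\<forall>n. simple_function M (s n)) \<and> (AE x in M. (\<lambda>n::nat. s n x) \<longlonglongrightarrow> f x))"

definition square_integrable :: "(real \<Rightarrow> 'a::real_normed_vector) \<Rightarrow> bool" where
  "square_integrable f \<longleftrightarrow>
     strongly_measurable lebesgue f \<and> integrable lebesgue (\<lambda>t. (norm (f t))\<^sup>2)"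

lemma strongly_measurable_norm:
  fixes f :: "real \<Rightarrow> 'a::real_normed_vector"
  assumes "strongly_measurable lebesgue f"
  shows "(\<lambda>t. norm (f t)) \<in> borel_measurable lebesgue"
proof -
  obtain s where s: "\<And>n. simple_function lebesgue (s n)"
    and lim: "AE x in lebesgue. (\<lambda>n::nat. s n x) \<longlonglongrightarrow> f x"
    using assms unfolding strongly_measurable_def by blast
  obtain N where N: "N \<in> null_sets lebesgue" "\<And>x. x \<notin> N \<Longrightarrow> (\<lambda>n. s n x) \<longlonglongrightarrow> f x"
    using lim unfolding completion.AE_iff_null_sets by auto
  have Nm: "- N \<in> sets lebesgue"
    using N(1) by (metis Compl_in_sets_lebesgue null_setsD2)
  have m: "(\<lambda>x. indicator (- N) x * norm (s n x)) \<in> borel_measurable lebesgue" for n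
    using Nm borel_measurable_simple_function[OF simple_function_compose1[OF s[of n], of norm]]
    by (intro borel_measurable_times borel_measurable_indicator) auto
  have "(\<lambda>x. indicator (- N) x * norm (f x) :: real) \<in> borel_measurable lebesgue"
  proof (rule borel_measurable_LIMSEQ_metric[OF m])
    fix x
    show "(\<lambda>n. indicator (- N) x * norm (s n x)) \<longlonglongrightarrow> indicator (- N) x * norm (f x)"
    proof (cases "x \<in> N")
      case False
      then show ?thesis using tendsto_norm[OF N(2)[OF False]] by simp
    qed simp
  qed
  moreover have "AE x in lebesgue. indicator (- N) x * norm (f x) = norm (f x)"
    using AE_not_in[OF N(1)] by eventually_elim auto
  ultimately show ?thesis by (rule borel_measurable_AE)
qed

lemma strongly_measurable_const: "strongly_measurable M (\<lambda>x. c)"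
  unfolding strongly_measurable_def by (rule exI[of _ "\<lambda>n x. c"]) simp

lemma strongly_measurable_add:
  fixes f g :: "'m \<Rightarrow> 'a::real_normed_vector"
  assumes "strongly_measurable M f" "strongly_measurable M g"
  shows "strongly_measurable M (\<lambda>x. f x + g x)"
proof -
  obtain s where s: "\<And>n. simple_function M (s n)" "AE x in M. (\<lambda>n::nat. s n x) \<longlonglongrightarrow> f x"
    using assms(1) unfolding strongly_measurable_def by blast
  obtain r where r: "\<And>n. simple_function M (r n)" "AE x in M. (\<lambda>n::nat. r n x) \<longlonglongrightarrow> g x"
    using assms(2) unfolding strongly_measurable_def by blast
  have "simple_function M (\<lambda>x. s n x + r n x)" for n
    by (rule simple_function_compose2[OF s(1) r(1)])
  moreover have "AE x in M. (\<lambda>n. s n x + r n x) \<longlonglongrightarrow> f x + g x"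
    using s(2) r(2) by eventually_elim (rule tendsto_add)
  ultimately show ?thesis
    unfolding strongly_measurable_def by (intro exI[of _ "\<lambda>n x. s n x + r n x"]) auto
qed

lemma strongly_measurable_scaleR:
  fixes f :: "'m \<Rightarrow> 'a::real_normed_vector"
  assumes "strongly_measurable M f"
  shows "strongly_measurable M (\<lambda>x. c *\<^sub>R f x)"
proof -
  obtain s where s: "\<And>n. simple_function M (s n)" "AE x in M. (\<lambda>n::nat. s n x) \<longlonglongrightarrow> f x"
    using assms unfolding strongly_measurable_def by blast
  have "AE x in M. (\<lambda>n. c *\<^sub>R s n x) \<longlonglongrightarrow> c *\<^sub>R f x"
    using s(2) by eventually_elim (intro tendsto_intros)
  then show ?thesis
    using simple_function_compose1[OF s(1), of "(*\<^sub>R) c"]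
    unfolding strongly_measurable_def by (intro exI[of _ "\<lambda>n x. c *\<^sub>R s n x"]) auto
qed

lemma square_integrable_zero: "square_integrable (\<lambda>t. 0)"
  unfolding square_integrable_def by (simp add: strongly_measurable_const)

lemma square_integrable_add:
  assumes f: "square_integrable f" and g: "square_integrable g"
  shows "square_integrable (\<lambda>t. f t + g t)"
proof -
  have sm: "strongly_measurable lebesgue (\<lambda>t. f t + g t)"
    using f g unfolding square_integrable_def by (intro strongly_measurable_add) auto
  have "integrable lebesgue (\<lambda>t. 2 * (norm (f t))\<^sup>2 + 2 * (norm (g t))\<^sup>2)"
    using f g unfolding square_integrable_def by auto
  then have "integrable lebesgue (\<lambda>t. (norm (f t + g t))\<^sup>2)"
  proof (rule Bochner_Integration.integrable_bound)
    show "(\<lambda>t. (norm (f t + g t))\<^sup>2) \<in> borel_measurable lebesgue"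
      using strongly_measurable_norm[OF sm] by measurable
    have "(norm (f t + g t))\<^sup>2 \<le> 2 * (norm (f t))\<^sup>2 + 2 * (norm (g t))\<^sup>2" for t
    proof -
      have "(norm (f t + g t))\<^sup>2 \<le> (norm (f t) + norm (g t))\<^sup>2"
        by (intro power_mono norm_triangle_ineq) auto
      also have "\<dots> \<le> 2 * (norm (f t))\<^sup>2 + 2 * (norm (g t))\<^sup>2"
        using zero_le_power2[of "norm (f t) - norm (g t)"] by (simp add: power2_eq_square algebra_simps)
      finally show ?thesis .
    qed
    then show "AE t in lebesgue. norm ((norm (f t + g t))\<^sup>2)
        \<le> norm (2 * (norm (f t))\<^sup>2 + 2 * (norm (g t))\<^sup>2)"
      by (intro AE_I2) (simp add: order_trans[OF _ abs_ge_self])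
  qed
  with sm show ?thesis unfolding square_integrable_def by simp
qed

lemma square_integrable_scaleR:
  "square_integrable f \<Longrightarrow> square_integrable (\<lambda>t. c *\<^sub>R f t)"
  unfolding square_integrable_def by (auto intro: strongly_measurable_scaleR simp: power_mult_distrib)

text \<open>\<open>L\<^sub>2(\<real>; 'a)\<close> as a type of equivalence classes modulo equality almost everywhere;
  \<^term>\<open>rep_L2fun w\<close> is some (unspecified) representative of the class \<^term>\<open>w\<close>.\<close>

quotient_type (overloaded) 'a L2fun = "real \<Rightarrow> 'a::real_normed_vector" / partial:
  "\<lambda>f g. square_integrable f \<and> square_integrable g \<and> (AE t in lebesgue. f t = g t)"
  morphisms rep_L2fun abs_L2fun
proof (rule part_equivpI)
  show "\<exists>f::real \<Rightarrow> 'a. square_integrable f \<and> square_integrable f \<and> (AE t in lebesgue. f t = f t)"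
    using square_integrable_zero by auto
  show "symp (\<lambda>(f::real \<Rightarrow> 'a) g. square_integrable f \<and> square_integrable g \<and> (AE t in lebesgue. f t = g t))"
    by (auto intro!: sympI elim: AE_mp)
  show "transp (\<lambda>(f::real \<Rightarrow> 'a) g. square_integrable f \<and> square_integrable g \<and> (AE t in lebesgue. f t = g t))"
    by (auto intro!: transpI elim: AE_mp)
qed

lemma L2_triangle:
  assumes f: "square_integrable f" and g: "square_integrable g"
  shows "sqrt (LINT t|lebesgue. (norm (f t + g t))\<^sup>2)
       \<le> sqrt (LINT t|lebesgue. (norm (f t))\<^sup>2) + sqrt (LINT t|lebesgue. (norm (g t))\<^sup>2)"
proof -
  define a where "a = sqrt (LINT t|lebesgue. (norm (f t))\<^sup>2)"
  define b where "b = sqrt (LINT t|lebesgue. (norm (g t))\<^sup>2)"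
  have i: "integrable lebesgue (\<lambda>t. (norm (f t))\<^sup>2)" "integrable lebesgue (\<lambda>t. (norm (g t))\<^sup>2)"
    "integrable lebesgue (\<lambda>t. (norm (f t + g t))\<^sup>2)"
    using f g square_integrable_add[OF f g] unfolding square_integrable_def by auto
  have ab: "a \<ge> 0" "b \<ge> 0" "a\<^sup>2 = (LINT t|lebesgue. (norm (f t))\<^sup>2)" "b\<^sup>2 = (LINT t|lebesgue. (norm (g t))\<^sup>2)"
    unfolding a_def b_def by (simp_all add: integral_nonneg_AE)
  have "(LINT t|lebesgue. (norm (f t + g t))\<^sup>2) \<le> (a + b)\<^sup>2"
  proof (cases "a = 0 \<or> b = 0")
    case True
    then show ?thesis
    proof
      assume "a = 0"
      then have "AE t in lebesgue. (norm (f t))\<^sup>2 = 0"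
        using integral_nonneg_eq_0_iff_AE[OF i(1)] ab(3) by simp
      then have "AE t in lebesgue. (norm (f t + g t))\<^sup>2 = (norm (g t))\<^sup>2"
        by eventually_elim simp
      then have "(LINT t|lebesgue. (norm (f t + g t))\<^sup>2) = (LINT t|lebesgue. (norm (g t))\<^sup>2)"
        by (intro integral_cong_AE) (use i in auto)
      then show ?thesis using \<open>a = 0\<close> ab(4) by simp
    next
      assume "b = 0"
      then have "AE t in lebesgue. (norm (g t))\<^sup>2 = 0"
        using integral_nonneg_eq_0_iff_AE[OF i(2)] ab(4) by simp
      then have "AE t in lebesgue. (norm (f t + g t))\<^sup>2 = (norm (f t))\<^sup>2"
        by eventually_elim simp
      then have "(LINT t|lebesgue. (norm (f t + g t))\<^sup>2) = (LINT t|lebesgue. (norm (f t))\<^sup>2)"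
        by (intro integral_cong_AE) (use i in auto)
      then show ?thesis using \<open>b = 0\<close> ab(3) by simp
    qed
  next
    case False
    then have p: "a > 0" "b > 0" using ab by auto
    have *: "(norm (f t + g t))\<^sup>2 \<le> (1 + b / a) * (norm (f t))\<^sup>2 + (1 + a / b) * (norm (g t))\<^sup>2" for t
    proof -
      let ?x = "norm (f t)" and ?y = "norm (g t)"
      have "(norm (f t + g t))\<^sup>2 \<le> (?x + ?y)\<^sup>2"
        by (intro power_mono norm_triangle_ineq) auto
      also have "(?x + ?y)\<^sup>2 \<le> (1 + b / a) * ?x\<^sup>2 + (1 + a / b) * ?y\<^sup>2"
      proof -
        have "0 \<le> (b * ?x - a * ?y)\<^sup>2 / (a * b)" using p by simp
        also have "\<dots> = (1 + b / a) * ?x\<^sup>2 + (1 + a / b) * ?y\<^sup>2 - (?x + ?y)\<^sup>2"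
          using p by (simp add: field_simps power2_eq_square)
        finally show ?thesis by simp
      qed
      finally show ?thesis .
    qed
    have "(LINT t|lebesgue. (norm (f t + g t))\<^sup>2)
        \<le> (LINT t|lebesgue. (1 + b / a) * (norm (f t))\<^sup>2 + (1 + a / b) * (norm (g t))\<^sup>2)"
      using i * by (intro integral_mono) auto
    also have "\<dots> = (1 + b / a) * a\<^sup>2 + (1 + a / b) * b\<^sup>2"
      using i ab by simp
    also have "\<dots> = (a + b)\<^sup>2"
      using p by (simp add: field_simps power2_eq_square)
    finally show ?thesis .
  qed
  then have "sqrt (LINT t|lebesgue. (norm (f t + g t))\<^sup>2) \<le> a + b"
    using ab by (intro real_le_lsqrt) auto
  then show ?thesis unfolding a_def b_def .
qed

instantiation L2fun :: (real_normed_vector) real_normed_vector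
begin

lift_definition zero_L2fun :: "'a L2fun" is "\<lambda>t. 0"
  by (simp add: square_integrable_zero)

lift_definition plus_L2fun :: "'a L2fun \<Rightarrow> 'a L2fun \<Rightarrow> 'a L2fun" is "\<lambda>f g t. f t + g t"
  by (auto intro: square_integrable_add elim: AE_mp)

lift_definition scaleR_L2fun :: "real \<Rightarrow> 'a L2fun \<Rightarrow> 'a L2fun" is "\<lambda>c f t. c *\<^sub>R f t"
  by (auto intro: square_integrable_scaleR elim: AE_mp)

lift_definition uminus_L2fun :: "'a L2fun \<Rightarrow> 'a L2fun" is "\<lambda>f t. - f t"
  using square_integrable_scaleR[of _ "-1"] by (auto elim: AE_mp)

definition minus_L2fun :: "'a L2fun \<Rightarrow> 'a L2fun \<Rightarrow> 'a L2fun" where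
  "minus_L2fun f g = f + - g"

lift_definition norm_L2fun :: "'a L2fun \<Rightarrow> real" is "\<lambda>f. sqrt (LINT t|lebesgue. (norm (f t))\<^sup>2)"
proof -
  fix f g :: "real \<Rightarrow> 'a"
  assume *: "square_integrable f \<and> square_integrable g \<and> (AE t in lebesgue. f t = g t)"
  then have "AE t in lebesgue. (norm (f t))\<^sup>2 = (norm (g t))\<^sup>2"
    by (auto elim: AE_mp)
  then show "sqrt (LINT t|lebesgue. (norm (f t))\<^sup>2) = sqrt (LINT t|lebesgue. (norm (g t))\<^sup>2)"
    using * unfolding square_integrable_def by (auto intro!: integral_cong_AE)
qed

definition dist_L2fun :: "'a L2fun \<Rightarrow> 'a L2fun \<Rightarrow> real" where
  "dist_L2fun f g = norm (f - g)"

definition sgn_L2fun :: "'a L2fun \<Rightarrow> 'a L2fun" where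
  "sgn_L2fun f = inverse (norm f) *\<^sub>R f"

definition uniformity_L2fun :: "('a L2fun \<times> 'a L2fun) filter" where
  "uniformity_L2fun = (INF e\<in>{0<..}. principal {(x, y). dist x y < e})"

definition open_L2fun :: "'a L2fun set \<Rightarrow> bool" where
  "open_L2fun U = (\<forall>x\<in>U. eventually (\<lambda>(x', y). x' = x \<longrightarrow> y \<in> U) uniformity)"

instance
proof
  fix f g h :: "'a L2fun" and a b :: real and U :: "'a L2fun set"
  show "f + g + h = f + (g + h)"
    by transfer (auto intro!: square_integrable_add simp: add.assoc)
  show "f + g = g + f"
    by transfer (auto intro!: square_integrable_add simp: add.commute)
  show "0 + f = f" by transfer auto
  show "- f + f = 0"
    by transfer (auto intro: square_integrable_zero)
  show "f - g = f + - g" by (rule minus_L2fun_def)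
  show "a *\<^sub>R (f + g) = a *\<^sub>R f + a *\<^sub>R g"
    by transfer (auto intro!: square_integrable_add square_integrable_scaleR simp: scaleR_add_right)
  show "(a + b) *\<^sub>R f = a *\<^sub>R f + b *\<^sub>R f"
    by transfer (auto intro!: square_integrable_add square_integrable_scaleR simp: scaleR_add_left)
  show "a *\<^sub>R b *\<^sub>R f = (a * b) *\<^sub>R f"
    by transfer (auto intro!: square_integrable_scaleR)
  show "1 *\<^sub>R f = f" by transfer auto
  show "dist f g = norm (f - g)" by (rule dist_L2fun_def)
  show "sgn f = inverse (norm f) *\<^sub>R f" by (rule sgn_L2fun_def)
  show "uniformity = (INF e\<in>{0<..}. principal {(x::'a L2fun, y). dist x y < e})"
    by (rule uniformity_L2fun_def)
  show "open U = (\<forall>x\<in>U. eventually (\<lambda>(x', y). x' = x \<longrightarrow> y \<in> U) uniformity)"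
    by (rule open_L2fun_def)
  show "norm f = 0 \<longleftrightarrow> f = 0"
  proof transfer
    fix f :: "real \<Rightarrow> 'a"
    assume *: "square_integrable f \<and> square_integrable f \<and> (AE t in lebesgue. f t = f t)"
    then have i: "integrable lebesgue (\<lambda>t. (norm (f t))\<^sup>2)"
      unfolding square_integrable_def by auto
    have "(LINT t|lebesgue. (norm (f t))\<^sup>2) = 0 \<longleftrightarrow> (AE t in lebesgue. (norm (f t))\<^sup>2 = 0)"
      by (rule integral_nonneg_eq_0_iff_AE[OF i]) simp
    then show "(sqrt (LINT t|lebesgue. (norm (f t))\<^sup>2) = 0) \<longleftrightarrow>
      (square_integrable f \<and> square_integrable (\<lambda>t. 0::'a) \<and> (AE t in lebesgue. f t = 0))"
      using * square_integrable_zero by auto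
  qed
  show "norm (f + g) \<le> norm f + norm g"
    by transfer (auto intro: L2_triangle)
  show "norm (a *\<^sub>R f) = \<bar>a\<bar> * norm f"
    by transfer (simp add: power_mult_distrib real_sqrt_mult)
qed

end

text \<open>\<open>L\<^sub>2(\<Xi>; 'a)\<close> for \<open>\<Xi> = (0,T)\<close>, identified via extension by zero with the closed subspace of
  \<open>L\<^sub>2(\<real>; 'a)\<close> of the functions that vanish almost everywhere outside \<open>\<Xi>\<close>.\<close>

definition L2_on :: "real \<Rightarrow> 'a::real_normed_vector L2fun set" where
  "L2_on T = {w. AE t in lebesgue. t \<notin> {0<..<T} \<longrightarrow> rep_L2fun w t = 0}"


section \<open>Gelfand triple and the space \<open>X\<close>\<close>

text \<open>The embedding of \<open>V\<close> into \<open>H\<close> is an injective bounded linear map \<open>j\<close> with dense range;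
  \<open>V'\<close> is the type \<open>'v \<Rightarrow>\<^sub>L real\<close> with the operator norm.\<close>

definition gelfand_triple :: "('v::{real_inner,complete_space} \<Rightarrow>\<^sub>L 'h::{real_inner,complete_space}) \<Rightarrow> bool" where
  "gelfand_triple j \<longleftrightarrow> inj (blinfun_apply j) \<and> closure (range (blinfun_apply j)) = UNIV"

text \<open>\<open>H \<simeq> H' \<hookrightarrow> V'\<close>, i.e. \<open>h \<mapsto> (v \<mapsto> \<langle>h, v\<rangle>\<^sub>H)\<close>.\<close>

definition embed_dual :: "('v::real_normed_vector \<Rightarrow>\<^sub>L 'h::real_inner) \<Rightarrow> 'h \<Rightarrow> ('v \<Rightarrow>\<^sub>L real)" where
  "embed_dual j h = blinfun_inner_right h o\<^sub>L j"

definition test_functions :: "real \<Rightarrow> (real \<Rightarrow> real) set" where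
  "test_functions T = {\<phi>. (\<forall>k x. (deriv ^^ k) \<phi> differentiable at x) \<and>
     (\<exists>a b. 0 < a \<and> b < T \<and> (\<forall>x. x \<notin> {a..b} \<longrightarrow> \<phi> x = 0))}"

text \<open>The defining identity \<open>\<integral> \<phi>' w = - \<integral> \<phi> g\<close> holds in \<open>V'\<close>; it is written out by evaluating
  both Bochner integrals at \<open>v \<in> V\<close>.\<close>

definition has_weak_derivative ::
  "real \<Rightarrow> (real \<Rightarrow> 'v::real_normed_vector \<Rightarrow>\<^sub>L real) \<Rightarrow> (real \<Rightarrow> 'v \<Rightarrow>\<^sub>L real) \<Rightarrow> bool" where
  "has_weak_derivative T w g \<longleftrightarrow> (\<forall>\<phi>\<in>test_functions T. \<forall>v.
     (LINT t:{0<..<T}|lebesgue. deriv \<phi> t * w t v) = - (LINT t:{0<..<T}|lebesgue. \<phi> t * g t v))"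

text \<open>For \<open>w \<in> L\<^sub>2(\<Xi>;V)\<close>, \<open>w \<in> L\<^sub>2(\<Xi>;V')\<close> is automatic, so \<open>w \<in> H\<^sup>1(\<Xi>;V')\<close> just asks for
  a weak derivative in \<open>L\<^sub>2(\<Xi>;V')\<close>.\<close>

definition is_time_deriv ::
  "('v::{real_inner,complete_space} \<Rightarrow>\<^sub>L 'h::{real_inner,complete_space}) \<Rightarrow> real \<Rightarrow>
    'v L2fun \<Rightarrow> ('v \<Rightarrow>\<^sub>L real) L2fun \<Rightarrow> bool" where
  "is_time_deriv j T w g \<longleftrightarrow> g \<in> L2_on T \<and>
     has_weak_derivative T (\<lambda>t. embed_dual j (j (rep_L2fun w t))) (rep_L2fun g)"

definition X_space ::
  "('v::{real_inner,complete_space} \<Rightarrow>\<^sub>L 'h::{real_inner,complete_space}) \<Rightarrow> real \<Rightarrow> 'v L2fun set" where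
  "X_space j T = {w \<in> L2_on T. \<exists>g. is_time_deriv j T w g}"

definition time_deriv ::
  "('v::{real_inner,complete_space} \<Rightarrow>\<^sub>L 'h::{real_inner,complete_space}) \<Rightarrow> real \<Rightarrow>
    'v L2fun \<Rightarrow> ('v \<Rightarrow>\<^sub>L real) L2fun" where
  "time_deriv j T w = (THE g. is_time_deriv j T w g)"

definition X_norm ::
  "('v::{real_inner,complete_space} \<Rightarrow>\<^sub>L 'h::{real_inner,complete_space}) \<Rightarrow> real \<Rightarrow> 'v L2fun \<Rightarrow> real" where
  "X_norm j T w = sqrt ((norm w)\<^sup>2 + (norm (time_deriv j T w))\<^sup>2)"

text \<open>\<open>\<gamma>\<^sub>t w\<close> is the value at \<open>t\<close> of the representative of \<open>w\<close> in \<open>C([0,T]; H)\<close>.\<close>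

definition time_trace ::
  "('v::{real_inner,complete_space} \<Rightarrow>\<^sub>L 'h::{real_inner,complete_space}) \<Rightarrow> real \<Rightarrow> real \<Rightarrow> 'v L2fun \<Rightarrow> 'h" where
  "time_trace j T t w = (THE h. \<exists>f. continuous_on {0..T} f \<and>
     (AE s in lebesgue. s \<in> {0<..<T} \<longrightarrow> f s = j (rep_L2fun w s)) \<and> h = f t)"


section \<open>Dual spaces of subspaces\<close>

text \<open>The dual of a subspace \<open>S\<close> with norm \<open>n\<close>. Functionals on \<open>S\<close> are extensional functions, so that
  equality of functionals is equality on \<open>S\<close>, and the adjoint of a trivial embedding is
  \<^const>\<open>restrict\<close>. The norm \<^term>\<open>dual_norm S n F\<close> only depends on the values of \<open>F\<close> on \<open>S\<close>.\<close>

definition dual_space :: "'a::real_vector set \<Rightarrow> ('a \<Rightarrow> real) \<Rightarrow> ('a \<Rightarrow> real) set" where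
  "dual_space S n = {F \<in> extensional S.
     (\<forall>x\<in>S. \<forall>y\<in>S. F (x + y) = F x + F y) \<and> (\<forall>c. \<forall>x\<in>S. F (c *\<^sub>R x) = c * F x) \<and>
     (\<exists>C. \<forall>x\<in>S. \<bar>F x\<bar> \<le> C * n x)}"

definition dual_norm :: "'a::real_vector set \<Rightarrow> ('a \<Rightarrow> real) \<Rightarrow> ('a \<Rightarrow> real) \<Rightarrow> real" where
  "dual_norm S n F = (SUP x\<in>{x\<in>S. n x \<le> 1}. \<bar>F x\<bar>)"

definition prod_norm :: "('a \<Rightarrow> real) \<Rightarrow> ('b \<Rightarrow> real) \<Rightarrow> 'a \<times> 'b \<Rightarrow> real" where
  "prod_norm n m p = n (fst p) + m (snd p)"

definition finite_dim :: "'a::real_vector set \<Rightarrow> bool" where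
  "finite_dim S \<longleftrightarrow> (\<exists>B. finite B \<and> S \<subseteq> span B)"


section \<open>The operators\<close>

definition dt :: "('v::{real_inner,complete_space} \<Rightarrow>\<^sub>L 'h::{real_inner,complete_space}) \<Rightarrow> real \<Rightarrow>
    'v L2fun \<Rightarrow> 'v L2fun \<Rightarrow> real" where
  "dt j T w = (\<lambda>v\<in>L2_on T. LINT t:{0<..<T}|lebesgue. (rep_L2fun (time_deriv j T w) t) (rep_L2fun v t))"

definition op_A :: "real \<Rightarrow> (real \<Rightarrow> 'v::real_normed_vector \<Rightarrow> ('v \<Rightarrow>\<^sub>L real)) \<Rightarrow>
    'v L2fun \<Rightarrow> 'v L2fun \<Rightarrow> real" where
  "op_A T A w = (\<lambda>v\<in>L2_on T. LINT t:{0<..<T}|lebesgue. (A t (rep_L2fun w t)) (rep_L2fun v t))"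

text \<open>The defining integral of \<open>A\<close> exists and \<open>A\<close> maps \<open>Y\<close> into \<open>Y'\<close>. The family \<open>A(t)\<close> is total in
  \<open>t\<close>, but its values outside \<open>\<Xi>\<close> or on a null set are irrelevant.\<close>

definition A_well_defined :: "real \<Rightarrow> (real \<Rightarrow> 'v::real_normed_vector \<Rightarrow> ('v \<Rightarrow>\<^sub>L real)) \<Rightarrow> bool" where
  "A_well_defined T A \<longleftrightarrow>
     (\<forall>w\<in>L2_on T. \<forall>v\<in>L2_on T.
        set_integrable lebesgue {0<..<T} (\<lambda>t. (A t (rep_L2fun w t)) (rep_L2fun v t))) \<and>
     (\<forall>w\<in>L2_on T. op_A T A w \<in> dual_space (L2_on T) norm)"

definition A_Lipschitz :: "real \<Rightarrow> (real \<Rightarrow> 'v::real_normed_vector \<Rightarrow> ('v \<Rightarrow>\<^sub>L real)) \<Rightarrow> real \<Rightarrow> bool" where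
  "A_Lipschitz T A L \<longleftrightarrow> (\<forall>w\<in>L2_on T. \<forall>v\<in>L2_on T.
     dual_norm (L2_on T) norm (op_A T A w - op_A T A v) \<le> L * norm (w - v))"

definition A_strongly_monotone :: "real \<Rightarrow> (real \<Rightarrow> 'v::real_normed_vector \<Rightarrow> ('v \<Rightarrow>\<^sub>L real)) \<Rightarrow> real \<Rightarrow> bool" where
  "A_strongly_monotone T A m \<longleftrightarrow> (\<forall>w\<in>L2_on T. \<forall>v\<in>L2_on T.
     (op_A T A w - op_A T A v) (w - v) \<ge> m * (norm (w - v))\<^sup>2)"

definition closed_in_X :: "('v::{real_inner,complete_space} \<Rightarrow>\<^sub>L 'h::{real_inner,complete_space}) \<Rightarrow> real \<Rightarrow>
    'v L2fun set \<Rightarrow> bool" where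
  "closed_in_X j T S \<longleftrightarrow> (\<forall>s w. (\<forall>n::nat. s n \<in> S) \<and> w \<in> X_space j T \<and>
     (\<lambda>n. X_norm j T (s n - w)) \<longlonglongrightarrow> 0 \<longrightarrow> w \<in> S)"

text \<open>\<open>A\<^sub>Y\<^sup>\<delta>\<close> and \<open>A\<^sub>X\<^sup>\<delta>\<close> for \<open>S = Y\<^sup>\<delta>\<close> and \<open>S = X\<^sup>\<delta>\<close>.\<close>

definition A_delta :: "real \<Rightarrow> (real \<Rightarrow> 'v::real_normed_vector \<Rightarrow> ('v \<Rightarrow>\<^sub>L real)) \<Rightarrow>
    'v L2fun set \<Rightarrow> 'v L2fun \<Rightarrow> 'v L2fun \<Rightarrow> real" where
  "A_delta T A S w = restrict (op_A T A w) S"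

definition dt_delta :: "('v::{real_inner,complete_space} \<Rightarrow>\<^sub>L 'h::{real_inner,complete_space}) \<Rightarrow> real \<Rightarrow>
    'v L2fun set \<Rightarrow> 'v L2fun \<Rightarrow> 'v L2fun \<Rightarrow> real" where
  "dt_delta j T Yd u = restrict (dt j T u) Yd"

definition dt_delta_adj :: "('v::{real_inner,complete_space} \<Rightarrow>\<^sub>L 'h::{real_inner,complete_space}) \<Rightarrow> real \<Rightarrow>
    'v L2fun set \<Rightarrow> 'v L2fun set \<Rightarrow> 'v L2fun \<Rightarrow> 'v L2fun \<Rightarrow> real" where
  "dt_delta_adj j T Yd Xd \<theta> = (\<lambda>z\<in>Xd. dt_delta j T Yd z \<theta>)"

definition trace_adj :: "('v::{real_inner,complete_space} \<Rightarrow>\<^sub>L 'h::{real_inner,complete_space}) \<Rightarrow> real \<Rightarrow>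
    'v L2fun set \<Rightarrow> 'h \<Rightarrow> 'v L2fun \<Rightarrow> real" where
  "trace_adj j T Xd h = (\<lambda>z\<in>Xd. h \<bullet> time_trace j T T z)"

definition Xd_norm :: "('v::{real_inner,complete_space} \<Rightarrow>\<^sub>L 'h::{real_inner,complete_space}) \<Rightarrow> real \<Rightarrow>
    'v L2fun set \<Rightarrow> 'v L2fun \<Rightarrow> real" where
  "Xd_norm j T Yd z = sqrt ((norm z)\<^sup>2 + (dual_norm Yd norm (dt_delta j T Yd z))\<^sup>2
     + (norm (time_trace j T T z))\<^sup>2)"

definition N_delta :: "('v::{real_inner,complete_space} \<Rightarrow>\<^sub>L 'h::{real_inner,complete_space}) \<Rightarrow> real \<Rightarrow>
    (real \<Rightarrow> 'v \<Rightarrow> ('v \<Rightarrow>\<^sub>L real)) \<Rightarrow> 'v L2fun set \<Rightarrow> 'v L2fun set \<Rightarrow>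
    'v L2fun \<times> 'v L2fun \<Rightarrow> ('v L2fun \<Rightarrow> real) \<times> ('v L2fun \<Rightarrow> real)" where
  "N_delta j T A Yd Xd = (\<lambda>(\<theta>, u).
     (\<lambda>v\<in>Yd. A_delta T A Yd \<theta> v + dt_delta j T Yd u v,
      \<lambda>z\<in>Xd. dt_delta_adj j T Yd Xd \<theta> z
        - (A_delta T A Xd u z + trace_adj j T Xd (time_trace j T T u) z)))"

definition m_S :: "real \<Rightarrow> real \<Rightarrow> real" where
  "m_S L m = min 1 (min m (m / L\<^sup>2))"

definition L_N_inv :: "real \<Rightarrow> real \<Rightarrow> real" where
  "L_N_inv L m = 1 / m + max 1 (1 / m) * (1 / m_S L m) * (1 + 1 / m)"

end

theory Submission
  imports Defs
begin

text \<open>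
  The first equation of the saddle point system is solved for \<open>\<theta>\<close>: on \<open>Y\<^sup>\<delta>\<close> the operator \<open>A\<close> is
  Lipschitz and strongly monotone, so \<open>\<theta> = A\<inverse> (f - d\<^sub>t u)\<close>. Insertion into the second equation leaves the
  Schur complement equation for \<open>u\<close>, with the operator
  \<open>u \<mapsto> - d\<^sub>t' A\<inverse> (f - d\<^sub>t u) + A u + \<gamma>\<^sub>T' \<gamma>\<^sub>T u\<close>. Inverses of strongly monotone Lipschitz operators are again
  strongly monotone, with constant \<open>m / L\<^sup>2\<close>; hence the three summands are coercive for the three
  parts of the norm of \<open>X\<^sup>\<delta>\<close>, and the Schur complement is strongly monotone with constant
  \<open>min 1 (min m (m / L\<^sup>2))\<close> and Lipschitz. Zarantonello's theorem gives unique solvability, and the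
  same monotonicity estimates give the Lipschitz constant of the inverse
  (\<open>solution_exists\<close>, \<open>solution_Lipschitz\<close>).

  Zarantonello's theorem needs \<open>X\<^sup>\<delta>\<close> to be a Hilbert space for its norm. The map
  \<open>u \<mapsto> (u, d\<^sub>t u, \<gamma>\<^sub>T u)\<close>, with \<open>d\<^sub>t u\<close> replaced by its Riesz representative in \<open>Y\<^sup>\<delta>\<close>, is an isometry into
  \<open>L\<^sub>2(V) \<times> L\<^sub>2(V) \<times> H\<close>, so the point is that it is linear with complete image. In finite dimensions
  this only needs linearity of the trace, but even that rests on the embedding of
  \<open>X = L\<^sub>2(V) \<inter> H\<^sup>1(V')\<close> into \<open>C([0,T]; H)\<close>; for \<open>X\<^sup>\<delta> = X\<close> the boundedness of the trace is needed as well.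

  For continuously differentiable \<open>V\<close>-valued functions the embedding is the classical energy estimate
  (\<open>energy_bound\<close>). Such functions are dense in \<open>X\<close>: regarded as the closed subspace of all pairs \<open>(w, y)\<close> of a
  function and the Riesz representative of its derivative, \<open>X\<close> can be tested mode by mode against
  \<open>cos (k \<pi> t / T) v\<close>. The derivative of such a mode is a sine, which vanishes at both end points and is
  therefore admissible in the weak formulation after cutting it off near them
  (\<open>weak_derivative_sin\<close>); this makes all Fourier coefficients of a pair orthogonal to the
  continuously differentiable ones zero (\<open>deriv_graph_subset_closure_C1_graph\<close>), and the
  trigonometric systems are total by the Weierstrass theorem. The sine modes also show that weak
  derivatives are unique.
\<close>


section \<open>Square integrable functions with values in a Banach space\<close>

lemma Quotient3_L2fun_rel:
  "Quotient3 (\<lambda>f g. square_integrable f \<and> square_integrable g \<and> (AE t in lebesgue. f t = g t))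
     abs_L2fun rep_L2fun"
  by (rule Quotient3_L2fun)

lemma square_integrable_rep [simp]: "square_integrable (rep_L2fun w)"
  using Quotient3_rep_reflp[OF Quotient3_L2fun_rel] by blast

lemma abs_rep_L2fun: "abs_L2fun (rep_L2fun w) = w"
  by (rule Quotient3_abs_rep[OF Quotient3_L2fun_rel])

lemma rep_abs_L2fun:
  "square_integrable f \<Longrightarrow> AE t in lebesgue. rep_L2fun (abs_L2fun f) t = f t"
  using rep_abs_rsp_left[OF Quotient3_L2fun_rel, of f f] by auto

lemma abs_L2fun_cong:
  assumes "square_integrable f" "square_integrable g" "AE t in lebesgue. f t = g t"
  shows "abs_L2fun f = abs_L2fun g"
  using Quotient3_rel_abs[OF Quotient3_L2fun_rel] assms by blast

lemma L2fun_eqI: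
  assumes "AE t in lebesgue. rep_L2fun w t = rep_L2fun z t"
  shows "w = z"
  using abs_L2fun_cong[of "rep_L2fun w" "rep_L2fun z"] assms by (simp add: abs_rep_L2fun)

lemma abs_L2fun_eqI:
  assumes "square_integrable f" "AE t in lebesgue. f t = rep_L2fun z t"
  shows "abs_L2fun f = z"
  using abs_L2fun_cong[of f "rep_L2fun z"] assms by (simp add: abs_rep_L2fun)

lemma rep_L2fun_add:
  "AE t in lebesgue. rep_L2fun (w + z) t = rep_L2fun w t + rep_L2fun z t"
proof -
  have "w + z = abs_L2fun (\<lambda>t. rep_L2fun w t + rep_L2fun z t)"
    by (metis abs_rep_L2fun plus_L2fun.abs_eq square_integrable_rep AE_I2)
  then show ?thesis
    using rep_abs_L2fun[OF square_integrable_add[OF square_integrable_rep[of w] square_integrable_rep[of z]]]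
    by simp
qed

lemma rep_L2fun_scaleR: "AE t in lebesgue. rep_L2fun (c *\<^sub>R w) t = c *\<^sub>R rep_L2fun w t"
proof -
  have "c *\<^sub>R w = abs_L2fun (\<lambda>t. c *\<^sub>R rep_L2fun w t)"
    by (metis abs_rep_L2fun scaleR_L2fun.abs_eq square_integrable_rep AE_I2)
  then show ?thesis
    using rep_abs_L2fun[OF square_integrable_scaleR[OF square_integrable_rep[of w]]] by simp
qed

lemma rep_L2fun_zero: "AE t in lebesgue. rep_L2fun (0::'a::real_normed_vector L2fun) t = 0"
  using rep_L2fun_scaleR[of 0 "0::'a L2fun"] by simp

lemma square_integrable_diff:
  assumes "square_integrable f" "square_integrable g"
  shows "square_integrable (\<lambda>t. f t - g t)"
  using square_integrable_add[OF assms(1) square_integrable_scaleR[OF assms(2), of "-1"]] by simp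

lemma abs_L2fun_add:
  assumes "square_integrable f" "square_integrable g"
  shows "abs_L2fun (\<lambda>t. f t + g t) = abs_L2fun f + abs_L2fun g"
  using assms by (metis plus_L2fun.abs_eq AE_I2)

lemma abs_L2fun_scaleR:
  assumes "square_integrable f"
  shows "abs_L2fun (\<lambda>t. c *\<^sub>R f t) = c *\<^sub>R abs_L2fun f"
  using assms by (metis scaleR_L2fun.abs_eq AE_I2)

lemma abs_L2fun_diff:
  assumes "square_integrable f" "square_integrable g"
  shows "abs_L2fun (\<lambda>t. f t - g t) = abs_L2fun f - abs_L2fun g"
  using abs_L2fun_add[OF assms(1) square_integrable_scaleR[OF assms(2), of "-1"]]
    abs_L2fun_scaleR[OF assms(2), of "-1"] by simp

lemma norm_abs_L2fun:
  assumes "square_integrable f"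
  shows "(norm (abs_L2fun f))\<^sup>2 = (LINT t|lebesgue. (norm (f t))\<^sup>2)"
proof -
  have "norm (abs_L2fun f) = sqrt (LINT t|lebesgue. (norm (f t))\<^sup>2)"
    using assms by (metis norm_L2fun.abs_eq AE_I2)
  then show ?thesis by (simp add: integral_nonneg_AE)
qed

lemma norm_L2fun_square: "(norm w)\<^sup>2 = (LINT t|lebesgue. (norm (rep_L2fun w t))\<^sup>2)"
  using norm_abs_L2fun[OF square_integrable_rep[of w]] by (simp add: abs_rep_L2fun)

lemma integrable_norm_square:
  "square_integrable f \<Longrightarrow> integrable lebesgue (\<lambda>t. (norm (f t))\<^sup>2)"
  unfolding square_integrable_def by simp

lemma strongly_measurable_bounded_linear:
  assumes "strongly_measurable M f" "bounded_linear F"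
  shows "strongly_measurable M (\<lambda>t. F (f t))"
proof -
  obtain s where s: "\<And>n. simple_function M (s n)" "AE x in M. (\<lambda>n::nat. s n x) \<longlonglongrightarrow> f x"
    using assms(1) unfolding strongly_measurable_def by blast
  have "AE x in M. (\<lambda>n. F (s n x)) \<longlonglongrightarrow> F (f x)"
    using s(2) by eventually_elim (rule bounded_linear.tendsto[OF assms(2)])
  then show ?thesis
    using simple_function_compose1[OF s(1), of F]
    unfolding strongly_measurable_def by (intro exI[of _ "\<lambda>n x. F (s n x)"]) auto
qed

lemma square_integrable_bounded_linear:
  assumes f: "square_integrable f" and F: "bounded_linear F"
  shows "square_integrable (\<lambda>t. F (f t))"
proof -
  have sm: "strongly_measurable lebesgue (\<lambda>t. F (f t))"
    using strongly_measurable_bounded_linear f F unfolding square_integrable_def by blast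
  obtain K where K: "\<And>x. norm (F x) \<le> norm x * K" "K > 0"
    using bounded_linear.pos_bounded[OF F] by blast
  have "integrable lebesgue (\<lambda>t. (norm (f t))\<^sup>2 * K\<^sup>2)"
    using f unfolding square_integrable_def by auto
  then have "integrable lebesgue (\<lambda>t. (norm (F (f t)))\<^sup>2)"
  proof (rule Bochner_Integration.integrable_bound)
    show "(\<lambda>t. (norm (F (f t)))\<^sup>2) \<in> borel_measurable lebesgue"
      using strongly_measurable_norm[OF sm] by measurable
    have "(norm (F x))\<^sup>2 \<le> (norm x)\<^sup>2 * K\<^sup>2" for x
      using power_mono[OF K(1)[of x], of 2] by (simp add: power_mult_distrib)
    then show "AE t in lebesgue. norm ((norm (F (f t)))\<^sup>2) \<le> norm ((norm (f t))\<^sup>2 * K\<^sup>2)"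
      by (intro AE_I2) simp
  qed
  with sm show ?thesis unfolding square_integrable_def by simp
qed

definition L2map :: "('a::real_normed_vector \<Rightarrow>\<^sub>L 'b::real_normed_vector) \<Rightarrow> 'a L2fun \<Rightarrow> 'b L2fun" where
  "L2map F w = abs_L2fun (\<lambda>t. F (rep_L2fun w t))"

lemma square_integrable_L2map: "square_integrable (\<lambda>t. blinfun_apply F (rep_L2fun w t))"
  by (rule square_integrable_bounded_linear[OF square_integrable_rep blinfun.bounded_linear_right])

lemma rep_L2map: "AE t in lebesgue. rep_L2fun (L2map F w) t = F (rep_L2fun w t)"
  unfolding L2map_def by (rule rep_abs_L2fun[OF square_integrable_L2map])

lemma L2map_abs:
  assumes "square_integrable f"
  shows "L2map F (abs_L2fun f) = abs_L2fun (\<lambda>t. F (f t))"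
proof -
  have "AE t in lebesgue. F (rep_L2fun (abs_L2fun f) t) = F (f t)"
    using rep_abs_L2fun[OF assms] by eventually_elim simp
  then show ?thesis
    unfolding L2map_def
    by (rule abs_L2fun_cong[OF square_integrable_L2map
        square_integrable_bounded_linear[OF assms blinfun.bounded_linear_right]])
qed

lemma norm_L2map_le: "norm (L2map F w) \<le> norm F * norm w"
proof -
  have "(norm (L2map F w))\<^sup>2 = (LINT t|lebesgue. (norm (F (rep_L2fun w t)))\<^sup>2)"
    unfolding L2map_def by (rule norm_abs_L2fun[OF square_integrable_L2map])
  also have "\<dots> \<le> (LINT t|lebesgue. (norm F)\<^sup>2 * (norm (rep_L2fun w t))\<^sup>2)"
  proof (rule integral_mono)
    show "integrable lebesgue (\<lambda>t. (norm F)\<^sup>2 * (norm (rep_L2fun w t))\<^sup>2)"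
      by (intro integrable_mult_right integrable_norm_square square_integrable_rep)
    show "integrable lebesgue (\<lambda>t. (norm (F (rep_L2fun w t)))\<^sup>2)"
      by (intro integrable_norm_square square_integrable_L2map)
    fix t
    show "(norm (F (rep_L2fun w t)))\<^sup>2 \<le> (norm F)\<^sup>2 * (norm (rep_L2fun w t))\<^sup>2"
      using power_mono[OF norm_blinfun[of F "rep_L2fun w t"], of 2] by (simp add: power_mult_distrib)
  qed
  also have "\<dots> = (norm F * norm w)\<^sup>2"
    by (simp add: power_mult_distrib norm_L2fun_square)
  finally show ?thesis by (rule power2_le_imp_le) simp
qed

lemma bounded_linear_L2map: "bounded_linear (L2map F)"
proof (rule bounded_linear_intro[where K="norm F"])
  fix w z
  show "L2map F (w + z) = L2map F w + L2map F z"
  proof (rule L2fun_eqI)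
    show "AE t in lebesgue. rep_L2fun (L2map F (w + z)) t = rep_L2fun (L2map F w + L2map F z) t"
      using rep_L2map[of F "w + z"] rep_L2map[of F w] rep_L2map[of F z] rep_L2fun_add[of w z]
        rep_L2fun_add[of "L2map F w" "L2map F z"]
      by eventually_elim (simp add: blinfun.add_right)
  qed
  fix c
  show "L2map F (c *\<^sub>R w) = c *\<^sub>R L2map F w"
  proof (rule L2fun_eqI)
    show "AE t in lebesgue. rep_L2fun (L2map F (c *\<^sub>R w)) t = rep_L2fun (c *\<^sub>R L2map F w) t"
      using rep_L2map[of F "c *\<^sub>R w"] rep_L2map[of F w] rep_L2fun_scaleR[of c w]
        rep_L2fun_scaleR[of c "L2map F w"]
      by eventually_elim (simp add: blinfun.scaleR_right)
  qed
  show "norm (L2map F w) \<le> norm w * norm F"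
    using norm_L2map_le[of F w] by (simp add: mult.commute)
qed

text \<open>Discarding the values of an approximating simple function wherever they exceed twice
  the norm of the limit keeps the approximation pointwise and makes it dominated, so simple
  functions are dense.\<close>

lemma simple_dense_L2:
  fixes f :: "real \<Rightarrow> 'a::real_normed_vector"
  assumes f: "square_integrable f" and e: "e > 0"
  shows "\<exists>s. simple_function lebesgue s \<and> square_integrable s \<and> norm (abs_L2fun f - abs_L2fun s) < e"
proof -
  have fsm: "strongly_measurable lebesgue f"
    using f unfolding square_integrable_def by simp
  then obtain s where s: "\<And>n. simple_function lebesgue (s n)"
    and lim: "AE x in lebesgue. (\<lambda>n::nat. s n x) \<longlonglongrightarrow> f x"
    unfolding strongly_measurable_def by blast
  define r where "r n t = (if norm (s n t) \<le> 2 * norm (f t) then s n t else 0)" for n t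
  have nf: "(\<lambda>t. norm (f t)) \<in> borel_measurable lebesgue"
    by (rule strongly_measurable_norm[OF fsm])
  have ns: "(\<lambda>t. norm (s n t)) \<in> borel_measurable lebesgue" for n
    using borel_measurable_simple_function[OF simple_function_compose1[OF s[of n], of norm]] .
  have r: "simple_function lebesgue (r n)" for n
    unfolding r_def
  proof (rule simple_function_If[OF s])
    show "{t \<in> space lebesgue. norm (s n t) \<le> 2 * norm (f t)} \<in> sets lebesgue"
      by (rule borel_measurable_le[OF ns borel_measurable_times[OF borel_measurable_const nf]])
  qed simp
  have rsm: "strongly_measurable lebesgue (r n)" for n
    unfolding strongly_measurable_def by (rule exI[of _ "\<lambda>_. r n"]) (simp add: r)
  have rle: "norm (r n t) \<le> 2 * norm (f t)" for n t
    unfolding r_def by simp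
  have rsq: "square_integrable (r n)" for n
    unfolding square_integrable_def
  proof
    show "integrable lebesgue (\<lambda>t. (norm (r n t))\<^sup>2)"
    proof (rule Bochner_Integration.integrable_bound)
      show "integrable lebesgue (\<lambda>t. 4 * (norm (f t))\<^sup>2)"
        using integrable_norm_square[OF f] by simp
      show "AE t in lebesgue. norm ((norm (r n t))\<^sup>2) \<le> norm (4 * (norm (f t))\<^sup>2)"
        using power_mono[OF rle[of n], of _ 2] by (intro AE_I2) (simp add: power_mult_distrib)
    qed (intro borel_measurable_power strongly_measurable_norm rsm)
  qed (rule rsm)
  have rlim: "AE t in lebesgue. (\<lambda>n. r n t) \<longlonglongrightarrow> f t"
    using lim
  proof eventually_elim
    fix t assume l: "(\<lambda>n. s n t) \<longlonglongrightarrow> f t"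
    show "(\<lambda>n. r n t) \<longlonglongrightarrow> f t"
    proof (cases "f t = 0")
      case True
      then have "r n t = 0" for n using rle[of n t] by simp
      then show ?thesis using True by simp
    next
      case False
      then have "eventually (\<lambda>n. norm (s n t) < 2 * norm (f t)) sequentially"
        using order_tendstoD(2)[OF tendsto_norm[OF l], of "2 * norm (f t)"] by simp
      then have "eventually (\<lambda>n. s n t = r n t) sequentially"
        by eventually_elim (simp add: r_def)
      then show ?thesis using l by (rule Lim_transform_eventually[rotated])
    qed
  qed
  have d: "square_integrable (\<lambda>t. f t - r n t)" for n
    by (rule square_integrable_diff[OF f rsq])
  have "(\<lambda>n. LINT t|lebesgue. (norm (f t - r n t))\<^sup>2) \<longlonglongrightarrow> (LINT (t::real)|lebesgue. (0::real))"
  proof (rule Bochner_Integration.integral_dominated_convergence)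
    show "integrable lebesgue (\<lambda>t. 9 * (norm (f t))\<^sup>2)"
      using integrable_norm_square[OF f] by simp
    show "AE t in lebesgue. (\<lambda>n. (norm (f t - r n t))\<^sup>2) \<longlonglongrightarrow> 0"
      using rlim
    proof eventually_elim
      fix t assume "(\<lambda>n. r n t) \<longlonglongrightarrow> f t"
      then have "(\<lambda>n. (norm (f t - r n t))\<^sup>2) \<longlonglongrightarrow> (norm (f t - f t))\<^sup>2"
        by (intro tendsto_intros)
      then show "(\<lambda>n. (norm (f t - r n t))\<^sup>2) \<longlonglongrightarrow> 0" by simp
    qed
    have "(norm (f t - r n t))\<^sup>2 \<le> (3 * norm (f t))\<^sup>2" for t n
      using norm_triangle_ineq4[of "f t" "r n t"] rle[of n t] by (intro power_mono) simp_all
    then show "AE t in lebesgue. norm ((norm (f t - r n t))\<^sup>2) \<le> 9 * (norm (f t))\<^sup>2" for n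
      by (intro AE_I2) (simp add: power_mult_distrib)
    show "(\<lambda>t. (norm (f t - r n t))\<^sup>2) \<in> borel_measurable lebesgue" for n
      by (rule borel_measurable_integrable[OF integrable_norm_square[OF d]])
  qed simp
  then have "eventually (\<lambda>n. (LINT t|lebesgue. (norm (f t - r n t))\<^sup>2) < e\<^sup>2) sequentially"
    by (rule order_tendstoD(2)) (use e in simp)
  then obtain n where "(LINT t|lebesgue. (norm (f t - r n t))\<^sup>2) < e\<^sup>2"
    by (meson eventually_sequentially order_refl)
  then have "(norm (abs_L2fun f - abs_L2fun (r n)))\<^sup>2 < e\<^sup>2"
    using norm_abs_L2fun[OF d[of n]] by (simp add: abs_L2fun_diff[OF f rsq])
  then have "norm (abs_L2fun f - abs_L2fun (r n)) < e"
    using e by (simp add: power_less_imp_less_base)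
  then show ?thesis by (intro exI[of _ "r n"] conjI r rsq)
qed

lemma Cauchy_if_summable_increments:
  fixes x :: "nat \<Rightarrow> 'a::real_normed_vector"
  assumes a: "summable a" and le: "\<And>n. norm (x (Suc n) - x n) \<le> a n"
  shows "Cauchy x"
proof (rule CauchyI')
  fix e :: real assume "e > 0"
  then obtain N where N: "\<And>m n. m \<ge> N \<Longrightarrow> norm (sum a {m..<n}) < e"
    using a unfolding summable_Cauchy by blast
  have tel: "norm (x (m + k) - x m) \<le> sum a {m..<m + k}" for m k
  proof (induction k)
    case (Suc k)
    have "norm (x (m + Suc k) - x m) \<le> norm (x (Suc (m + k)) - x (m + k)) + norm (x (m + k) - x m)"
      using norm_triangle_ineq[of "x (Suc (m + k)) - x (m + k)" "x (m + k) - x m"] by simp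
    then show ?case using Suc le[of "m + k"] by simp
  qed simp
  show "\<exists>M. \<forall>m\<ge>M. \<forall>n>m. dist (x m) (x n) < e"
  proof (intro exI[of _ N] allI impI)
    fix m n assume "N \<le> m" "m < n"
    then show "dist (x m) (x n) < e"
      using tel[of m "n - m"] N[of m n] by (simp add: dist_norm norm_minus_commute)
  qed
qed

text \<open>A sequence of functions that is rapidly Cauchy in \<open>L\<^sub>2\<close> converges almost everywhere: the
  weights \<open>2^n\<close> make \<open>\<Sum>n. 2^n * \<parallel>s (Suc n) t - s n t\<parallel>\<^sup>2\<close> integrable, and where this series is finite
  the increments are dominated by a geometric sequence.\<close>

lemma rapidly_Cauchy_AE_convergent:
  fixes s :: "nat \<Rightarrow> real \<Rightarrow> 'a::{real_normed_vector, complete_space}"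
  assumes s: "\<And>n. square_integrable (s n)"
    and le: "\<And>n. norm (abs_L2fun (s (Suc n)) - abs_L2fun (s n)) \<le> (1/2) ^ n"
  shows "AE t in lebesgue. convergent (\<lambda>n. s n t)"
proof -
  define h where "h n t = (norm (s (Suc n) t - s n t))\<^sup>2" for n t
  have d: "square_integrable (\<lambda>t. s (Suc n) t - s n t)" for n
    by (rule square_integrable_diff[OF s s])
  have hi: "integrable lebesgue (h n)" for n
    unfolding h_def by (rule integrable_norm_square[OF d])
  have hm: "h n \<in> borel_measurable lebesgue" for n
    by (rule borel_measurable_integrable[OF hi])
  have hb: "integral\<^sup>L lebesgue (h n) \<le> (1/4) ^ n" for n
  proof -
    have "integral\<^sup>L lebesgue (h n) = (norm (abs_L2fun (s (Suc n)) - abs_L2fun (s n)))\<^sup>2"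
      unfolding h_def using norm_abs_L2fun[OF d[of n]] by (simp add: abs_L2fun_diff[OF s s])
    also have "\<dots> \<le> ((1/2) ^ n)\<^sup>2" by (intro power_mono le) simp
    also have "((1/2::real) ^ n)\<^sup>2 = ((1/2)\<^sup>2) ^ n" by (metis power_mult mult.commute)
    finally show ?thesis by (simp add: power_divide)
  qed
  have "(\<integral>\<^sup>+ t. (\<Sum>n. ennreal (2 ^ n * h n t)) \<partial>lebesgue)
      = (\<Sum>n. \<integral>\<^sup>+ t. ennreal (2 ^ n * h n t) \<partial>lebesgue)"
    using hm by (intro nn_integral_suminf) measurable
  also have "\<dots> \<le> (\<Sum>n. ennreal ((1/2) ^ n))"
  proof (rule suminf_le)
    fix n
    have "(\<integral>\<^sup>+ t. ennreal (2 ^ n * h n t) \<partial>lebesgue) = ennreal (2 ^ n * integral\<^sup>L lebesgue (h n))"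
      using nn_integral_eq_integral[OF integrable_mult_right[OF hi[of n], of "2 ^ n"]]
      by (simp add: h_def[abs_def])
    also have "\<dots> \<le> ennreal (2 ^ n * (1/4) ^ n)"
      using hb[of n] by (intro ennreal_leI mult_left_mono) auto
    also have "(2::real) ^ n * (1/4) ^ n = (1/2) ^ n" by (simp flip: power_mult_distrib)
    finally show "(\<integral>\<^sup>+ t. ennreal (2 ^ n * h n t) \<partial>lebesgue) \<le> ennreal ((1/2) ^ n)" .
  qed auto
  also have "\<dots> = ennreal (\<Sum>n. (1/2) ^ n)"
    by (rule suminf_ennreal2) (auto intro: summable_geometric)
  also have "\<dots> < \<infinity>" by simp
  finally have fin: "(\<integral>\<^sup>+ t. (\<Sum>n. ennreal (2 ^ n * h n t)) \<partial>lebesgue) \<noteq> \<infinity>" by simp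
  have "AE t in lebesgue. (\<Sum>n. ennreal (2 ^ n * h n t)) \<noteq> \<infinity>"
    by (rule nn_integral_noteq_infinite[OF _ fin]) (use hm in measurable)
  then show ?thesis
  proof eventually_elim
    fix t assume "(\<Sum>n. ennreal (2 ^ n * h n t)) \<noteq> \<infinity>"
    then have "summable (\<lambda>n. 2 ^ n * h n t)"
      by (intro summable_suminf_not_top) (auto simp: h_def top_ennreal_def infinity_ennreal_def)
    then have "Bseq (\<lambda>n. 2 ^ n * h n t)"
      by (rule summable_imp_Bseq)
    then obtain C where C: "C > 0" "\<And>n. norm (2 ^ n * h n t) \<le> C"
      by (auto simp: Bseq_def)
    have inc: "norm (s (Suc n) t - s n t) \<le> sqrt C * (sqrt (1/2)) ^ n" for n
    proof -
      have "h n t \<le> C * (1/2) ^ n"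
        using C(2)[of n] by (simp add: h_def field_simps abs_mult)
      then have "sqrt (h n t) \<le> sqrt (C * (1/2) ^ n)" by (rule real_sqrt_le_mono)
      then show ?thesis by (simp add: h_def real_sqrt_mult real_sqrt_power real_sqrt_divide)
    qed
    have "sqrt (1/2::real) < 1" by (simp add: real_sqrt_lt_1_iff)
    then have "summable (\<lambda>n. sqrt C * (sqrt (1/2)) ^ n)"
      by (intro summable_mult summable_geometric) simp
    then have "Cauchy (\<lambda>n. s n t)"
      by (rule Cauchy_if_summable_increments) (rule inc)
    then show "convergent (\<lambda>n. s n t)" by (rule Cauchy_convergent)
  qed
qed

text \<open>The bound on the norms passes to the limit by Fatou's lemma for the squared norms.\<close>

lemma L2_Fatou:
  fixes g :: "real \<Rightarrow> 'a::real_normed_vector"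
  assumes gm: "strongly_measurable lebesgue g"
    and lim: "AE t in lebesgue. (\<lambda>n. f n t) \<longlonglongrightarrow> g t"
    and f: "\<And>n. square_integrable (f n)"
    and le: "eventually (\<lambda>n. norm (abs_L2fun (f n)) \<le> C) sequentially"
  shows "square_integrable g" and "norm (abs_L2fun g) \<le> C"
proof -
  obtain n0 where "norm (abs_L2fun (f n0)) \<le> C"
    using le by (meson eventually_sequentially order_refl)
  then have C: "C \<ge> 0" using norm_ge_zero order_trans by blast
  have gn: "(\<lambda>t. norm (g t)) \<in> borel_measurable lebesgue"
    by (rule strongly_measurable_norm[OF gm])
  have ev: "eventually (\<lambda>n. (\<integral>\<^sup>+ t. ennreal ((norm (f n t))\<^sup>2) \<partial>lebesgue) \<le> ennreal (C\<^sup>2)) sequentially"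
    using le
  proof eventually_elim
    fix n assume *: "norm (abs_L2fun (f n)) \<le> C"
    have "(\<integral>\<^sup>+ t. ennreal ((norm (f n t))\<^sup>2) \<partial>lebesgue) = ennreal ((norm (abs_L2fun (f n)))\<^sup>2)"
      unfolding norm_abs_L2fun[OF f]
      by (rule nn_integral_eq_integral[OF integrable_norm_square[OF f]]) simp
    also have "\<dots> \<le> ennreal (C\<^sup>2)"
      using power_mono[OF *, of 2] by (intro ennreal_leI) simp
    finally show "(\<integral>\<^sup>+ t. ennreal ((norm (f n t))\<^sup>2) \<partial>lebesgue) \<le> ennreal (C\<^sup>2)" .
  qed
  have "(\<integral>\<^sup>+ t. ennreal ((norm (g t))\<^sup>2) \<partial>lebesgue)
      = (\<integral>\<^sup>+ t. liminf (\<lambda>n. ennreal ((norm (f n t))\<^sup>2)) \<partial>lebesgue)"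
  proof (rule nn_integral_cong_AE)
    show "AE t in lebesgue. ennreal ((norm (g t))\<^sup>2) = liminf (\<lambda>n. ennreal ((norm (f n t))\<^sup>2))"
      using lim
    proof eventually_elim
      fix t assume "(\<lambda>n. f n t) \<longlonglongrightarrow> g t"
      then have "(\<lambda>n. ennreal ((norm (f n t))\<^sup>2)) \<longlonglongrightarrow> ennreal ((norm (g t))\<^sup>2)"
        by (intro tendsto_intros)
      then show "ennreal ((norm (g t))\<^sup>2) = liminf (\<lambda>n. ennreal ((norm (f n t))\<^sup>2))"
        by (rule lim_imp_Liminf[OF sequentially_bot, symmetric])
    qed
  qed
  also have "\<dots> \<le> liminf (\<lambda>n. \<integral>\<^sup>+ t. ennreal ((norm (f n t))\<^sup>2) \<partial>lebesgue)"
    by (intro nn_integral_liminf measurable_compose[OF borel_measurable_integrable measurable_ennreal]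
        integrable_norm_square f)
  also have "\<dots> \<le> ennreal (C\<^sup>2)"
    by (rule Liminf_le[OF sequentially_bot ev])
  finally have fin: "(\<integral>\<^sup>+ t. ennreal ((norm (g t))\<^sup>2) \<partial>lebesgue) \<le> ennreal (C\<^sup>2)" .
  have "integrable lebesgue (\<lambda>t. (norm (g t))\<^sup>2)"
  proof (rule integrableI_nonneg)
    show "(\<lambda>t. (norm (g t))\<^sup>2) \<in> borel_measurable lebesgue"
      by (rule borel_measurable_power[OF gn])
    show "(\<integral>\<^sup>+ t. ennreal ((norm (g t))\<^sup>2) \<partial>lebesgue) < \<infinity>"
      using fin by (rule order_le_less_trans) simp
  qed simp
  with gm show sq: "square_integrable g" unfolding square_integrable_def by simp
  have "ennreal ((norm (abs_L2fun g))\<^sup>2) \<le> ennreal (C\<^sup>2)"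
    using fin nn_integral_eq_integral[OF integrable_norm_square[OF sq]]
    by (simp add: norm_abs_L2fun[OF sq])
  then have "(norm (abs_L2fun g))\<^sup>2 \<le> C\<^sup>2" by simp
  then show "norm (abs_L2fun g) \<le> C" using C by (rule power2_le_imp_le)
qed

text \<open>Strong measurability of an almost everywhere limit is immediate from the definition
  when the approximants are simple. Replacing a rapidly Cauchy sequence by simple functions
  therefore yields completeness without any closure property of strong measurability.\<close>

lemma simple_rapidly_Cauchy_convergent:
  fixes s :: "nat \<Rightarrow> real \<Rightarrow> 'a::{real_normed_vector, complete_space}"
  assumes s: "\<And>n. simple_function lebesgue (s n)" "\<And>n. square_integrable (s n)"
    and le: "\<And>n. norm (abs_L2fun (s (Suc n)) - abs_L2fun (s n)) \<le> (1/2) ^ n"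
  shows "convergent (\<lambda>n. abs_L2fun (s n))"
proof -
  define f where "f t = lim (\<lambda>n. s n t)" for t
  have lim: "AE t in lebesgue. (\<lambda>n. s n t) \<longlonglongrightarrow> f t"
    using rapidly_Cauchy_AE_convergent[OF s(2) le]
    by eventually_elim (simp add: f_def convergent_LIMSEQ_iff)
  have fm: "strongly_measurable lebesgue f"
    unfolding strongly_measurable_def by (intro exI[of _ s] conjI allI s(1) lim)
  have cau: "Cauchy (\<lambda>n. abs_L2fun (s n))"
    using le by (intro Cauchy_if_summable_increments[where a="\<lambda>n. (1/2) ^ n"]) (simp_all add: summable_geometric)
  have close: "\<exists>N. \<forall>n\<ge>N. square_integrable (\<lambda>t. f t - s n t) \<and>
      norm (abs_L2fun (\<lambda>t. f t - s n t)) \<le> e" if e: "e > 0" for e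
  proof -
    obtain N where N: "\<And>m n. m \<ge> N \<Longrightarrow> n \<ge> N \<Longrightarrow> norm (abs_L2fun (s m) - abs_L2fun (s n)) < e"
      using CauchyD[OF cau e] by blast
    have "square_integrable (\<lambda>t. f t - s n t) \<and> norm (abs_L2fun (\<lambda>t. f t - s n t)) \<le> e"
      if "n \<ge> N" for n
    proof -
      have "strongly_measurable lebesgue (\<lambda>t. f t + (-1) *\<^sub>R s n t)"
        using s(2) by (intro strongly_measurable_add strongly_measurable_scaleR fm)
          (simp add: square_integrable_def)
      then have m: "strongly_measurable lebesgue (\<lambda>t. f t - s n t)" by simp
      have l: "AE t in lebesgue. (\<lambda>m. s m t - s n t) \<longlonglongrightarrow> f t - s n t"
        using lim by eventually_elim (intro tendsto_intros)
      have ev: "eventually (\<lambda>m. norm (abs_L2fun (\<lambda>t. s m t - s n t)) \<le> e) sequentially"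
        using eventually_ge_at_top[of N]
        by eventually_elim (use N that s(2) in \<open>simp add: abs_L2fun_diff less_imp_le\<close>)
      show ?thesis
        using L2_Fatou[OF m l square_integrable_diff[OF s(2) s(2)] ev] by simp
    qed
    then show ?thesis by blast
  qed
  obtain N where "square_integrable (\<lambda>t. f t - s N t)" using close[of 1] by auto
  from square_integrable_add[OF this s(2)[of N]] have f: "square_integrable f" by simp
  have "(\<lambda>n. abs_L2fun (s n)) \<longlonglongrightarrow> abs_L2fun f"
  proof (rule LIMSEQ_I)
    fix e :: real assume "e > 0"
    then obtain N where N: "\<And>n. n \<ge> N \<Longrightarrow> norm (abs_L2fun (\<lambda>t. f t - s n t)) \<le> e / 2"
      using close[of "e / 2"] by auto
    have "norm (abs_L2fun (s n) - abs_L2fun f) < e" if "n \<ge> N" for n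
      using N[OF that] \<open>e > 0\<close> by (simp add: abs_L2fun_diff[OF f s(2)] norm_minus_commute)
    then show "\<exists>N. \<forall>n\<ge>N. norm (abs_L2fun (s n) - abs_L2fun f) < e" by blast
  qed
  then show ?thesis by (rule convergentI)
qed

instance L2fun :: ("{real_normed_vector, complete_space}") complete_space
proof
  fix X :: "nat \<Rightarrow> 'a L2fun"
  assume X: "Cauchy X"
  have "\<exists>N. \<forall>m\<ge>N. \<forall>n\<ge>N. norm (X m - X n) < (1/2) ^ k / 4" for k :: nat
    using CauchyD[OF X, of "(1/2) ^ k / 4"] by simp
  then obtain N where N: "\<And>k m n. m \<ge> N k \<Longrightarrow> n \<ge> N k \<Longrightarrow> norm (X m - X n) < (1/2) ^ k / 4"
    by metis
  have "\<exists>s. simple_function lebesgue s \<and> square_integrable s \<and>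
      norm (X (N k) - abs_L2fun s) < (1/2) ^ k / 8" for k
    using simple_dense_L2[OF square_integrable_rep[of "X (N k)"], of "(1/2) ^ k / 8"]
    by (simp add: abs_rep_L2fun)
  then obtain s where s: "\<And>k. simple_function lebesgue (s k)" "\<And>k. square_integrable (s k)"
    and sX: "\<And>k. norm (X (N k) - abs_L2fun (s k)) < (1/2) ^ k / 8"
    by metis
  have "norm (abs_L2fun (s (Suc k)) - abs_L2fun (s k)) \<le> (1/2) ^ k" for k
  proof -
    define M where "M = max (N k) (N (Suc k))"
    have 1: "norm (X (N k) - X M) < (1/2) ^ k / 4"
      using N[of k "N k" M] unfolding M_def by simp
    have 2: "norm (X (N (Suc k)) - X M) < (1/2) ^ Suc k / 4"
      using N[of "Suc k" "N (Suc k)" M] unfolding M_def by simp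
    have "abs_L2fun (s (Suc k)) - abs_L2fun (s k)
        = (X (N k) - abs_L2fun (s k)) - (X (N (Suc k)) - abs_L2fun (s (Suc k)))
          + ((X (N (Suc k)) - X M) - (X (N k) - X M))" by simp
    then have "norm (abs_L2fun (s (Suc k)) - abs_L2fun (s k))
        \<le> (norm (X (N k) - abs_L2fun (s k)) + norm (X (N (Suc k)) - abs_L2fun (s (Suc k))))
          + (norm (X (N (Suc k)) - X M) + norm (X (N k) - X M))"
      using norm_triangle_ineq[of "(X (N k) - abs_L2fun (s k)) - (X (N (Suc k)) - abs_L2fun (s (Suc k)))"
          "(X (N (Suc k)) - X M) - (X (N k) - X M)"]
        norm_triangle_ineq4[of "X (N k) - abs_L2fun (s k)" "X (N (Suc k)) - abs_L2fun (s (Suc k))"]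
        norm_triangle_ineq4[of "X (N (Suc k)) - X M" "X (N k) - X M"]
      by simp
    moreover have "(0::real) \<le> (1/2) ^ k" by simp
    ultimately show ?thesis
      using 1 2 sX[of k] sX[of "Suc k"] unfolding power_Suc by linarith
  qed
  from simple_rapidly_Cauchy_convergent[OF s this]
  obtain F where F: "(\<lambda>k. abs_L2fun (s k)) \<longlonglongrightarrow> F" by (auto simp: convergent_def)
  have "X \<longlonglongrightarrow> F"
  proof (rule LIMSEQ_I)
    fix e :: real assume e: "e > 0"
    have "eventually (\<lambda>k. norm (abs_L2fun (s k) - F) < e / 2) sequentially"
      using tendstoD[OF F, of "e / 2"] e by (simp add: dist_norm)
    moreover have "eventually (\<lambda>k. (1/2::real) ^ k < e / 2) sequentially"
      using order_tendstoD(2)[OF LIMSEQ_realpow_zero[of "1/2::real"], of "e / 2"] e by simp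
    ultimately have "eventually (\<lambda>k. norm (abs_L2fun (s k) - F) < e / 2 \<and> (1/2::real) ^ k < e / 2) sequentially"
      by (rule eventually_conj)
    then obtain k where k: "norm (abs_L2fun (s k) - F) < e / 2" "(1/2::real) ^ k < e / 2"
      using eventually_happens'[OF sequentially_bot] by blast
    have "norm (X n - F) < e" if n: "n \<ge> N k" for n
    proof -
      have "X n - F = (X n - X (N k)) + (X (N k) - abs_L2fun (s k)) + (abs_L2fun (s k) - F)" by simp
      then have "norm (X n - F) \<le> norm (X n - X (N k)) + norm (X (N k) - abs_L2fun (s k))
          + norm (abs_L2fun (s k) - F)"
        using norm_triangle_ineq[of "(X n - X (N k)) + (X (N k) - abs_L2fun (s k))" "abs_L2fun (s k) - F"]
          norm_triangle_ineq[of "X n - X (N k)" "X (N k) - abs_L2fun (s k)"] by simp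
      moreover have "(0::real) \<le> (1/2) ^ k" by simp
      ultimately show ?thesis using N[OF n order_refl] sX[of k] k by linarith
    qed
    then show "\<exists>M. \<forall>n\<ge>M. norm (X n - F) < e" by blast
  qed
  then show "convergent X" by (rule convergentI)
qed

lemma integrable_inner_square_integrable:
  fixes f g :: "real \<Rightarrow> 'a::real_inner"
  assumes "square_integrable f" "square_integrable g"
  shows "integrable lebesgue (\<lambda>t. f t \<bullet> g t)"
proof -
  have "integrable lebesgue (\<lambda>t. ((norm (f t + g t))\<^sup>2 - (norm (f t - g t))\<^sup>2) / 4)"
    by (intro Bochner_Integration.integrable_diff integrable_divide integrable_norm_square
        square_integrable_add square_integrable_diff assms)
  moreover have "((norm (f t + g t))\<^sup>2 - (norm (f t - g t))\<^sup>2) / 4 = f t \<bullet> g t" for t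
    by (simp add: power2_norm_eq_inner inner_simps inner_commute)
  ultimately show ?thesis by simp
qed

instantiation L2fun :: (real_inner) real_inner
begin

definition inner_L2fun :: "'a L2fun \<Rightarrow> 'a L2fun \<Rightarrow> real" where
  "inner_L2fun w z = (LINT t|lebesgue. rep_L2fun w t \<bullet> rep_L2fun z t)"

instance
proof
  fix x y z :: "'a L2fun" and r :: real
  note i = integrable_inner_square_integrable[OF square_integrable_rep square_integrable_rep]
  show "x \<bullet> y = y \<bullet> x"
    by (simp add: inner_L2fun_def inner_commute)
  have "AE t in lebesgue. rep_L2fun (x + y) t \<bullet> rep_L2fun z t
      = rep_L2fun x t \<bullet> rep_L2fun z t + rep_L2fun y t \<bullet> rep_L2fun z t"
    using rep_L2fun_add[of x y] by eventually_elim (simp add: inner_add_left)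
  then have "(x + y) \<bullet> z
      = (LINT t|lebesgue. rep_L2fun x t \<bullet> rep_L2fun z t + rep_L2fun y t \<bullet> rep_L2fun z t)"
    unfolding inner_L2fun_def
    by (intro integral_cong_AE borel_measurable_integrable Bochner_Integration.integrable_add i)
  then show "(x + y) \<bullet> z = x \<bullet> z + y \<bullet> z"
    unfolding inner_L2fun_def by (simp add: i)
  have "AE t in lebesgue. rep_L2fun (r *\<^sub>R x) t \<bullet> rep_L2fun y t
      = r * (rep_L2fun x t \<bullet> rep_L2fun y t)"
    using rep_L2fun_scaleR[of r x] by eventually_elim simp
  then have "r *\<^sub>R x \<bullet> y = (LINT t|lebesgue. r * (rep_L2fun x t \<bullet> rep_L2fun y t))"
    unfolding inner_L2fun_def
    by (intro integral_cong_AE borel_measurable_integrable integrable_mult_right i)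
  then show "r *\<^sub>R x \<bullet> y = r * (x \<bullet> y)"
    unfolding inner_L2fun_def by simp
  have sq: "x \<bullet> x = (norm x)\<^sup>2"
    unfolding inner_L2fun_def norm_L2fun_square by (simp add: power2_norm_eq_inner)
  show "0 \<le> x \<bullet> x" "(x \<bullet> x = 0) = (x = 0)" "norm x = sqrt (x \<bullet> x)"
    unfolding sq by simp_all
qed

end

lemma inner_abs_L2fun:
  assumes f: "square_integrable f"
  shows "w \<bullet> abs_L2fun f = (LINT t|lebesgue. rep_L2fun w t \<bullet> f t)"
  unfolding inner_L2fun_def
proof (rule integral_cong_AE)
  show "AE t in lebesgue. rep_L2fun w t \<bullet> rep_L2fun (abs_L2fun f) t = rep_L2fun w t \<bullet> f t"
    using rep_abs_L2fun[OF f] by eventually_elim simp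
qed (intro borel_measurable_integrable integrable_inner_square_integrable f square_integrable_rep)+

section \<open>Complete subspaces of inner product spaces\<close>

text \<open>The representing element minimizes \<open>\<parallel>x\<parallel>\<^sup>2 / 2 - F x\<close>; the parallelogram law makes
  minimizing sequences Cauchy.\<close>

lemma Riesz_representation_subspace:
  fixes S :: "'a::real_inner set" and F :: "'a \<Rightarrow> real"
  assumes S: "subspace S" "complete S"
    and add: "\<And>x y. x \<in> S \<Longrightarrow> y \<in> S \<Longrightarrow> F (x + y) = F x + F y"
    and scale: "\<And>c x. x \<in> S \<Longrightarrow> F (c *\<^sub>R x) = c * F x"
    and bound: "\<And>x. x \<in> S \<Longrightarrow> \<bar>F x\<bar> \<le> C * norm x"
  shows "\<exists>r\<in>S. \<forall>v\<in>S. F v = r \<bullet> v"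
proof -
  define J where "J x = (norm x)\<^sup>2 / 2 - F x" for x
  have lower: "- C\<^sup>2 / 2 \<le> J x" if "x \<in> S" for x
  proof -
    have "0 \<le> (norm x - C)\<^sup>2" by simp
    then have "C * norm x \<le> ((norm x)\<^sup>2 + C\<^sup>2) / 2" by (simp add: power2_diff algebra_simps)
    then show ?thesis using bound[OF that] unfolding J_def by (simp add: field_simps)
  qed
  have bdd: "bdd_below (J ` S)"
    by (rule bdd_belowI2) (rule lower)
  have ne: "J ` S \<noteq> {}" using subspace_0[OF S(1)] by auto
  define m where "m = Inf (J ` S)"
  have mJ: "m \<le> J x" if "x \<in> S" for x
    unfolding m_def using bdd that by (intro cInf_lower) auto
  have "\<exists>x\<in>S. J x < m + 1 / real (Suc n)" for n
    using cInf_lessD[OF ne, of "m + 1 / real (Suc n)"] unfolding m_def by auto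
  then obtain x where x: "\<And>n. x n \<in> S" "\<And>n. J (x n) < m + 1 / real (Suc n)"
    by metis
  have par: "(norm (y - z))\<^sup>2 \<le> 4 * (J y + J z - 2 * m)" if "y \<in> S" "z \<in> S" for y z
  proof -
    let ?h = "(1/2) *\<^sub>R (y + z)"
    have "?h \<in> S" using S(1) that by (intro subspace_scale subspace_add)
    then have "m \<le> J ?h" by (rule mJ)
    moreover have "F ?h = (F y + F z) / 2"
      using that by (simp add: scale[OF subspace_add[OF S(1) that]] add)
    moreover have "(norm ?h)\<^sup>2 = ((norm y)\<^sup>2 + 2 * (y \<bullet> z) + (norm z)\<^sup>2) / 4"
      by (simp only: power2_norm_eq_inner) (simp add: inner_simps inner_commute)
    moreover have "(norm (y - z))\<^sup>2 = (norm y)\<^sup>2 - 2 * (y \<bullet> z) + (norm z)\<^sup>2"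
      by (simp only: power2_norm_eq_inner) (simp add: inner_simps inner_commute)
    ultimately show ?thesis unfolding J_def by (simp add: field_simps)
  qed
  have "Cauchy x"
  proof (rule CauchyI)
    fix e :: real assume e: "e > 0"
    obtain N where N: "1 / real (Suc N) < e\<^sup>2 / 8"
      using reals_Archimedean[of "e\<^sup>2 / 8"] e by (auto simp: inverse_eq_divide)
    show "\<exists>M. \<forall>i\<ge>M. \<forall>k\<ge>M. norm (x i - x k) < e"
    proof (intro exI allI impI)
      fix i k assume ik: "i \<ge> N" "k \<ge> N"
      define d where "d = 1 / real (Suc N)"
      have "1 / real (Suc i) \<le> d" "1 / real (Suc k) \<le> d"
        unfolding d_def using ik by (auto simp: frac_le)
      then have "J (x i) < m + d" "J (x k) < m + d"
        using x(2)[of i] x(2)[of k] by simp_all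
      then have "4 * (J (x i) + J (x k) - 2 * m) < e\<^sup>2"
        using N unfolding d_def[symmetric] by simp
      then have "(norm (x i - x k))\<^sup>2 < e\<^sup>2"
        using par[OF x(1)[of i] x(1)[of k]] by linarith
      then show "norm (x i - x k) < e"
        using e by (simp add: power_less_imp_less_base)
    qed
  qed
  then obtain r where r: "r \<in> S" "x \<longlonglongrightarrow> r"
    using S(2) x(1) unfolding complete_def by metis
  have "(\<lambda>n. F (x n)) \<longlonglongrightarrow> F r"
  proof (rule LIM_zero_cancel, rule Lim_null_comparison)
    have "F (x n) - F r = F (x n - r)" for n
      using add[of "x n - r" r] subspace_diff[OF S(1) x(1) r(1)] r(1) by simp
    then show "eventually (\<lambda>n. norm (F (x n) - F r) \<le> C * norm (x n - r)) sequentially"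
      using bound[OF subspace_diff[OF S(1) x(1) r(1)]] by simp
    show "(\<lambda>n. C * norm (x n - r)) \<longlonglongrightarrow> 0"
      using tendsto_mult_right_zero[OF tendsto_norm_zero[OF LIM_zero[OF r(2)]]] by simp
  qed
  then have Jlim: "(\<lambda>n. J (x n)) \<longlonglongrightarrow> J r"
    unfolding J_def by (intro tendsto_intros r(2)) auto
  have "(\<lambda>n. m + 1 / real (Suc n)) \<longlonglongrightarrow> m + 0"
    by (intro tendsto_intros LIMSEQ_inverse_real_of_nat[unfolded inverse_eq_divide])
  from LIMSEQ_le[OF Jlim this] x(2) have Jr: "J r \<le> m"
    by (simp add: less_imp_le)
  \<comment> \<open>Minimality along \<open>r + t v\<close> makes \<open>t a + t\<^sup>2 q / 2\<close> nonnegative; the choice of \<open>t\<close> below refutes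
    \<open>a \<noteq> 0\<close>, and \<open>q + 1\<close> in the denominator covers \<open>v = 0\<close>.\<close>
  have "F v = r \<bullet> v" if v: "v \<in> S" for v
  proof -
    define a where "a = r \<bullet> v - F v"
    define q where "q = v \<bullet> v"
    have q: "q \<ge> 0" unfolding q_def by simp
    define t where "t = - a / (q + 1)"
    have "J r \<le> J (r + t *\<^sub>R v)"
      using Jr mJ[of "r + t *\<^sub>R v"] subspace_add[OF S(1) r(1) subspace_scale[OF S(1) v]] by fastforce
    moreover have "F (r + t *\<^sub>R v) = F r + t * F v"
      by (simp add: add[OF r(1) subspace_scale[OF S(1) v]] scale[OF v])
    moreover have "(norm (r + t *\<^sub>R v))\<^sup>2 = (norm r)\<^sup>2 + 2 * t * (r \<bullet> v) + t\<^sup>2 * q"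
      unfolding q_def power2_norm_eq_inner by (simp add: inner_simps inner_commute power2_eq_square algebra_simps)
    ultimately have *: "0 \<le> t * a + t\<^sup>2 * q / 2"
      unfolding J_def a_def by (simp add: algebra_simps)
    have "t * a + t\<^sup>2 * q / 2 = - (a / (q + 1))\<^sup>2 * (q / 2 + 1)"
      unfolding t_def using q by (simp add: field_simps power2_eq_square add_nonneg_eq_0_iff)
    with * have "(a / (q + 1))\<^sup>2 * (q / 2 + 1) \<le> 0" by simp
    then have "a / (q + 1) = 0" using q by (auto simp: mult_le_0_iff)
    then have "a = 0" using q by auto
    then show ?thesis unfolding a_def by simp
  qed
  with r(1) show ?thesis by blast
qed

lemma subspace_closure_real:
  fixes N :: "'a::real_normed_vector set"
  assumes "subspace N" shows "subspace (closure N)"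
  unfolding subspace_def
proof (intro conjI ballI allI)
  show "0 \<in> closure N" using subspace_0[OF assms] closure_subset by blast
  fix x y assume "x \<in> closure N" "y \<in> closure N"
  then obtain a b where "\<And>n. a n \<in> N" "a \<longlonglongrightarrow> x" "\<And>n. b n \<in> N" "b \<longlonglongrightarrow> y"
    unfolding closure_sequential by blast
  then show "x + y \<in> closure N"
    unfolding closure_sequential
    by (intro exI[of _ "\<lambda>n. a n + b n"]) (auto intro: tendsto_add subspace_add[OF assms])
next
  fix c :: real and x assume "x \<in> closure N"
  then obtain a where "\<And>n. a n \<in> N" "a \<longlonglongrightarrow> x"
    unfolding closure_sequential by blast
  then show "c *\<^sub>R x \<in> closure N"
    unfolding closure_sequential
    by (intro exI[of _ "\<lambda>n. c *\<^sub>R a n"]) (auto intro: tendsto_scaleR subspace_scale[OF assms])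
qed

lemma orthogonal_projection_subspace:
  fixes S :: "'a::real_inner set"
  assumes "subspace S" "complete S"
  shows "\<exists>p\<in>S. \<forall>v\<in>S. (x - p) \<bullet> v = 0"
proof -
  have "\<exists>p\<in>S. \<forall>v\<in>S. x \<bullet> v = p \<bullet> v"
    by (rule Riesz_representation_subspace[OF assms, where C="norm x"])
      (auto simp: inner_simps Cauchy_Schwarz_ineq2)
  then show ?thesis by (auto simp: inner_diff_left)
qed

text \<open>Otherwise the residual of the projection of some \<open>x\<close> onto the closure is a nonzero element
  of the orthogonal complement.\<close>

lemma dense_if_trivial_orthogonal_complement:
  fixes G N :: "'a::real_inner set"
  assumes G: "subspace G" "complete G" and N: "subspace N" "N \<subseteq> G"
    and triv: "\<And>x. x \<in> G \<Longrightarrow> (\<And>n. n \<in> N \<Longrightarrow> x \<bullet> n = 0) \<Longrightarrow> x = 0"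
  shows "G \<subseteq> closure N"
proof
  fix x assume x: "x \<in> G"
  have sub: "closure N \<subseteq> G"
    using N(2) complete_imp_closed[OF G(2)] by (rule closure_minimal)
  have "complete (closure N)"
    using complete_Int_closed[OF G(2) closed_closure, of N] sub by (simp add: Int_absorb1)
  then obtain p where p: "p \<in> closure N" "\<And>v. v \<in> closure N \<Longrightarrow> (x - p) \<bullet> v = 0"
    using orthogonal_projection_subspace[OF subspace_closure_real[OF N(1)], of x] by blast
  have "x - p = 0"
    using p sub x closure_subset[of N] by (intro triv subspace_diff[OF G(1)]) auto
  with p(1) show "x \<in> closure N" by simp
qed

text \<open>Subtracting the projection of a new vector onto the old span leaves an orthogonal direction
  \<open>e\<close>; a Cauchy sequence then splits into a Cauchy sequence in the old span and one of scalars.\<close>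

lemma complete_span_finite:
  fixes B :: "'a::real_inner set"
  assumes "finite B"
  shows "complete (span B)"
  using assms
proof induction
  case empty
  have "complete {0::'a}" by (simp add: compact_imp_complete)
  then show ?case by simp
next
  case (insert b B)
  show ?case
  proof (cases "b \<in> span B")
    case True
    then show ?thesis using insert.IH by (simp add: span_redundant)
  next
    case False
    obtain p where p: "p \<in> span B" "\<And>v. v \<in> span B \<Longrightarrow> (b - p) \<bullet> v = 0"
      using orthogonal_projection_subspace[OF subspace_span insert.IH, of b] by blast
    define e where "e = b - p"
    have e: "e \<bullet> e \<noteq> 0" using False p(1) unfolding e_def by auto
    have eS: "e \<in> span (insert b B)"
      unfolding e_def using p(1) span_mono[of B "insert b B"]
      by (intro span_diff) (auto intro: span_base)
    define k where "k x = (x \<bullet> e) / (e \<bullet> e)" for x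
    have proj: "x - k x *\<^sub>R e \<in> span B" if x: "x \<in> span (insert b B)" for x
    proof -
      obtain c where c: "x - c *\<^sub>R b \<in> span B" using x unfolding span_insert by auto
      have "(x - c *\<^sub>R b) + c *\<^sub>R p \<in> span B" by (intro span_add span_scale c p(1))
      then have *: "x - c *\<^sub>R e \<in> span B" unfolding e_def by (simp add: algebra_simps)
      then have "e \<bullet> (x - c *\<^sub>R e) = 0" using p(2) unfolding e_def by blast
      then have "k x = c" unfolding k_def using e by (simp add: inner_simps inner_commute field_simps)
      with * show ?thesis by simp
    qed
    show ?thesis
      unfolding complete_def
    proof (intro allI impI)
      fix f :: "nat \<Rightarrow> 'a" assume f: "(\<forall>n. f n \<in> span (insert b B)) \<and> Cauchy f"
      have kl: "bounded_linear k"
        unfolding k_def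
        by (rule bounded_linear_compose[OF bounded_linear_divide bounded_linear_inner_left])
      have kc: "Cauchy (\<lambda>n. k (f n))"
        using f bounded_linear.Cauchy[OF kl] by blast
      then obtain c where c: "(\<lambda>n. k (f n)) \<longlonglongrightarrow> c"
        using Cauchy_convergent convergent_def by blast
      have "bounded_linear (\<lambda>x. x - k x *\<^sub>R e)"
        by (intro bounded_linear_sub bounded_linear_ident bounded_linear_scaleR_const kl)
      then have cau: "Cauchy (\<lambda>n. f n - k (f n) *\<^sub>R e)"
        by (rule bounded_linear.Cauchy) (use f in blast)
      have inB: "\<forall>n. f n - k (f n) *\<^sub>R e \<in> span B"
        using f proj by simp
      obtain y where y: "y \<in> span B" "(\<lambda>n. f n - k (f n) *\<^sub>R e) \<longlonglongrightarrow> y"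
        by (rule completeE[OF insert.IH inB cau])
      have "(\<lambda>n. (f n - k (f n) *\<^sub>R e) + k (f n) *\<^sub>R e) \<longlonglongrightarrow> y + c *\<^sub>R e"
        by (intro tendsto_intros y(2) c)
      moreover have "y + c *\<^sub>R e \<in> span (insert b B)"
        using y(1) eS span_mono[of B "insert b B"] by (intro span_add span_scale) auto
      ultimately show "\<exists>l\<in>span (insert b B). f \<longlonglongrightarrow> l" by auto
    qed
  qed
qed

lemma finite_dim_subspace_span:
  assumes "subspace S" "finite_dim S"
  shows "\<exists>B. finite B \<and> B \<subseteq> S \<and> S = span B"
proof -
  obtain C where C: "finite C" "S \<subseteq> span C"
    using assms(2) unfolding finite_dim_def by blast
  obtain B where B: "B \<subseteq> S" "independent B" "S \<subseteq> span B"
    using maximal_independent_subset[of S] by blast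
  have "finite B"
    using independent_span_bound[OF C(1) B(2)] B(1) C(2) by blast
  moreover have "span B = S"
    using B span_minimal[OF B(1) assms(1)] by blast
  ultimately show ?thesis using B(1) by blast
qed

text \<open>Zarantonello's theorem: for small \<open>\<rho>\<close> the map \<open>x \<mapsto> x - \<rho> (f x - r)\<close> is a contraction.\<close>

lemma strongly_monotone_Lipschitz_surj:
  fixes S :: "'a::real_inner set" and f :: "'a \<Rightarrow> 'a"
  assumes S: "subspace S" "complete S"
    and fS: "\<And>x. x \<in> S \<Longrightarrow> f x \<in> S"
    and lip: "\<And>x y. x \<in> S \<Longrightarrow> y \<in> S \<Longrightarrow> norm (f x - f y) \<le> L * norm (x - y)"
    and mono: "\<And>x y. x \<in> S \<Longrightarrow> y \<in> S \<Longrightarrow> (f x - f y) \<bullet> (x - y) \<ge> m * (norm (x - y))\<^sup>2"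
    and m: "m > 0" and r: "r \<in> S"
  shows "\<exists>x\<in>S. f x = r"
proof -
  \<comment> \<open>Enlarging the Lipschitz constant keeps \<open>1 - m\<^sup>2 / K\<^sup>2\<close> nonnegative.\<close>
  define K where "K = max L m"
  have K: "K > 0" "m \<le> K" "L \<le> K" using m unfolding K_def by auto
  define \<rho> where "\<rho> = m / K\<^sup>2"
  define c where "c = 1 - m\<^sup>2 / K\<^sup>2"
  have \<rho>: "\<rho> > 0" using m K unfolding \<rho>_def by simp
  have c: "0 \<le> c" "c < 1"
    using power_mono[OF K(2), of 2] m K by (simp_all add: c_def)
  define T where "T x = x - \<rho> *\<^sub>R (f x - r)" for x
  have contr: "(norm (T x - T y))\<^sup>2 \<le> c * (norm (x - y))\<^sup>2" if "x \<in> S" "y \<in> S" for x y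
  proof -
    have "norm (f x - f y) \<le> K * norm (x - y)"
      using lip[OF that] mult_right_mono[OF K(3) norm_ge_zero[of "x - y"]] by linarith
    then have 1: "(norm (f x - f y))\<^sup>2 \<le> K\<^sup>2 * (norm (x - y))\<^sup>2"
      using power_mono[of _ _ 2] by (fastforce simp: power_mult_distrib)
    have "T x - T y = (x - y) - \<rho> *\<^sub>R (f x - f y)" unfolding T_def by (simp add: algebra_simps)
    moreover have "(norm (a - \<rho> *\<^sub>R b))\<^sup>2 = (norm a)\<^sup>2 - 2 * \<rho> * (b \<bullet> a) + \<rho>\<^sup>2 * (norm b)\<^sup>2" for a b :: 'a
      unfolding power2_norm_eq_inner by (simp add: inner_simps inner_commute power2_eq_square algebra_simps)
    ultimately have "(norm (T x - T y))\<^sup>2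
        = (norm (x - y))\<^sup>2 - 2 * \<rho> * ((f x - f y) \<bullet> (x - y)) + \<rho>\<^sup>2 * (norm (f x - f y))\<^sup>2"
      by simp
    also have "\<dots> \<le> (norm (x - y))\<^sup>2 - 2 * \<rho> * (m * (norm (x - y))\<^sup>2) + \<rho>\<^sup>2 * (K\<^sup>2 * (norm (x - y))\<^sup>2)"
      using \<rho> by (intro add_mono diff_mono mult_left_mono mono that 1 order_refl) simp_all
    also have "\<dots> = (1 - 2 * \<rho> * m + \<rho>\<^sup>2 * K\<^sup>2) * (norm (x - y))\<^sup>2" by (simp add: algebra_simps)
    also have "1 - 2 * \<rho> * m + \<rho>\<^sup>2 * K\<^sup>2 = c"
      unfolding \<rho>_def c_def using K by (simp add: field_simps power2_eq_square)
    finally show ?thesis .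
  qed
  have "\<exists>!x. x \<in> S \<and> T x = x"
  proof (rule Banach_fix[where c="sqrt c"])
    show "T ` S \<subseteq> S"
      unfolding T_def using S(1) fS r by (auto intro!: subspace_diff subspace_scale)
    show "S \<noteq> {}" using r by blast
    fix x y assume xy: "x \<in> S" "y \<in> S"
    have "norm (T x - T y) \<le> sqrt (c * (norm (x - y))\<^sup>2)"
      by (rule real_le_rsqrt[OF contr[OF xy]])
    then show "dist (T x) (T y) \<le> sqrt c * dist x y"
      by (simp add: real_sqrt_mult dist_norm)
  qed (use S c in auto)
  then obtain x where x: "x \<in> S" "T x = x" by blast
  then have "f x = r" using \<rho> unfolding T_def by simp
  with x(1) show ?thesis by blast
qed

section \<open>Test functions and trigonometric totality on an interval\<close>

lemma borel_measurable_lebesgueI: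
  fixes f :: "real \<Rightarrow> real"
  assumes "f \<in> borel_measurable borel"
  shows "f \<in> borel_measurable lebesgue"
proof (rule measurable_completion)
  show "f \<in> borel_measurable lborel" using assms by (simp only: measurable_lborel2)
qed

lemma smooth_if_closed_under_derivatives:
  fixes f :: "real \<Rightarrow> real"
  assumes C: "\<And>f. C f \<Longrightarrow> \<exists>g. C g \<and> (\<forall>x. (f has_real_derivative g x) (at x))" and f: "C f"
  shows "(deriv ^^ k) f differentiable at x"
proof -
  have dC: "C (deriv f) \<and> (\<forall>x. f differentiable at x)" if f: "C f" for f
  proof -
    obtain g where g: "C g" "\<And>x. (f has_real_derivative g x) (at x)" using C[OF f] by auto
    have "deriv f = g" using DERIV_imp_deriv[OF g(2)] by (rule ext)
    then show ?thesis using g real_differentiable_def by blast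
  qed
  have "C ((deriv ^^ k) f)" by (induction k) (use f dC in auto)
  then show ?thesis using dC by simp
qed

text \<open>The functions \<open>p(1/y) e\<^bsup>-1/y\<^esup>\<close>, extended by zero to \<open>y \<le> 0\<close>, form a class that is closed under
  differentiation, which makes all of them smooth.\<close>

definition flat :: "real poly \<Rightarrow> real \<Rightarrow> real" where
  "flat p y = (if y > 0 then poly p (1 / y) * exp (- 1 / y) else 0)"

lemma poly_exp_decay: "((\<lambda>u. poly p u * exp (- u)) \<longlongrightarrow> 0) at_top" for p :: "real poly"
proof -
  have "((\<lambda>u. \<Sum>i\<le>degree p. coeff p i * (u ^ i / exp u)) \<longlongrightarrow> 0) at_top"
    by (intro tendsto_null_sum tendsto_mult_right_zero tendsto_power_div_exp_0)
  moreover have "(\<Sum>i\<le>degree p. coeff p i * (u ^ i / exp u)) = poly p u * exp (- u)" for u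
    by (simp add: poly_altdef sum_distrib_right exp_minus divide_inverse mult.assoc)
  ultimately show ?thesis by simp
qed

lemma flat_has_derivative:
  "(flat p has_real_derivative flat ([:0, 0, 1:] * (p - pderiv p)) y) (at y)"
proof -
  consider "y < 0" | "y = 0" | "y > 0" by linarith
  then show ?thesis
  proof cases
    case 1
    have "((\<lambda>y. 0) has_real_derivative 0) (at y)" by simp
    then have "(flat p has_real_derivative 0) (at y)"
      by (rule DERIV_cong_ev[THEN iffD1, OF refl _ refl, rotated])
        (use eventually_nhds_in_open[of "{..<0}" y] 1 in \<open>auto elim!: eventually_mono simp: flat_def\<close>)
    then show ?thesis using 1 by (simp add: flat_def)
  next
    case 2
    have "((\<lambda>u. poly ([:0, 1:] * p) u * exp (- u)) \<longlongrightarrow> 0) at_top" by (rule poly_exp_decay)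
    then have "((\<lambda>h. poly ([:0, 1:] * p) (1 / h) * exp (- (1 / h))) \<longlongrightarrow> 0) (at_right 0)"
      by (rule filterlim_compose) (simp add: filterlim_inverse_at_top_right flip: inverse_eq_divide)
    then have r: "((\<lambda>h. (flat p (0 + h) - flat p 0) / h) \<longlongrightarrow> 0) (at_right 0)"
      by (rule Lim_transform_eventually)
        (use eventually_at_right_less[of 0] in \<open>auto elim!: eventually_mono simp: flat_def\<close>)
    have l: "((\<lambda>h. (flat p (0 + h) - flat p 0) / h) \<longlongrightarrow> 0) (at_left 0)"
      by (rule Lim_transform_eventually[OF tendsto_const])
        (auto simp: flat_def eventually_at_filter)
    have "(flat p has_real_derivative 0) (at 0)"
      unfolding DERIV_def using filterlim_split_at[OF l r] by simp
    then show ?thesis using 2 by (simp add: flat_def)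
  next
    case 3
    have "((\<lambda>y. poly p (1 / y) * exp (- 1 / y)) has_real_derivative
        flat ([:0, 0, 1:] * (p - pderiv p)) y) (at y)"
      using 3 by (auto intro!: derivative_eq_intros DERIV_chain2[OF poly_DERIV]
          simp: flat_def field_simps power2_eq_square)
    then show ?thesis
      by (rule DERIV_cong_ev[THEN iffD1, OF refl _ refl, rotated])
        (use eventually_nhds_in_open[of "{0<..}" y] 3 in \<open>auto elim!: eventually_mono simp: flat_def\<close>)
  qed
qed

text \<open>An algebra of functions that contains the derivatives of its elements; this gives
  smoothness of products without a formula for their iterated derivatives.\<close>

inductive smooth_alg :: "(real \<Rightarrow> real) \<Rightarrow> bool" where
  smooth_const: "smooth_alg (\<lambda>x. a)"
| smooth_flat: "smooth_alg (\<lambda>x. flat p (c * x + d))"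
| smooth_sin: "smooth_alg (\<lambda>x. sin (c * x))"
| smooth_cos: "smooth_alg (\<lambda>x. cos (c * x))"
| smooth_add: "smooth_alg f \<Longrightarrow> smooth_alg g \<Longrightarrow> smooth_alg (\<lambda>x. f x + g x)"
| smooth_mult: "smooth_alg f \<Longrightarrow> smooth_alg g \<Longrightarrow> smooth_alg (\<lambda>x. f x * g x)"

lemma smooth_alg_derivative:
  "smooth_alg f \<Longrightarrow> \<exists>g. smooth_alg g \<and> (\<forall>x. (f has_real_derivative g x) (at x))"
proof (induction rule: smooth_alg.induct)
  case (smooth_const a)
  show ?case by (rule exI[of _ "\<lambda>x. 0"]) (auto intro: smooth_alg.intros)
next
  case (smooth_flat p c d)
  show ?case
    by (rule exI[of _ "\<lambda>x. c * flat ([:0, 0, 1:] * (p - pderiv p)) (c * x + d)"])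
      (auto intro!: smooth_alg.intros DERIV_chain2[OF flat_has_derivative, THEN DERIV_cong] derivative_eq_intros)
next
  case (smooth_sin c)
  show ?case
    by (rule exI[of _ "\<lambda>x. c * cos (c * x)"]) (auto intro!: smooth_alg.intros derivative_eq_intros)
next
  case (smooth_cos c)
  show ?case
    by (intro exI[of _ "\<lambda>x. (- c) * sin (c * x)"] conjI allI smooth_alg.intros)
      (auto intro!: derivative_eq_intros)
next
  case (smooth_add f g)
  then obtain f' g' where "smooth_alg f'" "\<And>x. (f has_real_derivative f' x) (at x)"
    "smooth_alg g'" "\<And>x. (g has_real_derivative g' x) (at x)" by auto
  then show ?case
    by (intro exI[of _ "\<lambda>x. f' x + g' x"]) (auto intro!: smooth_alg.intros derivative_eq_intros)
next
  case (smooth_mult f g)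
  then obtain f' g' where "smooth_alg f'" "\<And>x. (f has_real_derivative f' x) (at x)"
    "smooth_alg g'" "\<And>x. (g has_real_derivative g' x) (at x)" by auto
  then show ?case
    using smooth_mult.hyps
    by (intro exI[of _ "\<lambda>x. f' x * g x + g' x * f x"]) (auto intro!: smooth_alg.intros DERIV_mult)
qed

text \<open>The cutoff of \<open>sin (\<kappa> t)\<close>: the layers near \<open>0\<close> and \<open>T\<close> have width \<open>1/n\<close>, and the sine vanishes
  linearly there, so the derivatives stay bounded.\<close>

definition cut_sin :: "real \<Rightarrow> real \<Rightarrow> nat \<Rightarrow> real \<Rightarrow> real" where
  "cut_sin T \<kappa> n t = sin (\<kappa> * t) * (flat [:1:] (real n * t - 1) * flat [:1:] (real n * (T - t) - 1))"

text \<open>The product rule, with \<open>flat [:0, 0, 1:]\<close> as the derivative of \<open>flat [:1:]\<close>.\<close>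

definition cut_sin' :: "real \<Rightarrow> real \<Rightarrow> nat \<Rightarrow> real \<Rightarrow> real" where
  "cut_sin' T \<kappa> n t = \<kappa> * cos (\<kappa> * t) * (flat [:1:] (real n * t - 1) * flat [:1:] (real n * (T - t) - 1))
     + sin (\<kappa> * t) * (real n * flat [:0, 0, 1:] (real n * t - 1) * flat [:1:] (real n * (T - t) - 1)
        - flat [:1:] (real n * t - 1) * (real n * flat [:0, 0, 1:] (real n * (T - t) - 1)))"

lemma cut_sin_has_derivative: "(cut_sin T \<kappa> n has_real_derivative cut_sin' T \<kappa> n t) (at t)"
proof -
  have d: "(flat [:1:] has_real_derivative flat [:0, 0, 1:] y) (at y)" for y
    using flat_has_derivative[of "[:1:]" y] by (simp add: pderiv_pCons)
  have 1: "((\<lambda>t. flat [:1:] (real n * t - 1)) has_real_derivative real n * flat [:0, 0, 1:] (real n * t - 1)) (at t)"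
    by (auto intro!: DERIV_chain2[OF d, THEN DERIV_cong] derivative_eq_intros)
  have 2: "((\<lambda>t. flat [:1:] (real n * (T - t) - 1)) has_real_derivative
      - (real n * flat [:0, 0, 1:] (real n * (T - t) - 1))) (at t)"
    by (auto intro!: DERIV_chain2[OF d, THEN DERIV_cong] derivative_eq_intros)
  have 3: "((\<lambda>t. sin (\<kappa> * t)) has_real_derivative \<kappa> * cos (\<kappa> * t)) (at t)"
    by (auto intro!: derivative_eq_intros)
  show ?thesis
    unfolding cut_sin_def[abs_def] cut_sin'_def
    by (rule DERIV_cong[OF DERIV_mult[OF 3 DERIV_mult[OF 1 2]]]) (simp add: algebra_simps)
qed

lemma cut_sin_test_function:
  assumes "n > 0"
  shows "cut_sin T \<kappa> n \<in> test_functions T"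
proof -
  have "smooth_alg (\<lambda>t. sin (\<kappa> * t) * (flat [:1:] (real n * t + (-1)) * flat [:1:] (- real n * t + (real n * T - 1))))"
    by (intro smooth_alg.intros)
  moreover have "cut_sin T \<kappa> n = (\<lambda>t. sin (\<kappa> * t) * (flat [:1:] (real n * t + (-1)) * flat [:1:] (- real n * t + (real n * T - 1))))"
    unfolding cut_sin_def[abs_def] by (simp add: algebra_simps)
  ultimately have "smooth_alg (cut_sin T \<kappa> n)" by simp
  then have "\<forall>k x. (deriv ^^ k) (cut_sin T \<kappa> n) differentiable at x"
    using smooth_if_closed_under_derivatives[OF smooth_alg_derivative] by simp
  moreover have "cut_sin T \<kappa> n x = 0" if "x \<notin> {1 / real n..T - 1 / real n}" for x
  proof -
    have "real n * x - 1 \<le> 0 \<or> real n * (T - x) - 1 \<le> 0"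
      using that assms by (auto simp: field_simps)
    then show ?thesis unfolding cut_sin_def flat_def by auto
  qed
  ultimately show ?thesis
    unfolding test_functions_def using assms
    by (intro CollectI conjI exI[of _ "1 / real n"] exI[of _ "T - 1 / real n"]) auto
qed

lemma flat_one_bounds: "0 \<le> flat [:1:] y" "flat [:1:] y \<le> 1"
  unfolding flat_def by auto

text \<open>With \<open>u = 1/y\<close> the product is \<open>(u + u\<^sup>2) e\<^bsup>-u\<^esup>\<close>. The factor \<open>y + 1\<close> is the rescaled distance
  \<open>n t\<close> to the end point when \<open>y = n t - 1\<close>.\<close>

lemma flat_square_bound:
  "0 \<le> (y + 1) * flat [:0, 0, 1:] y" "(y + 1) * flat [:0, 0, 1:] y \<le> 3"
proof -
  have "0 \<le> (y + 1) * flat [:0, 0, 1:] y \<and> (y + 1) * flat [:0, 0, 1:] y \<le> 3"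
  proof (cases "y > 0")
    case True
    define u where "u = 1 / y"
    have u: "u > 0" unfolding u_def using True by simp
    have "(y + 1) * flat [:0, 0, 1:] y = (u + u\<^sup>2) * exp (- u)"
      unfolding flat_def u_def using True by (simp add: field_simps power2_eq_square)
    moreover have "(u + u\<^sup>2) * exp (- u) \<le> 3"
    proof -
      have "u + u\<^sup>2 \<le> 3 * exp u"
        using exp_lower_Taylor_quadratic[of u] u zero_le_power2[of u] by linarith
      then have "(u + u\<^sup>2) / exp u \<le> 3" by (simp add: pos_divide_le_eq)
      then show ?thesis by (simp add: exp_minus divide_inverse)
    qed
    ultimately show ?thesis using u by simp
  qed (simp add: flat_def)
  then show "0 \<le> (y + 1) * flat [:0, 0, 1:] y" "(y + 1) * flat [:0, 0, 1:] y \<le> 3" by auto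
qed

lemma flat_one_at_top: "(flat [:1:] \<longlongrightarrow> 1) at_top"
proof -
  have "((\<lambda>y::real. exp (- 1 / y)) \<longlongrightarrow> exp 0) at_top"
    by (intro tendsto_exp real_tendsto_divide_at_top[OF tendsto_const filterlim_ident])
  moreover have "eventually (\<lambda>y. exp (- 1 / y) = flat [:1:] y) at_top"
    using eventually_gt_at_top[of 0] by eventually_elim (simp add: flat_def)
  ultimately show ?thesis using Lim_transform_eventually by fastforce
qed

lemma flat_square_at_top: "((\<lambda>y. (y + 1) * flat [:0, 0, 1:] y) \<longlongrightarrow> 0) at_top"
proof -
  have "((\<lambda>y::real. (1 / y + 1 / y * (1 / y)) * exp (- 1 / y)) \<longlongrightarrow> (0 + 0 * 0) * exp 0) at_top"
    by (intro tendsto_intros real_tendsto_divide_at_top[OF tendsto_const filterlim_ident])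
  moreover have "eventually (\<lambda>y. (1 / y + 1 / y * (1 / y)) * exp (- 1 / y)
      = (y + 1) * flat [:0, 0, 1:] y) at_top"
    using eventually_gt_at_top[of 0] by eventually_elim (simp add: flat_def field_simps)
  ultimately show ?thesis using Lim_transform_eventually by fastforce
qed

lemma layer_limits:
  assumes "t > 0"
  shows "(\<lambda>n. flat [:1:] (real n * t - 1)) \<longlonglongrightarrow> 1"
    and "(\<lambda>n. real n * t * flat [:0, 0, 1:] (real n * t - 1)) \<longlonglongrightarrow> 0"
proof -
  have "filterlim (\<lambda>n. t * real n) at_top sequentially"
    using assms by (intro filterlim_tendsto_pos_mult_at_top[OF tendsto_const] filterlim_real_sequentially)
  then have "filterlim (\<lambda>n. -1 + t * real n) at_top sequentially"
    by (rule filterlim_tendsto_add_at_top[OF tendsto_const])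
  then have l: "filterlim (\<lambda>n. real n * t - 1) at_top sequentially"
    by (simp add: algebra_simps)
  show "(\<lambda>n. flat [:1:] (real n * t - 1)) \<longlonglongrightarrow> 1"
    by (rule filterlim_compose[OF flat_one_at_top l])
  show "(\<lambda>n. real n * t * flat [:0, 0, 1:] (real n * t - 1)) \<longlonglongrightarrow> 0"
    using filterlim_compose[OF flat_square_at_top l] by simp
qed

lemma sin_layer_bounds:
  assumes s: "\<bar>s\<bar> \<le> \<kappa> * t" and \<kappa>: "\<kappa> \<ge> 0"
  shows "\<bar>s * (real n * flat [:0, 0, 1:] (real n * t - 1))\<bar> \<le> \<kappa> * (real n * t * flat [:0, 0, 1:] (real n * t - 1))"
    and "\<bar>s * (real n * flat [:0, 0, 1:] (real n * t - 1))\<bar> \<le> 3 * \<kappa>"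
proof -
  have f: "0 \<le> flat [:0, 0, 1:] (real n * t - 1)" unfolding flat_def by simp
  have "\<bar>s * (real n * flat [:0, 0, 1:] (real n * t - 1))\<bar> = \<bar>s\<bar> * (real n * flat [:0, 0, 1:] (real n * t - 1))"
    using f by (simp add: abs_mult)
  also have "\<dots> \<le> (\<kappa> * t) * (real n * flat [:0, 0, 1:] (real n * t - 1))"
    using s f by (intro mult_right_mono) auto
  finally show 1: "\<bar>s * (real n * flat [:0, 0, 1:] (real n * t - 1))\<bar> \<le> \<kappa> * (real n * t * flat [:0, 0, 1:] (real n * t - 1))"
    by (simp add: algebra_simps)
  also have "\<dots> \<le> \<kappa> * 3"
    using flat_square_bound(2)[of "real n * t - 1"] \<kappa> by (intro mult_left_mono) auto
  finally show "\<bar>s * (real n * flat [:0, 0, 1:] (real n * t - 1))\<bar> \<le> 3 * \<kappa>" by simp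
qed

lemma sin_boundary_bounds:
  fixes \<kappa> T t :: real
  assumes "\<kappa> \<ge> 0" "sin (\<kappa> * T) = 0" "0 < t" "t < T"
  shows "\<bar>sin (\<kappa> * t)\<bar> \<le> \<kappa> * t" "\<bar>sin (\<kappa> * t)\<bar> \<le> \<kappa> * (T - t)"
proof -
  show "\<bar>sin (\<kappa> * t)\<bar> \<le> \<kappa> * t"
    using abs_sin_x_le_abs_x[of "\<kappa> * t"] assms by (simp add: abs_mult)
  have "\<bar>cos (\<kappa> * T)\<bar> = 1"
    using sin_cos_squared_add[of "\<kappa> * T"] assms(2) by (simp add: power2_eq_1_iff) auto
  moreover have "sin (\<kappa> * (T - t)) = - cos (\<kappa> * T) * sin (\<kappa> * t)"
    by (simp add: right_diff_distrib sin_diff assms(2))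
  ultimately have "\<bar>sin (\<kappa> * t)\<bar> = \<bar>sin (\<kappa> * (T - t))\<bar>" by (simp add: abs_mult)
  also have "\<dots> \<le> \<kappa> * (T - t)"
    using abs_sin_x_le_abs_x[of "\<kappa> * (T - t)"] assms by (simp add: abs_mult)
  finally show "\<bar>sin (\<kappa> * t)\<bar> \<le> \<kappa> * (T - t)" .
qed

lemma cut_sin_limit:
  assumes "0 < t" "t < T"
  shows "(\<lambda>n. cut_sin T \<kappa> n t) \<longlonglongrightarrow> sin (\<kappa> * t)"
proof -
  have "(\<lambda>n. cut_sin T \<kappa> n t) \<longlonglongrightarrow> sin (\<kappa> * t) * (1 * 1)"
    unfolding cut_sin_def using assms by (intro tendsto_intros layer_limits) auto
  then show ?thesis by simp
qed

lemma cut_sin'_limit: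
  assumes \<kappa>: "\<kappa> \<ge> 0" "sin (\<kappa> * T) = 0" and t: "0 < t" "t < T"
  shows "(\<lambda>n. cut_sin' T \<kappa> n t) \<longlonglongrightarrow> \<kappa> * cos (\<kappa> * t)"
proof -
  note b = sin_boundary_bounds[OF \<kappa> t]
  have 1: "(\<lambda>n. sin (\<kappa> * t) * (real n * flat [:0, 0, 1:] (real n * t - 1))) \<longlonglongrightarrow> 0"
  proof (rule Lim_null_comparison)
    show "(\<lambda>n. \<kappa> * (real n * t * flat [:0, 0, 1:] (real n * t - 1))) \<longlonglongrightarrow> 0"
      using tendsto_mult_right_zero[OF layer_limits(2)[OF t(1)]] .
  qed (use sin_layer_bounds(1)[OF b(1) \<kappa>(1)] in simp)
  have 2: "(\<lambda>n. sin (\<kappa> * t) * (real n * flat [:0, 0, 1:] (real n * (T - t) - 1))) \<longlonglongrightarrow> 0"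
  proof (rule Lim_null_comparison)
    show "(\<lambda>n. \<kappa> * (real n * (T - t) * flat [:0, 0, 1:] (real n * (T - t) - 1))) \<longlonglongrightarrow> 0"
      using tendsto_mult_right_zero[OF layer_limits(2)[of "T - t"]] t by simp
  qed (use sin_layer_bounds(1)[OF b(2) \<kappa>(1)] in simp)
  have "(\<lambda>n. \<kappa> * cos (\<kappa> * t) * (flat [:1:] (real n * t - 1) * flat [:1:] (real n * (T - t) - 1))
     + (sin (\<kappa> * t) * (real n * flat [:0, 0, 1:] (real n * t - 1)) * flat [:1:] (real n * (T - t) - 1)
        - flat [:1:] (real n * t - 1) * (sin (\<kappa> * t) * (real n * flat [:0, 0, 1:] (real n * (T - t) - 1)))))
      \<longlonglongrightarrow> \<kappa> * cos (\<kappa> * t) * (1 * 1) + (0 * 1 - 1 * 0)"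
    using t by (intro tendsto_intros layer_limits 1 2) auto
  then show ?thesis unfolding cut_sin'_def by (simp add: algebra_simps)
qed

lemma cut_sin_bounds:
  assumes \<kappa>: "\<kappa> \<ge> 0" "sin (\<kappa> * T) = 0" and t: "0 < t" "t < T"
  shows "\<bar>cut_sin T \<kappa> n t\<bar> \<le> 1" "\<bar>cut_sin' T \<kappa> n t\<bar> \<le> 7 * \<kappa>"
proof -
  note b = sin_boundary_bounds[OF \<kappa> t]
  define p q where "p = flat [:1:] (real n * t - 1)" and "q = flat [:1:] (real n * (T - t) - 1)"
  have pq: "\<bar>p\<bar> \<le> 1" "\<bar>q\<bar> \<le> 1" unfolding p_def q_def using flat_one_bounds by auto
  have prod_le: "\<bar>x * y\<bar> \<le> C" if "\<bar>x\<bar> \<le> C" "\<bar>y\<bar> \<le> 1" for x y C :: real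
    using mult_mono[OF that] that by (simp add: abs_mult) 
  show "\<bar>cut_sin T \<kappa> n t\<bar> \<le> 1"
    unfolding cut_sin_def p_def[symmetric] q_def[symmetric] by (intro prod_le pq) auto
  define x y where "x = sin (\<kappa> * t) * (real n * flat [:0, 0, 1:] (real n * t - 1))"
    and "y = sin (\<kappa> * t) * (real n * flat [:0, 0, 1:] (real n * (T - t) - 1))"
  have "cut_sin' T \<kappa> n t = \<kappa> * cos (\<kappa> * t) * (p * q) + (x * q - y * p)"
    unfolding cut_sin'_def p_def q_def x_def y_def by (simp add: algebra_simps)
  moreover have "\<bar>\<kappa> * cos (\<kappa> * t) * (p * q)\<bar> \<le> \<kappa>"
    using \<kappa>(1) by (intro prod_le pq) auto
  moreover have "\<bar>x * q\<bar> \<le> 3 * \<kappa>" "\<bar>y * p\<bar> \<le> 3 * \<kappa>"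
    unfolding x_def y_def by (intro prod_le sin_layer_bounds(2) b \<kappa>(1) pq)+
  ultimately show "\<bar>cut_sin' T \<kappa> n t\<bar> \<le> 7 * \<kappa>" by linarith
qed

text \<open>Sine modes are not compactly supported in the interval, but they are boundedly pointwise
  limits of the test functions above, together with their derivatives.\<close>

lemma weak_derivative_sin:
  fixes a b :: "real \<Rightarrow> real"
  assumes a: "set_integrable lebesgue {0<..<T} a" and b: "set_integrable lebesgue {0<..<T} b"
    and weak: "\<And>\<phi>. \<phi> \<in> test_functions T \<Longrightarrow>
      (LINT t:{0<..<T}|lebesgue. deriv \<phi> t * a t) = - (LINT t:{0<..<T}|lebesgue. \<phi> t * b t)"
    and \<kappa>: "\<kappa> \<ge> 0" "sin (\<kappa> * T) = 0"
  shows "(LINT t:{0<..<T}|lebesgue. \<kappa> * cos (\<kappa> * t) * a t)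
      = - (LINT t:{0<..<T}|lebesgue. sin (\<kappa> * t) * b t)"
proof -
  let ?I = "\<lambda>t. indicator {0<..<T} t :: real"
  have lim: "(\<lambda>n. LINT t:{0<..<T}|lebesgue. f n t * h t) \<longlonglongrightarrow> (LINT t:{0<..<T}|lebesgue. g t * h t)"
    if h: "set_integrable lebesgue {0<..<T} h" and fc: "\<And>n. continuous_on UNIV (f n)"
      and gc: "continuous_on UNIV g"
      and fl: "\<And>t. 0 < t \<Longrightarrow> t < T \<Longrightarrow> (\<lambda>n. f n t) \<longlonglongrightarrow> g t"
      and fb: "\<And>n t. 0 < t \<Longrightarrow> t < T \<Longrightarrow> \<bar>f n t\<bar> \<le> C"
    for f :: "nat \<Rightarrow> real \<Rightarrow> real" and g h :: "real \<Rightarrow> real" and C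
  proof -
    have hi: "integrable lebesgue (\<lambda>t. ?I t * h t)"
      using h unfolding set_integrable_def by simp
    have m: "(\<lambda>t. ?I t *\<^sub>R (c t * h t)) \<in> borel_measurable lebesgue" if "continuous_on UNIV c" for c :: "real \<Rightarrow> real"
    proof -
      have "c \<in> borel_measurable lebesgue"
        by (rule borel_measurable_lebesgueI[OF borel_measurable_continuous_onI[OF that]])
      then have "(\<lambda>t. c t * (?I t * h t)) \<in> borel_measurable lebesgue"
        by (intro borel_measurable_times borel_measurable_integrable[OF hi])
      then show ?thesis by (simp add: algebra_simps)
    qed
    show ?thesis
      unfolding set_lebesgue_integral_def
    proof (rule Bochner_Integration.integral_dominated_convergence)
      show "integrable lebesgue (\<lambda>t. C * \<bar>?I t * h t\<bar>)"
        by (intro integrable_mult_right integrable_abs hi)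
      show "AE t in lebesgue. (\<lambda>n. ?I t *\<^sub>R (f n t * h t)) \<longlonglongrightarrow> ?I t *\<^sub>R (g t * h t)"
        by (intro AE_I2) (auto simp: indicator_def intro!: tendsto_intros fl)
      show "AE t in lebesgue. norm (?I t *\<^sub>R (f n t * h t)) \<le> C * \<bar>?I t * h t\<bar>" for n
        by (intro AE_I2) (auto simp: indicator_def abs_mult intro!: mult_right_mono fb)
    qed (intro m fc gc)+
  qed
  have cd: "deriv (cut_sin T \<kappa> n) = cut_sin' T \<kappa> n" for n
    using DERIV_imp_deriv[OF cut_sin_has_derivative] by (rule ext)
  have contf: "continuous_on UNIV (flat p)" for p
    by (intro continuous_at_imp_continuous_on ballI DERIV_isCont[OF flat_has_derivative])
  have contfc: "continuous_on UNIV (\<lambda>t. flat p (c t))" if "continuous_on UNIV c" for p c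
    using continuous_on_compose2[OF contf that] by simp
  have c1: "continuous_on UNIV (cut_sin T \<kappa> n)" "continuous_on UNIV (cut_sin' T \<kappa> n)" for n
    unfolding cut_sin_def[abs_def] cut_sin'_def[abs_def]
    by (intro continuous_intros contfc)+
  have 1: "(\<lambda>n. LINT t:{0<..<T}|lebesgue. cut_sin' T \<kappa> n t * a t)
      \<longlonglongrightarrow> (LINT t:{0<..<T}|lebesgue. \<kappa> * cos (\<kappa> * t) * a t)"
    by (intro lim[OF a, where C="7 * \<kappa>"] c1 cut_sin'_limit cut_sin_bounds \<kappa> continuous_intros)
  have 2: "(\<lambda>n. - (LINT t:{0<..<T}|lebesgue. cut_sin T \<kappa> n t * b t))
      \<longlonglongrightarrow> - (LINT t:{0<..<T}|lebesgue. sin (\<kappa> * t) * b t)"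
    by (intro tendsto_minus lim[OF b, where C=1] c1 cut_sin_limit cut_sin_bounds \<kappa> continuous_intros)
  have "eventually (\<lambda>n. - (LINT t:{0<..<T}|lebesgue. cut_sin T \<kappa> n t * b t)
      = (LINT t:{0<..<T}|lebesgue. cut_sin' T \<kappa> n t * a t)) sequentially"
    using eventually_gt_at_top[of 0]
  proof eventually_elim
    case (elim n)
    show ?case using weak[OF cut_sin_test_function[OF elim], of \<kappa>] by (simp add: cd)
  qed
  from Lim_transform_eventually[OF 2 this] 1 show ?thesis by (rule LIMSEQ_unique[symmetric])
qed

text \<open>Testing against continuous approximations of the sign of \<open>h\<close> gives \<open>\<integral>\<bar>h\<bar> = 0\<close>.\<close>

lemma AE_zero_if_orthogonal_to_continuous:
  fixes h :: "real \<Rightarrow> real"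
  assumes h: "integrable lebesgue h"
    and orth: "\<And>c. continuous_on UNIV c \<Longrightarrow> (\<And>t. \<bar>c t\<bar> \<le> 1) \<Longrightarrow> (LINT t|lebesgue. h t * c t) = 0"
  shows "AE t in lebesgue. h t = 0"
proof -
  have hm: "h \<in> borel_measurable lebesgue" by (rule borel_measurable_integrable[OF h])
  have "(\<lambda>t. sgn (h t)) \<in> borel_measurable lebesgue"
    using measurable_compose[OF hm borel_measurable_sgn] .
  then have "(\<lambda>t. sgn (h t)) measurable_on UNIV"
    by (rule lebesgue_measurable_imp_measurable_on) simp
  then obtain N g where N: "negligible N" and gc: "\<And>n. continuous_on UNIV (g n)"
    and gl: "\<And>t. t \<notin> N \<Longrightarrow> (\<lambda>n. g n t) \<longlonglongrightarrow> sgn (h t)"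
    unfolding measurable_on_def by auto
  define c where "c n t = max (-1) (min 1 (g n t))" for n :: nat and t :: real
  have cc: "continuous_on UNIV (c n)" for n
    unfolding c_def by (intro continuous_intros gc)
  have cb: "\<bar>c n t\<bar> \<le> 1" for n t unfolding c_def by auto
  have cl: "(\<lambda>n. c n t) \<longlonglongrightarrow> sgn (h t)" if "t \<notin> N" for t
  proof -
    have "(\<lambda>n. c n t) \<longlonglongrightarrow> max (-1) (min 1 (sgn (h t)))"
      unfolding c_def by (intro tendsto_intros gl that)
    moreover have "max (-1) (min 1 (sgn (h t))) = sgn (h t)" by (auto simp: sgn_real_def)
    ultimately show ?thesis by simp
  qed
  have cm: "c n \<in> borel_measurable lebesgue" for n
    by (rule borel_measurable_lebesgueI[OF borel_measurable_continuous_onI[OF cc]])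
  have "(\<lambda>n. LINT t|lebesgue. h t * c n t) \<longlonglongrightarrow> (LINT t|lebesgue. h t * sgn (h t))"
  proof (rule Bochner_Integration.integral_dominated_convergence)
    show "integrable lebesgue (\<lambda>t. \<bar>h t\<bar>)" by (rule integrable_abs[OF h])
    have "AE t in lebesgue. t \<notin> N"
      using N by (intro AE_not_in) (simp add: negligible_iff_null_sets)
    then show "AE t in lebesgue. (\<lambda>n. h t * c n t) \<longlonglongrightarrow> h t * sgn (h t)"
      by eventually_elim (intro tendsto_intros cl)
    show "AE t in lebesgue. norm (h t * c n t) \<le> \<bar>h t\<bar>" for n
      using mult_left_mono[OF cb abs_ge_zero] by (intro AE_I2) (simp add: abs_mult)
    show "(\<lambda>t. h t * sgn (h t)) \<in> borel_measurable lebesgue"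
      by (intro borel_measurable_times hm measurable_compose[OF hm borel_measurable_sgn])
    show "(\<lambda>t. h t * c n t) \<in> borel_measurable lebesgue" for n
      by (intro borel_measurable_times hm cm)
  qed
  moreover have "(LINT t|lebesgue. h t * c n t) = 0" for n
    by (rule orth[OF cc cb])
  ultimately have "(LINT t|lebesgue. h t * sgn (h t)) = 0"
    by (simp add: LIMSEQ_const_iff)
  then have "(LINT t|lebesgue. \<bar>h t\<bar>) = 0"
    by (simp add: abs_sgn)
  then have "AE t in lebesgue. \<bar>h t\<bar> = 0"
    using integral_nonneg_eq_0_iff_AE[OF integrable_abs[OF h]] by simp
  then show ?thesis by simp
qed

lemma integrable_mult_bounded_continuous:
  fixes h c :: "real \<Rightarrow> real"
  assumes h: "integrable lebesgue h" and c: "continuous_on UNIV c" "\<And>t. \<bar>c t\<bar> \<le> C"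
  shows "integrable lebesgue (\<lambda>t. h t * c t)"
proof (rule Bochner_Integration.integrable_bound)
  show "integrable lebesgue (\<lambda>t. \<bar>h t\<bar> * C)" by (intro integrable_mult_left integrable_abs h)
  have "c \<in> borel_measurable lebesgue"
    by (rule borel_measurable_lebesgueI[OF borel_measurable_continuous_onI[OF c(1)]])
  then show "(\<lambda>t. h t * c t) \<in> borel_measurable lebesgue"
    by (intro borel_measurable_times borel_measurable_integrable[OF h])
  have "C \<ge> 0" using c(2)[of 0] by simp
  then show "AE t in lebesgue. norm (h t * c t) \<le> norm (\<bar>h t\<bar> * C)"
    by (intro AE_I2) (simp add: abs_mult mult_left_mono c(2))
qed

text \<open>Every continuous function on \<open>[0,T]\<close> is a continuous function of \<open>cos (\<pi> t / T)\<close>, hence by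
  Weierstrass a uniform limit of polynomials in that cosine.\<close>

lemma AE_zero_if_orthogonal_to_cos_powers:
  fixes h :: "real \<Rightarrow> real"
  assumes T: "T > 0" and h: "integrable lebesgue h" and supp: "\<And>t. t \<notin> {0<..<T} \<Longrightarrow> h t = 0"
    and orth: "\<And>i::nat. (LINT t|lebesgue. h t * cos (pi / T * t) ^ i) = 0"
  shows "AE t in lebesgue. h t = 0"
proof (rule AE_zero_if_orthogonal_to_continuous[OF h])
  fix c :: "real \<Rightarrow> real" assume c: "continuous_on UNIV c" "\<And>t. \<bar>c t\<bar> \<le> 1"
  define g where "g y = c (T / pi * arccos y)" for y
  have gc: "continuous_on {-1..1} g"
    unfolding g_def
    by (intro continuous_on_compose2[OF c(1)] continuous_intros continuous_on_arccos) auto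
  have gcos: "g (cos (pi / T * t)) = c t" if t: "0 < t" "t < T" for t
  proof -
    have "0 \<le> pi / T * t" "pi / T * t \<le> pi" using t T by (auto simp: field_simps)
    then have "arccos (cos (pi / T * t)) = pi / T * t" by (rule arccos_cos)
    then show ?thesis unfolding g_def using T by simp
  qed
  have bnd: "\<bar>LINT t|lebesgue. h t * c t\<bar> \<le> e * (LINT t|lebesgue. \<bar>h t\<bar>)" if e: "e > 0" for e
  proof -
    obtain p where p: "real_polynomial_function p" "\<And>y. y \<in> {-1..1} \<Longrightarrow> \<bar>g y - p y\<bar> < e"
      using Stone_Weierstrass_real_polynomial_function[OF compact_Icc gc e] by auto
    obtain a n where pa: "p = (\<lambda>y. \<Sum>i\<le>n. a i * y ^ i)"
      using p(1) real_polynomial_function_iff_sum by blast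
    have hcos: "integrable lebesgue (\<lambda>t. h t * cos (pi / T * t) ^ i)" for i
      by (intro integrable_mult_bounded_continuous[OF h, where C=1] continuous_intros)
        (simp add: power_abs power_le_one)
    have hp: "(\<lambda>t. h t * p (cos (pi / T * t))) = (\<lambda>t. \<Sum>i\<le>n. a i * (h t * cos (pi / T * t) ^ i))"
      unfolding pa by (simp add: sum_distrib_left algebra_simps)
    have i1: "integrable lebesgue (\<lambda>t. h t * p (cos (pi / T * t)))"
      unfolding hp by (intro Bochner_Integration.integrable_sum integrable_mult_right hcos)
    have "(LINT t|lebesgue. h t * p (cos (pi / T * t))) = 0"
      unfolding hp
      by (subst Bochner_Integration.integral_sum) (intro integrable_mult_right hcos, simp add: orth del: times_divide_eq_left)
    then have "(LINT t|lebesgue. h t * c t) = (LINT t|lebesgue. h t * c t - h t * p (cos (pi / T * t)))"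
      using i1 integrable_mult_bounded_continuous[OF h c] by simp
    also have "\<bar>\<dots>\<bar> \<le> (LINT t|lebesgue. \<bar>h t * c t - h t * p (cos (pi / T * t))\<bar>)"
      by (rule integral_abs_bound)
    also have "\<dots> \<le> (LINT t|lebesgue. e * \<bar>h t\<bar>)"
    proof (rule integral_mono)
      show "integrable lebesgue (\<lambda>t. \<bar>h t * c t - h t * p (cos (pi / T * t))\<bar>)"
        using i1 integrable_mult_bounded_continuous[OF h c] by simp
      show "integrable lebesgue (\<lambda>t. e * \<bar>h t\<bar>)" using h by simp
      fix t
      show "\<bar>h t * c t - h t * p (cos (pi / T * t))\<bar> \<le> e * \<bar>h t\<bar>"
      proof (cases "t \<in> {0<..<T}")
        case True
        then have "\<bar>c t - p (cos (pi / T * t))\<bar> \<le> e"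
          using p(2)[of "cos (pi / T * t)"] gcos[of t] by simp
        then have "\<bar>h t\<bar> * \<bar>c t - p (cos (pi / T * t))\<bar> \<le> \<bar>h t\<bar> * e"
          by (intro mult_left_mono) auto
        then show ?thesis by (simp flip: abs_mult add: right_diff_distrib mult.commute)
      qed (simp add: supp)
    qed
    finally show ?thesis by simp
  qed
  have "\<bar>LINT t|lebesgue. h t * c t\<bar> \<le> 0"
  proof (cases "(LINT t|lebesgue. \<bar>h t\<bar>) = 0")
    case False
    then have pos: "(LINT t|lebesgue. \<bar>h t\<bar>) > 0"
      by (simp add: order_less_le integral_nonneg_AE)
    show ?thesis
    proof (rule field_le_epsilon)
      fix e :: real assume "e > 0"
      then show "\<bar>LINT t|lebesgue. h t * c t\<bar> \<le> 0 + e"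
        using bnd[of "e / (LINT t|lebesgue. \<bar>h t\<bar>)"] pos by simp
    qed
  qed (use bnd[of 1] in simp)
  then show "(LINT t|lebesgue. h t * c t) = 0" by simp
qed

text \<open>The product formula shifts the frequency by one for each factor \<open>cos (\<pi> t / T)\<close>.\<close>

lemma integral_cos_power_mult_zero:
  fixes h e :: "real \<Rightarrow> real"
  assumes h: "integrable lebesgue h" and e: "continuous_on UNIV e" "\<And>x. \<bar>e x\<bar> \<le> 1"
    and prod: "\<And>x y. cos y * e x = (e (x + y) + e (x - y)) / 2"
    and orth: "\<And>m::int. (LINT t|lebesgue. h t * e (of_int m * pi / T * t)) = 0"
  shows "(LINT t|lebesgue. h t * (cos (pi / T * t) ^ i * e (of_int m * pi / T * t))) = 0"
proof (induction i arbitrary: m)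
  case 0
  then show ?case using orth by simp
next
  case (Suc i)
  have int: "integrable lebesgue (\<lambda>t. h t * (cos (pi / T * t) ^ i * e (of_int m * pi / T * t)))" for m :: int
    by (intro integrable_mult_bounded_continuous[OF h, where C=1] continuous_intros continuous_on_compose2[OF e(1)])
      (simp_all add: power_abs power_le_one abs_mult mult_le_one e(2))
  have "cos (pi / T * t) * e (of_int m * pi / T * t)
      = (e (of_int (m + 1) * pi / T * t) + e (of_int (m - 1) * pi / T * t)) / 2" for t
  proof -
    have "of_int (m + 1) * pi / T * t = of_int m * pi / T * t + pi / T * t"
      "of_int (m - 1) * pi / T * t = of_int m * pi / T * t - pi / T * t"
      by (simp_all add: add_divide_distrib diff_divide_distrib algebra_simps)
    then show ?thesis by (simp only: prod)
  qed
  then have "h t * (cos (pi / T * t) ^ Suc i * e (of_int m * pi / T * t))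
      = (h t * (cos (pi / T * t) ^ i * e (of_int (m + 1) * pi / T * t))
        + h t * (cos (pi / T * t) ^ i * e (of_int (m - 1) * pi / T * t))) / 2" for t
    by (simp only: power_Suc2 mult.assoc) (simp only: algebra_simps add_divide_distrib times_divide_eq_right)
  then show ?case
    using int[of "m + 1"] int[of "m - 1"] Suc.IH[of "m + 1"] Suc.IH[of "m - 1"] by (simp only:) simp
qed

lemma cos_total:
  fixes h :: "real \<Rightarrow> real"
  assumes T: "T > 0" and h: "integrable lebesgue h" and supp: "\<And>t. t \<notin> {0<..<T} \<Longrightarrow> h t = 0"
    and orth: "\<And>k::nat. (LINT t|lebesgue. h t * cos (real k * pi / T * t)) = 0"
  shows "AE t in lebesgue. h t = 0"
proof (rule AE_zero_if_orthogonal_to_cos_powers[OF T h supp])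
  have "(LINT t|lebesgue. h t * cos (of_int m * pi / T * t)) = 0" for m :: int
    using orth[of "nat m"] orth[of "nat (- m)"] by (cases "m \<ge> 0") simp_all
  then have "(LINT t|lebesgue. h t * (cos (pi / T * t) ^ i * cos (of_int 0 * pi / T * t))) = 0" for i
    by (intro integral_cos_power_mult_zero[OF h] continuous_intros) (simp_all add: cos_add cos_diff)
  then show "(LINT t|lebesgue. h t * cos (pi / T * t) ^ i) = 0" for i by simp
qed

text \<open>The products \<open>cos\<^sup>i sin\<close> reduce the claim to the cosine powers for \<open>h sin\<close>, and the sine
  has no zero inside the interval.\<close>

lemma sin_total:
  fixes h :: "real \<Rightarrow> real"
  assumes T: "T > 0" and h: "integrable lebesgue h" and supp: "\<And>t. t \<notin> {0<..<T} \<Longrightarrow> h t = 0"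
    and orth: "\<And>k::nat. (LINT t|lebesgue. h t * sin (real k * pi / T * t)) = 0"
  shows "AE t in lebesgue. h t = 0"
proof -
  have "(LINT t|lebesgue. h t * sin (of_int m * pi / T * t)) = 0" for m :: int
    using orth[of "nat m"] orth[of "nat (- m)"] by (cases "m \<ge> 0") simp_all
  then have *: "(LINT t|lebesgue. h t * (cos (pi / T * t) ^ i * sin (of_int 1 * pi / T * t))) = 0" for i
    by (intro integral_cos_power_mult_zero[OF h] continuous_intros) (simp_all add: sin_add sin_diff)
  have "AE t in lebesgue. h t * sin (pi / T * t) = 0"
  proof (rule AE_zero_if_orthogonal_to_cos_powers[OF T])
    show "integrable lebesgue (\<lambda>t. h t * sin (pi / T * t))"
      by (intro integrable_mult_bounded_continuous[OF h, where C=1] continuous_intros) simp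
    show "(LINT t|lebesgue. h t * sin (pi / T * t) * cos (pi / T * t) ^ i) = 0" for i
      using *[of i] by (simp add: algebra_simps)
  qed (simp add: supp)
  then show ?thesis
  proof eventually_elim
    fix t assume t: "h t * sin (pi / T * t) = 0"
    show "h t = 0"
    proof (cases "t \<in> {0<..<T}")
      case True
      then have "0 < pi / T * t" "pi / T * t < pi" using T by (auto simp: field_simps)
      then show ?thesis using t sin_gt_zero by force
    qed (rule supp)
  qed
qed

section \<open>The subspace of functions living on an interval\<close>

lemma square_integrable_restrict:
  fixes f :: "real \<Rightarrow> 'a::real_normed_vector"
  assumes f: "square_integrable f" and S: "S \<in> sets lebesgue"
  shows "square_integrable (\<lambda>t. if t \<in> S then f t else 0)"
proof -
  have "strongly_measurable lebesgue f" using f unfolding square_integrable_def by simp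
  then obtain s where s: "\<And>n. simple_function lebesgue (s n)"
    and lim: "AE x in lebesgue. (\<lambda>n::nat. s n x) \<longlonglongrightarrow> f x"
    unfolding strongly_measurable_def by blast
  have "simple_function lebesgue (\<lambda>t. if t \<in> S then s n t else 0)" for n
    by (rule simple_function_If_set[OF s]) (use S in simp_all)
  moreover have "AE t in lebesgue. (\<lambda>n. if t \<in> S then s n t else 0) \<longlonglongrightarrow> (if t \<in> S then f t else 0)"
    using lim by eventually_elim simp
  ultimately have sm: "strongly_measurable lebesgue (\<lambda>t. if t \<in> S then f t else 0)"
    unfolding strongly_measurable_def
    by (intro exI[of _ "\<lambda>n t. if t \<in> S then s n t else 0"] conjI allI)
  have "integrable lebesgue (\<lambda>t. (norm (if t \<in> S then f t else 0))\<^sup>2)"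
  proof (rule Bochner_Integration.integrable_bound[OF integrable_norm_square[OF f]])
    show "(\<lambda>t. (norm (if t \<in> S then f t else 0))\<^sup>2) \<in> borel_measurable lebesgue"
      by (rule borel_measurable_power[OF strongly_measurable_norm[OF sm]])
  qed (intro AE_I2, simp)
  with sm show ?thesis unfolding square_integrable_def by simp
qed

text \<open>Membership in the subspace is the vanishing of a bounded linear operator, the
  restriction to the complement of the interval.\<close>

definition L2_outside :: "real \<Rightarrow> 'a::real_normed_vector L2fun \<Rightarrow> 'a L2fun" where
  "L2_outside T w = abs_L2fun (\<lambda>t. if t \<in> - {0<..<T} then rep_L2fun w t else 0)"

lemma interval_lebesgue_sets: "{0<..<T::real} \<in> sets lebesgue" "- {0<..<T::real} \<in> sets lebesgue"
  by (simp_all add: Compl_in_sets_lebesgue)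

lemma integrable_indicator_interval: "integrable lebesgue (indicator {0<..<T} :: real \<Rightarrow> real)"
  by (rule integrable_real_indicator[OF interval_lebesgue_sets(1)])
    (cases "0 \<le> T"; simp add: emeasure_completion)

lemma rep_L2_outside:
  "AE t in lebesgue. rep_L2fun (L2_outside T w) t = (if t \<in> - {0<..<T} then rep_L2fun w t else 0)"
  unfolding L2_outside_def
  by (rule rep_abs_L2fun[OF square_integrable_restrict[OF square_integrable_rep interval_lebesgue_sets(2)]])

lemma bounded_linear_L2_outside: "bounded_linear (L2_outside T)"
proof (rule bounded_linear_intro[where K=1])
  fix w z :: "'a L2fun" and c
  show "L2_outside T (w + z) = L2_outside T w + L2_outside T z"
  proof (rule L2fun_eqI)
    show "AE t in lebesgue. rep_L2fun (L2_outside T (w + z)) t = rep_L2fun (L2_outside T w + L2_outside T z) t"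
      using rep_L2_outside[of T "w + z"] rep_L2_outside[of T w] rep_L2_outside[of T z] rep_L2fun_add[of w z]
        rep_L2fun_add[of "L2_outside T w" "L2_outside T z"]
      by eventually_elim simp
  qed
  show "L2_outside T (c *\<^sub>R w) = c *\<^sub>R L2_outside T w"
  proof (rule L2fun_eqI)
    show "AE t in lebesgue. rep_L2fun (L2_outside T (c *\<^sub>R w)) t = rep_L2fun (c *\<^sub>R L2_outside T w) t"
      using rep_L2_outside[of T "c *\<^sub>R w"] rep_L2_outside[of T w] rep_L2fun_scaleR[of c w]
        rep_L2fun_scaleR[of c "L2_outside T w"]
      by eventually_elim simp
  qed
  note sq = square_integrable_restrict[OF square_integrable_rep[of w] interval_lebesgue_sets(2)[of T]]
  have "(norm (L2_outside T w))\<^sup>2 = (LINT t|lebesgue. (norm (if t \<in> - {0<..<T} then rep_L2fun w t else 0))\<^sup>2)"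
    unfolding L2_outside_def by (rule norm_abs_L2fun[OF sq])
  also have "\<dots> \<le> (LINT t|lebesgue. (norm (rep_L2fun w t))\<^sup>2)"
  proof (rule integral_mono[OF integrable_norm_square[OF sq] integrable_norm_square[OF square_integrable_rep]])
    fix t show "(norm (if t \<in> - {0<..<T} then rep_L2fun w t else 0))\<^sup>2 \<le> (norm (rep_L2fun w t))\<^sup>2" by simp
  qed
  finally have "(norm (L2_outside T w))\<^sup>2 \<le> (norm w)\<^sup>2" by (simp add: norm_L2fun_square)
  then have "norm (L2_outside T w) \<le> norm w" by (rule power2_le_imp_le) simp
  then show "norm (L2_outside T w) \<le> norm w * 1" by simp
qed

lemma L2_on_iff_outside: "w \<in> L2_on T \<longleftrightarrow> L2_outside T w = 0"
proof
  assume "w \<in> L2_on T"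
  then have "AE t in lebesgue. t \<notin> {0<..<T} \<longrightarrow> rep_L2fun w t = 0" unfolding L2_on_def by simp
  then have "AE t in lebesgue. rep_L2fun (L2_outside T w) t = rep_L2fun 0 t"
    using rep_L2_outside[of T w] rep_L2fun_zero by eventually_elim auto
  then show "L2_outside T w = 0" by (rule L2fun_eqI)
next
  assume "L2_outside T w = 0"
  then have "AE t in lebesgue. rep_L2fun (L2_outside T w) t = 0" using rep_L2fun_zero by metis
  then have "AE t in lebesgue. t \<notin> {0<..<T} \<longrightarrow> rep_L2fun w t = 0"
    using rep_L2_outside[of T w] by eventually_elim (auto split: if_splits)
  then show "w \<in> L2_on T" unfolding L2_on_def by simp
qed

lemma subspace_L2_on: "subspace (L2_on T)"
proof -
  interpret bounded_linear "L2_outside T :: 'a L2fun \<Rightarrow> _" by (rule bounded_linear_L2_outside)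
  show ?thesis by (auto simp: subspace_def L2_on_iff_outside zero add scale)
qed

lemma closed_L2_on: "closed (L2_on T :: 'a::real_normed_vector L2fun set)"
proof -
  have "L2_on T = {w :: 'a L2fun. L2_outside T w = 0}" using L2_on_iff_outside by auto
  then show ?thesis
    using closed_Collect_eq[OF linear_continuous_on[OF bounded_linear_L2_outside] continuous_on_const, of T 0] by simp
qed

lemma complete_L2_on: "complete (L2_on T :: 'a::{real_normed_vector, complete_space} L2fun set)"
  using closed_L2_on complete_eq_closed by blast

lemma L2_on_AE: "w \<in> L2_on T \<Longrightarrow> AE t in lebesgue. t \<notin> {0<..<T} \<longrightarrow> rep_L2fun w t = 0"
  unfolding L2_on_def by simp

lemma L2map_L2_on:
  assumes "w \<in> L2_on T"
  shows "L2map F w \<in> L2_on T"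
  unfolding L2_on_def mem_Collect_eq using rep_L2map[of F w] L2_on_AE[OF assms]
  by eventually_elim (auto simp: blinfun.zero_right)

definition L2_cont :: "real \<Rightarrow> (real \<Rightarrow> 'a::real_normed_vector) \<Rightarrow> 'a L2fun" where
  "L2_cont T f = abs_L2fun (\<lambda>t. if t \<in> {0<..<T} then f t else 0)"

text \<open>Sampling on a grid of mesh width \<open>1 / (n + 1)\<close> yields simple functions with limit \<open>f\<close>.\<close>

lemma square_integrable_continuous:
  fixes f :: "real \<Rightarrow> 'a::real_normed_vector"
  assumes f: "continuous_on {0..T} f"
  shows "square_integrable (\<lambda>t. if t \<in> {0<..<T} then f t else 0)"
proof -
  \<comment> \<open>The grid point below \<open>t\<close>; the value \<open>-1\<close>, which is no grid point, marks the complement of the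
    interval.\<close>
  define r where "r n t = (if t \<in> {0<..<T} then real_of_int \<lfloor>real (Suc n) * t\<rfloor> / real (Suc n) else -1)" for n t
  define g where "g x = (if x = -1 then 0 else f x)" for x :: real
  have rb: "0 \<le> r n t \<and> r n t \<le> t \<and> \<bar>r n t - t\<bar> \<le> 1 / real (Suc n)" if t: "t \<in> {0<..<T}" for n t
  proof -
    define x where "x = real (Suc n) * t"
    have n: "real (Suc n) > 0" by simp
    have x0: "x \<ge> 0" unfolding x_def using t n by (simp add: mult_nonneg_nonneg)
    have "t = x / real (Suc n)" unfolding x_def using n by (simp del: of_nat_Suc)
    moreover have "r n t = of_int \<lfloor>x\<rfloor> / real (Suc n)" unfolding r_def x_def using t by simp
    moreover have "0 \<le> real_of_int \<lfloor>x\<rfloor>" "real_of_int \<lfloor>x\<rfloor> \<le> x" "x - real_of_int \<lfloor>x\<rfloor> \<le> 1"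
      using x0 of_int_floor_le[of x] real_of_int_floor_add_one_ge[of x] by (simp, simp, linarith)
    ultimately have "0 \<le> r n t" "r n t \<le> t" "t - r n t \<le> 1 / real (Suc n)"
      using n by (simp_all add: divide_right_mono diff_divide_distrib[symmetric] del: of_nat_Suc)
    then show ?thesis by auto
  qed
  have rs: "simple_function lebesgue (r n)" for n
  proof (rule simple_function_borel_measurable)
    have "r n \<in> borel_measurable borel"
      unfolding r_def by measurable
    then show "r n \<in> borel_measurable lebesgue"
      by (rule borel_measurable_lebesgueI)
    have "r n ` space lebesgue \<subseteq> insert (-1) ((\<lambda>i. real_of_int i / real (Suc n)) ` {0..\<lfloor>real (Suc n) * T\<rfloor>})"
    proof
      fix y assume "y \<in> r n ` space lebesgue"
      then obtain t where y: "y = r n t" by auto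
      show "y \<in> insert (-1) ((\<lambda>i. real_of_int i / real (Suc n)) ` {0..\<lfloor>real (Suc n) * T\<rfloor>})"
      proof (cases "t \<in> {0<..<T}")
        case True
        then have "0 \<le> \<lfloor>real (Suc n) * t\<rfloor>" "\<lfloor>real (Suc n) * t\<rfloor> \<le> \<lfloor>real (Suc n) * T\<rfloor>"
          by (auto intro!: floor_mono mult_left_mono)
        then show ?thesis unfolding y r_def using True by auto
      next
        case False
        then have "y = -1" unfolding y r_def by (rule if_not_P)
        then show ?thesis by simp
      qed
    qed
    then show "finite (r n ` space lebesgue)" by (rule finite_subset) simp
  qed
  have "simple_function lebesgue (\<lambda>t. g (r n t))" for n
    by (rule simple_function_compose1[OF rs])
  moreover have "(\<lambda>n. g (r n t)) \<longlonglongrightarrow> (if t \<in> {0<..<T} then f t else 0)" for t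
  proof (cases "t \<in> {0<..<T}")
    case True
    have lim: "(\<lambda>n. r n t) \<longlonglongrightarrow> t"
    proof (rule LIM_zero_cancel, rule Lim_null_comparison)
      show "eventually (\<lambda>n. norm (r n t - t) \<le> 1 / real (Suc n)) sequentially"
        using rb[OF True] by (intro always_eventually allI) (simp only: real_norm_def)
      show "(\<lambda>n. 1 / real (Suc n)) \<longlonglongrightarrow> 0"
        by (rule LIMSEQ_inverse_real_of_nat[unfolded inverse_eq_divide])
    qed
    have "(\<lambda>n. f (r n t)) \<longlonglongrightarrow> f t"
    proof (rule continuous_on_tendsto_compose[OF f lim])
      show "eventually (\<lambda>n. r n t \<in> {0..T}) sequentially"
      proof (intro always_eventually allI)
        fix n show "r n t \<in> {0..T}" using rb[OF True, of n] True by simp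
      qed
    qed (use True in auto)
    moreover have "g (r n t) = f (r n t)" for n using rb[OF True, of n] unfolding g_def by auto
    ultimately show ?thesis using True by simp
  qed (auto simp: r_def g_def)
  ultimately have sm: "strongly_measurable lebesgue (\<lambda>t. if t \<in> {0<..<T} then f t else 0)"
    unfolding strongly_measurable_def by (intro exI[of _ "\<lambda>n t. g (r n t)"] conjI allI AE_I2)
  have "bounded (f ` {0..T})"
    by (rule compact_imp_bounded[OF compact_continuous_image[OF f compact_Icc]])
  then obtain C where C: "\<And>t. t \<in> {0..T} \<Longrightarrow> norm (f t) \<le> C" unfolding bounded_iff by blast
  have "integrable lebesgue (\<lambda>t. (norm (if t \<in> {0<..<T} then f t else 0))\<^sup>2)"
  proof (rule Bochner_Integration.integrable_bound)
    show "integrable lebesgue (\<lambda>t. C\<^sup>2 * indicator {0<..<T} t)"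
      by (intro integrable_mult_right integrable_indicator_interval)
    show "(\<lambda>t. (norm (if t \<in> {0<..<T} then f t else 0))\<^sup>2) \<in> borel_measurable lebesgue"
      by (rule borel_measurable_power[OF strongly_measurable_norm[OF sm]])
    have "(norm (f t))\<^sup>2 \<le> C\<^sup>2" if "t \<in> {0<..<T}" for t
      using C[of t] that by (intro power_mono) auto
    then show "AE t in lebesgue. norm ((norm (if t \<in> {0<..<T} then f t else 0))\<^sup>2) \<le> norm (C\<^sup>2 * indicator {0<..<T} t)"
      by (intro AE_I2) simp
  qed
  with sm show ?thesis unfolding square_integrable_def by simp
qed

lemma rep_L2_cont:
  "continuous_on {0..T} f \<Longrightarrow>
    AE t in lebesgue. rep_L2fun (L2_cont T f) t = (if t \<in> {0<..<T} then f t else 0)"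
  unfolding L2_cont_def by (rule rep_abs_L2fun[OF square_integrable_continuous])

lemma L2_cont_in_L2_on:
  assumes "continuous_on {0..T} f" shows "L2_cont T f \<in> L2_on T"
  unfolding L2_on_def mem_Collect_eq using rep_L2_cont[OF assms] by eventually_elim simp

lemma L2_cont_add:
  assumes "continuous_on {0..T} f" "continuous_on {0..T} g"
  shows "L2_cont T (\<lambda>t. f t + g t) = L2_cont T f + L2_cont T g"
proof -
  have "L2_cont T f + L2_cont T g
      = abs_L2fun (\<lambda>t. (if t \<in> {0<..<T} then f t else 0) + (if t \<in> {0<..<T} then g t else 0))"
    unfolding L2_cont_def by (rule abs_L2fun_add[symmetric]) (intro square_integrable_continuous assms)+
  also have "\<dots> = L2_cont T (\<lambda>t. f t + g t)"
    unfolding L2_cont_def by (rule arg_cong[where f=abs_L2fun]) auto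
  finally show ?thesis by simp
qed

lemma L2_cont_scaleR:
  assumes "continuous_on {0..T} f"
  shows "L2_cont T (\<lambda>t. c *\<^sub>R f t) = c *\<^sub>R L2_cont T f"
proof -
  have "c *\<^sub>R L2_cont T f = abs_L2fun (\<lambda>t. c *\<^sub>R (if t \<in> {0<..<T} then f t else 0))"
    unfolding L2_cont_def by (rule abs_L2fun_scaleR[symmetric]) (intro square_integrable_continuous assms)
  also have "\<dots> = L2_cont T (\<lambda>t. c *\<^sub>R f t)"
    unfolding L2_cont_def by (rule arg_cong[where f=abs_L2fun]) auto
  finally show ?thesis by simp
qed

lemma L2_cont_diff:
  assumes "continuous_on {0..T} f" "continuous_on {0..T} g"
  shows "L2_cont T (\<lambda>t. f t - g t) = L2_cont T f - L2_cont T g"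
  using L2_cont_add[OF assms(1) continuous_on_minus[OF assms(2)]] L2_cont_scaleR[OF assms(2), of "-1"] by simp

lemma norm_L2_cont_square:
  assumes "continuous_on {0..T} f"
  shows "(norm (L2_cont T f))\<^sup>2 = (LINT t:{0<..<T}|lebesgue. (norm (f t))\<^sup>2)"
  unfolding L2_cont_def norm_abs_L2fun[OF square_integrable_continuous[OF assms]] set_lebesgue_integral_def
  by (rule Bochner_Integration.integral_cong) (auto simp: indicator_def)

lemma inner_L2_cont:
  assumes "continuous_on {0..T} f"
  shows "w \<bullet> L2_cont T f = (LINT t:{0<..<T}|lebesgue. rep_L2fun w t \<bullet> f t)"
  unfolding L2_cont_def inner_abs_L2fun[OF square_integrable_continuous[OF assms]] set_lebesgue_integral_def
  by (rule Bochner_Integration.integral_cong) (auto simp: indicator_def)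

lemma inner_L2_cont_L2_cont:
  assumes f: "continuous_on {0..T} f" and g: "continuous_on {0..T} g"
  shows "L2_cont T f \<bullet> L2_cont T g = (LINT t:{0<..<T}|lebesgue. f t \<bullet> g t)"
proof -
  have "L2_cont T f \<bullet> L2_cont T g
      = (LINT t|lebesgue. (if t \<in> {0<..<T} then f t \<bullet> g t else 0))"
    unfolding inner_L2fun_def
  proof (rule integral_cong_AE)
    show "AE t in lebesgue. rep_L2fun (L2_cont T f) t \<bullet> rep_L2fun (L2_cont T g) t
        = (if t \<in> {0<..<T} then f t \<bullet> g t else 0)"
      using rep_L2_cont[OF f] rep_L2_cont[OF g] by eventually_elim simp
    have "(\<lambda>t. (if t \<in> {0<..<T} then f t else 0) \<bullet> (if t \<in> {0<..<T} then g t else 0))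
        = (\<lambda>t. if t \<in> {0<..<T} then f t \<bullet> g t else 0)" by auto
    then show "(\<lambda>t. if t \<in> {0<..<T} then f t \<bullet> g t else 0) \<in> borel_measurable lebesgue"
      using borel_measurable_integrable[OF integrable_inner_square_integrable[OF
          square_integrable_continuous[OF f] square_integrable_continuous[OF g]]] by simp
  qed (intro borel_measurable_integrable integrable_inner_square_integrable square_integrable_rep)
  also have "\<dots> = (LINT t:{0<..<T}|lebesgue. f t \<bullet> g t)"
    unfolding set_lebesgue_integral_def
    by (rule Bochner_Integration.integral_cong) (auto simp: indicator_def)
  finally show ?thesis .
qed

lemma set_integrable_rep_inner: "set_integrable lebesgue {0<..<T} (\<lambda>t. rep_L2fun w t \<bullet> v)"
proof -
  have "integrable lebesgue (\<lambda>t. rep_L2fun w t \<bullet> (if t \<in> {0<..<T} then v else 0))"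
    by (intro integrable_inner_square_integrable square_integrable_rep square_integrable_continuous
        continuous_on_const)
  moreover have "rep_L2fun w t \<bullet> (if t \<in> {0<..<T} then v else 0)
      = indicator {0<..<T} t *\<^sub>R (rep_L2fun w t \<bullet> v)" for t by simp
  ultimately show ?thesis unfolding set_integrable_def by simp
qed

text \<open>The exceptional null set of \<open>w \<bullet> v = 0\<close> depends on \<open>v\<close>. Only countably many \<open>v\<close> occur as
  values of simple functions \<open>s\<^sub>n \<rightarrow> w\<close>, so almost everywhere \<open>w \<bullet> s\<^sub>n = 0\<close> for all \<open>n\<close>, and in the limit
  \<open>w \<bullet> w = 0\<close>.\<close>

lemma L2_on_zero_if_weakly_zero:
  fixes w :: "'a::real_inner L2fun"
  assumes weak: "\<And>v. AE t in lebesgue. indicator {0<..<T} t * (rep_L2fun w t \<bullet> v) = 0"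
    and w: "w \<in> L2_on T"
  shows "w = 0"
proof -
  have "strongly_measurable lebesgue (rep_L2fun w)"
    using square_integrable_rep[of w] unfolding square_integrable_def by simp
  then obtain s where s: "\<And>n. simple_function lebesgue (s n)"
    and lim: "AE x in lebesgue. (\<lambda>n::nat. s n x) \<longlonglongrightarrow> rep_L2fun w x"
    unfolding strongly_measurable_def by blast
  have "AE t in lebesgue. \<forall>v\<in>range (s n). indicator {0<..<T} t * (rep_L2fun w t \<bullet> v) = 0" for n
    by (rule AE_finite_allI) (use simple_functionD(1)[OF s[of n]] in simp, rule weak)
  then have "AE t in lebesgue. \<forall>n. \<forall>v\<in>range (s n). indicator {0<..<T} t * (rep_L2fun w t \<bullet> v) = 0"
    unfolding AE_all_countable by simp
  with lim L2_on_AE[OF w] have "AE t in lebesgue. rep_L2fun w t = 0"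
  proof eventually_elim
    case (elim t)
    show ?case
    proof (cases "t \<in> {0<..<T}")
      case True
      have "(\<lambda>n. rep_L2fun w t \<bullet> s n t) \<longlonglongrightarrow> rep_L2fun w t \<bullet> rep_L2fun w t"
        by (intro tendsto_intros elim(1))
      moreover have "rep_L2fun w t \<bullet> s n t = 0" for n using elim(3) True by auto
      ultimately show ?thesis by (simp add: LIMSEQ_const_iff)
    qed (use elim(2) in simp)
  qed
  then have "AE t in lebesgue. rep_L2fun w t = rep_L2fun 0 t"
    using rep_L2fun_zero by eventually_elim simp
  then show ?thesis by (rule L2fun_eqI)
qed

lemma L2_on_zero_if_moments_zero:
  fixes w :: "'a::real_inner L2fun" and e :: "nat \<Rightarrow> real \<Rightarrow> real"
  assumes w: "w \<in> L2_on T" and e: "\<And>k. continuous_on {0..T} (e k)"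
    and total: "\<And>h. integrable lebesgue h \<Longrightarrow> (\<And>t. t \<notin> {0<..<T} \<Longrightarrow> h t = 0) \<Longrightarrow>
      (\<And>k. (LINT t|lebesgue. h t * e k t) = 0) \<Longrightarrow> AE t in lebesgue. h t = 0"
    and orth: "\<And>k v. w \<bullet> L2_cont T (\<lambda>t. e k t *\<^sub>R v) = 0"
  shows "w = 0"
proof (rule L2_on_zero_if_weakly_zero[OF _ w])
  fix v
  show "AE t in lebesgue. indicator {0<..<T} t * (rep_L2fun w t \<bullet> v) = 0"
  proof (rule total)
    show "integrable lebesgue (\<lambda>t. indicator {0<..<T} t * (rep_L2fun w t \<bullet> v))"
      using set_integrable_rep_inner[of T w v] unfolding set_integrable_def by simp
    fix k
    have "w \<bullet> L2_cont T (\<lambda>t. e k t *\<^sub>R v)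
        = (LINT t:{0<..<T}|lebesgue. rep_L2fun w t \<bullet> (e k t *\<^sub>R v))"
      by (intro inner_L2_cont continuous_intros e)
    then show "(LINT t|lebesgue. indicator {0<..<T} t * (rep_L2fun w t \<bullet> v) * e k t) = 0"
      using orth[of k v] unfolding set_lebesgue_integral_def by (simp add: algebra_simps)
  qed simp
qed

lemma L2_cos_total:
  fixes w :: "'a::real_inner L2fun"
  assumes "T > 0" "w \<in> L2_on T"
    and "\<And>k::nat. \<And>v. w \<bullet> L2_cont T (\<lambda>t. cos (real k * pi / T * t) *\<^sub>R v) = 0"
  shows "w = 0"
  by (rule L2_on_zero_if_moments_zero[OF assms(2) _ cos_total[OF assms(1)] assms(3)])
    (use assms(1) in \<open>auto intro!: continuous_intros\<close>)

lemma L2_sin_total: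
  fixes w :: "'a::real_inner L2fun"
  assumes "T > 0" "w \<in> L2_on T"
    and "\<And>k::nat. \<And>v. w \<bullet> L2_cont T (\<lambda>t. sin (real k * pi / T * t) *\<^sub>R v) = 0"
  shows "w = 0"
  by (rule L2_on_zero_if_moments_zero[OF assms(2) _ sin_total[OF assms(1)] assms(3)])
    (use assms(1) in \<open>auto intro!: continuous_intros\<close>)

section \<open>The graph of the time derivative\<close>

lemma set_integrable_continuous_interval:
  fixes f :: "real \<Rightarrow> real"
  assumes "continuous_on {0..T} f"
  shows "set_integrable lebesgue {0<..<T} f"
  by (rule set_integrable_subset[OF absolutely_integrable_continuous_real[OF assms]])
    (auto simp: interval_lebesgue_sets)

lemma norm_L2_cont_integral:
  assumes f: "continuous_on {0..T} f"
  shows "(norm (L2_cont T f))\<^sup>2 = integral {0..T} (\<lambda>t. (norm (f t))\<^sup>2)"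
proof -
  have c: "continuous_on {0..T} (\<lambda>t. (norm (f t))\<^sup>2)" by (intro continuous_intros f)
  have "(norm (L2_cont T f))\<^sup>2 = integral {0<..<T} (\<lambda>t. (norm (f t))\<^sup>2)"
    unfolding norm_L2_cont_square[OF f]
    by (rule set_lebesgue_integral_eq_integral(2)[OF set_integrable_continuous_interval[OF c]])
  also have "((\<lambda>t. (norm (f t))\<^sup>2) has_integral integral {0..T} (\<lambda>t. (norm (f t))\<^sup>2)) {0..T}"
    by (intro integrable_integral integrable_continuous_real c)
  then have "integral {0<..<T} (\<lambda>t. (norm (f t))\<^sup>2) = integral {0..T} (\<lambda>t. (norm (f t))\<^sup>2)"
    unfolding has_integral_Icc_iff_Ioo by (rule integral_unique)
  finally show ?thesis .
qed

lemma norm_L2_cont_le: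
  assumes T: "T > 0" and f: "continuous_on {0..T} f" and le: "\<And>t. t \<in> {0..T} \<Longrightarrow> norm (f t) \<le> C"
  shows "norm (L2_cont T f) \<le> sqrt T * C"
proof (rule power2_le_imp_le)
  have C: "C \<ge> 0" using order_trans[OF norm_ge_zero le[of 0]] T by simp
  then show "0 \<le> sqrt T * C" using T by simp
  have "(norm (L2_cont T f))\<^sup>2 \<le> integral {0..T} (\<lambda>t. C\<^sup>2)"
    unfolding norm_L2_cont_integral[OF f]
    by (intro integral_le integrable_continuous_real continuous_intros f power_mono le norm_ge_zero)
  also have "\<dots> = (sqrt T * C)\<^sup>2" using T by (simp add: power_mult_distrib)
  finally show "(norm (L2_cont T f))\<^sup>2 \<le> (sqrt T * C)\<^sup>2" .
qed

definition riesz :: "('v::{real_inner,complete_space} \<Rightarrow>\<^sub>L real) \<Rightarrow> 'v" where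
  "riesz F = (SOME r. \<forall>v. F v = r \<bullet> v)"

lemma inner_riesz: "riesz F \<bullet> v = blinfun_apply F v"
proof -
  have "\<exists>r\<in>UNIV. \<forall>v\<in>UNIV. blinfun_apply F v = r \<bullet> v"
    by (rule Riesz_representation_subspace[where C="norm F"])
      (use norm_blinfun[of F] in \<open>auto simp: complete_UNIV blinfun.add_right blinfun.scaleR_right\<close>)
  then have "\<exists>r. \<forall>v. blinfun_apply F v = r \<bullet> v" by simp
  then have "\<forall>v. blinfun_apply F v = riesz F \<bullet> v" unfolding riesz_def by (rule someI_ex)
  from this[rule_format, of v] show ?thesis by (rule sym)
qed

lemma riesz_unique:
  assumes "\<And>v. blinfun_apply F v = r \<bullet> v"
  shows "riesz F = r"
proof -
  have "\<forall>v. riesz F \<bullet> v = r \<bullet> v" by (simp add: inner_riesz assms)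
  then show ?thesis by (simp only: vector_eq_rdot)
qed

lemma bounded_linear_riesz: "bounded_linear riesz"
proof (rule bounded_linear_intro[where K=1])
  fix F :: "'v::{real_inner,complete_space} \<Rightarrow>\<^sub>L real"
  have "norm (riesz F) * norm (riesz F) = blinfun_apply F (riesz F)"
    by (simp add: inner_riesz[symmetric] power2_norm_eq_inner[symmetric] power2_eq_square)
  also have "\<dots> \<le> norm F * norm (riesz F)" using norm_blinfun[of F "riesz F"] by simp
  finally show "norm (riesz F) \<le> norm F * 1"
    by (cases "riesz F = 0") (auto simp: mult_le_cancel_right)
qed (auto intro!: riesz_unique simp: inner_riesz inner_add_left blinfun.add_left blinfun.scaleR_left)

definition Riesz :: "('v::{real_inner,complete_space} \<Rightarrow>\<^sub>L real) \<Rightarrow>\<^sub>L 'v" where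
  "Riesz = Blinfun riesz"

definition Riesz_inv :: "'v::{real_inner,complete_space} \<Rightarrow>\<^sub>L ('v \<Rightarrow>\<^sub>L real)" where
  "Riesz_inv = Blinfun blinfun_inner_right"

lemma Riesz_apply: "blinfun_apply Riesz F = riesz F"
  unfolding Riesz_def by (simp add: bounded_linear_Blinfun_apply bounded_linear_riesz)

lemma Riesz_inv_apply: "blinfun_apply Riesz_inv v = blinfun_inner_right v"
  unfolding Riesz_inv_def by (simp add: bounded_linear_Blinfun_apply bounded_linear_blinfun_inner_right)

lemma riesz_inner_right: "riesz (blinfun_inner_right v) = v"
  by (rule riesz_unique) simp

lemma blinfun_inner_right_riesz: "blinfun_inner_right (riesz F) = F"
  by (rule blinfun_eqI) (simp add: inner_riesz)

text \<open>The operator \<open>j\<^sup>* j\<close>, through which the pivot space inner product is expressed on \<open>V\<close>.\<close>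

definition pivot :: "('v::{real_inner,complete_space} \<Rightarrow>\<^sub>L 'h::{real_inner,complete_space}) \<Rightarrow> 'v \<Rightarrow> 'v" where
  "pivot j v = riesz (embed_dual j (j v))"

lemma embed_dual_apply: "blinfun_apply (embed_dual j h) v = h \<bullet> j v"
  unfolding embed_dual_def by simp

lemma inner_pivot: "a \<bullet> pivot j v = j a \<bullet> j v"
proof -
  have "pivot j v \<bullet> a = j v \<bullet> j a" unfolding pivot_def by (simp add: inner_riesz embed_dual_apply)
  then show ?thesis by (simp only: inner_commute)
qed

lemma pivot_selfadjoint: "a \<bullet> pivot j b = pivot j a \<bullet> b"
  by (metis inner_commute inner_pivot)

lemma bounded_linear_pivot: "bounded_linear (pivot j)"
proof (rule bounded_linear_intro[where K="(norm j)\<^sup>2"])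
  fix x y :: 'a and c
  have "\<forall>a. a \<bullet> pivot j (x + y) = a \<bullet> (pivot j x + pivot j y)"
    by (simp add: inner_pivot inner_add_right blinfun.add_right)
  then show "pivot j (x + y) = pivot j x + pivot j y" by (simp only: vector_eq_ldot)
  have "\<forall>a. a \<bullet> pivot j (c *\<^sub>R x) = a \<bullet> (c *\<^sub>R pivot j x)"
    by (simp add: inner_pivot blinfun.scaleR_right)
  then show "pivot j (c *\<^sub>R x) = c *\<^sub>R pivot j x" by (simp only: vector_eq_ldot)
  have "norm (pivot j x) * norm (pivot j x) = j (pivot j x) \<bullet> j x"
    by (simp add: inner_pivot[symmetric] power2_norm_eq_inner[symmetric] power2_eq_square)
  also have "\<dots> \<le> norm (j (pivot j x)) * norm (j x)" by (rule norm_cauchy_schwarz)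
  also have "\<dots> \<le> (norm j * norm (pivot j x)) * (norm j * norm x)"
    by (intro mult_mono norm_blinfun) auto
  finally have "norm (pivot j x) * norm (pivot j x) \<le> (norm x * (norm j)\<^sup>2) * norm (pivot j x)"
    by (simp add: power2_eq_square algebra_simps)
  then show "norm (pivot j x) \<le> norm x * (norm j)\<^sup>2"
    by (cases "pivot j x = 0") (auto simp: mult_le_cancel_right)
qed

lemma continuous_on_pivot [continuous_intros]:
  "continuous_on S f \<Longrightarrow> continuous_on S (\<lambda>t. pivot j (f t))"
  by (rule bounded_linear.continuous_on[OF bounded_linear_pivot])

lemma test_function_facts:
  assumes "\<phi> \<in> test_functions T"
  shows "continuous_on S \<phi>" "continuous_on S (deriv \<phi>)"
    and "(\<phi> has_real_derivative deriv \<phi> t) (at t)" and "\<phi> 0 = 0" "\<phi> T = 0"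
proof -
  have d: "(deriv ^^ k) \<phi> differentiable at x" for k x
    using assms unfolding test_functions_def by blast
  have c: "continuous_on S ((deriv ^^ k) \<phi>)" for k
    by (intro continuous_at_imp_continuous_on ballI differentiable_imp_continuous_within d)
  show "continuous_on S \<phi>" using c[of 0] by simp
  show "continuous_on S (deriv \<phi>)" using c[of 1] by simp
  show "(\<phi> has_real_derivative deriv \<phi> t) (at t)"
    using d[of 0 t] by (simp add: DERIV_deriv_iff_real_differentiable)
  obtain a b where ab: "0 < a" "b < T" "\<And>x. x \<notin> {a..b} \<Longrightarrow> \<phi> x = 0"
    using assms unfolding test_functions_def by blast
  show "\<phi> 0 = 0" using ab(1) ab(3)[of 0] by auto
  show "\<phi> T = 0" using ab(2) ab(3)[of T] by auto
qed

text \<open>The graph of \<open>d/dt\<close> with the derivative replaced by its Riesz representative in \<open>L\<^sub>2(V)\<close>;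
  it is cut out by continuous linear equations.\<close>

definition deriv_graph :: "('v::{real_inner,complete_space} \<Rightarrow>\<^sub>L 'h::{real_inner,complete_space}) \<Rightarrow> real \<Rightarrow>
    ('v L2fun \<times> 'v L2fun) set" where
  "deriv_graph j T = {(w, y). w \<in> L2_on T \<and> y \<in> L2_on T \<and> (\<forall>\<phi>\<in>test_functions T. \<forall>v.
     w \<bullet> L2_cont T (\<lambda>t. deriv \<phi> t *\<^sub>R pivot j v) + y \<bullet> L2_cont T (\<lambda>t. \<phi> t *\<^sub>R v) = 0)}"

lemma deriv_graph_eq_Int:
  "deriv_graph j T = (L2_on T \<times> L2_on T) \<inter> (\<Inter>\<phi>\<in>test_functions T. \<Inter>v.
     {p. (L2_cont T (\<lambda>t. deriv \<phi> t *\<^sub>R pivot j v), L2_cont T (\<lambda>t. \<phi> t *\<^sub>R v)) \<bullet> p = 0})"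
  unfolding deriv_graph_def by (auto simp: inner_commute)

lemma subspace_deriv_graph: "subspace (deriv_graph j T)"
  unfolding deriv_graph_eq_Int
  by (intro subspace_inter subspace_Times subspace_L2_on subspace_Inter)
    (auto intro!: subspace_Inter subspace_hyperplane)

lemma complete_deriv_graph: "complete (deriv_graph j T)"
proof -
  have "closed (deriv_graph j T)"
    unfolding deriv_graph_eq_Int
    by (intro closed_Int closed_Times closed_L2_on closed_INT ballI closed_hyperplane)
  then show ?thesis by (simp add: complete_eq_closed)
qed

lemma inner_L2map_Riesz:
  assumes f: "square_integrable f"
  shows "L2map Riesz g \<bullet> abs_L2fun f = (LINT t|lebesgue. rep_L2fun g t (f t))"
proof -
  have "L2map Riesz g \<bullet> abs_L2fun f = (LINT t|lebesgue. rep_L2fun (L2map Riesz g) t \<bullet> f t)"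
    by (rule inner_abs_L2fun[OF f])
  also have "\<dots> = (LINT t|lebesgue. Riesz (rep_L2fun g t) \<bullet> f t)"
  proof (rule integral_cong_AE)
    show "AE t in lebesgue. rep_L2fun (L2map Riesz g) t \<bullet> f t = Riesz (rep_L2fun g t) \<bullet> f t"
      using rep_L2map[of Riesz g] by eventually_elim simp
  qed (intro borel_measurable_integrable integrable_inner_square_integrable f square_integrable_rep
      square_integrable_L2map)+
  finally show ?thesis by (simp add: Riesz_apply inner_riesz)
qed

lemma inner_L2map_Riesz_cont:
  assumes f: "continuous_on {0..T} f"
  shows "L2map Riesz g \<bullet> L2_cont T f = (LINT t:{0<..<T}|lebesgue. rep_L2fun g t (f t))"
  unfolding L2_cont_def inner_L2map_Riesz[OF square_integrable_continuous[OF f]] set_lebesgue_integral_def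
  by (rule Bochner_Integration.integral_cong) (auto simp: indicator_def blinfun.zero_right)

lemma L2map_L2map: "L2map F (L2map G w) = abs_L2fun (\<lambda>t. F (G (rep_L2fun w t)))"
  unfolding L2map_def[of G] by (rule L2map_abs[OF square_integrable_L2map])

lemma L2map_Riesz_inverse:
  "L2map Riesz (L2map Riesz_inv y) = y" "L2map Riesz_inv (L2map Riesz g) = g"
  by (simp_all add: L2map_L2map Riesz_apply Riesz_inv_apply
      riesz_inner_right blinfun_inner_right_riesz abs_rep_L2fun)

text \<open>\<open>j\<^sup>* j\<close> and the Riesz map translate the duality pairings of the weak formulation into inner
  products of \<open>L\<^sub>2(V)\<close>.\<close>

lemma is_time_deriv_iff_graph:
  assumes w: "w \<in> L2_on T" and g: "g \<in> L2_on T"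
  shows "is_time_deriv j T w g \<longleftrightarrow> (w, L2map Riesz g) \<in> deriv_graph j T"
proof -
  have 1: "w \<bullet> L2_cont T (\<lambda>t. deriv \<phi> t *\<^sub>R pivot j v)
      = (LINT t:{0<..<T}|lebesgue. deriv \<phi> t * embed_dual j (j (rep_L2fun w t)) v)"
    if "\<phi> \<in> test_functions T" for \<phi> v
    using test_function_facts(2)[OF that, of "{0..T}"]
    by (subst inner_L2_cont) (auto intro!: continuous_intros simp: inner_pivot embed_dual_apply)
  have 2: "L2map Riesz g \<bullet> L2_cont T (\<lambda>t. \<phi> t *\<^sub>R v)
      = (LINT t:{0<..<T}|lebesgue. \<phi> t * rep_L2fun g t v)"
    if "\<phi> \<in> test_functions T" for \<phi> v
    using test_function_facts(1)[OF that, of "{0..T}"]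
    by (subst inner_L2map_Riesz_cont) (auto intro!: continuous_intros simp: blinfun.scaleR_right)
  show ?thesis
    unfolding is_time_deriv_def has_weak_derivative_def deriv_graph_def
    using w g L2map_L2_on[OF g, of Riesz] by (simp add: 1 2 eq_neg_iff_add_eq_0)
qed

lemma deriv_graph_sin:
  assumes wy: "(w, y) \<in> deriv_graph j T" and \<kappa>: "\<kappa> \<ge> 0" "sin (\<kappa> * T) = 0"
  shows "\<kappa> * (w \<bullet> L2_cont T (\<lambda>t. cos (\<kappa> * t) *\<^sub>R pivot j v)) = - (y \<bullet> L2_cont T (\<lambda>t. sin (\<kappa> * t) *\<^sub>R v))"
proof -
  have "(LINT t:{0<..<T}|lebesgue. \<kappa> * cos (\<kappa> * t) * (rep_L2fun w t \<bullet> pivot j v))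
      = - (LINT t:{0<..<T}|lebesgue. sin (\<kappa> * t) * (rep_L2fun y t \<bullet> v))"
  proof (rule weak_derivative_sin[OF set_integrable_rep_inner set_integrable_rep_inner _ \<kappa>])
    fix \<phi> assume \<phi>: "\<phi> \<in> test_functions T"
    have 1: "w \<bullet> L2_cont T (\<lambda>t. deriv \<phi> t *\<^sub>R pivot j v)
        = (LINT t:{0<..<T}|lebesgue. deriv \<phi> t * (rep_L2fun w t \<bullet> pivot j v))"
      using test_function_facts(2)[OF \<phi>, of "{0..T}"]
      by (subst inner_L2_cont) (auto intro!: continuous_intros)
    have 2: "y \<bullet> L2_cont T (\<lambda>t. \<phi> t *\<^sub>R v) = (LINT t:{0<..<T}|lebesgue. \<phi> t * (rep_L2fun y t \<bullet> v))"
      using test_function_facts(1)[OF \<phi>, of "{0..T}"]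
      by (subst inner_L2_cont) (auto intro!: continuous_intros)
    have "w \<bullet> L2_cont T (\<lambda>t. deriv \<phi> t *\<^sub>R pivot j v) + y \<bullet> L2_cont T (\<lambda>t. \<phi> t *\<^sub>R v) = 0"
      using wy \<phi> unfolding deriv_graph_def by simp
    then show "(LINT t:{0<..<T}|lebesgue. deriv \<phi> t * (rep_L2fun w t \<bullet> pivot j v))
        = - (LINT t:{0<..<T}|lebesgue. \<phi> t * (rep_L2fun y t \<bullet> v))"
      unfolding 1 2 by simp
  qed
  moreover have "w \<bullet> L2_cont T (\<lambda>t. \<kappa> *\<^sub>R (cos (\<kappa> * t) *\<^sub>R pivot j v))
      = (LINT t:{0<..<T}|lebesgue. \<kappa> * cos (\<kappa> * t) * (rep_L2fun w t \<bullet> pivot j v))"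
    by (subst inner_L2_cont) (auto intro!: continuous_intros simp: mult.assoc)
  moreover have "L2_cont T (\<lambda>t. \<kappa> *\<^sub>R (cos (\<kappa> * t) *\<^sub>R pivot j v)) = \<kappa> *\<^sub>R L2_cont T (\<lambda>t. cos (\<kappa> * t) *\<^sub>R pivot j v)"
    by (intro L2_cont_scaleR continuous_intros)
  moreover have "y \<bullet> L2_cont T (\<lambda>t. sin (\<kappa> * t) *\<^sub>R v) = (LINT t:{0<..<T}|lebesgue. sin (\<kappa> * t) * (rep_L2fun y t \<bullet> v))"
    by (subst inner_L2_cont) (auto intro!: continuous_intros)
  ultimately show ?thesis by simp
qed

lemma sin_wave_number: "T > 0 \<Longrightarrow> sin (real k * pi / T * T) = 0" for k :: nat
  by simp

text \<open>The sine coefficients of a weak derivative are determined by the cosine coefficients of the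
  function.\<close>

lemma deriv_graph_single_valued:
  assumes T: "T > 0" and "(w, y) \<in> deriv_graph j T" "(w, z) \<in> deriv_graph j T"
  shows "y = z"
proof -
  have d: "(0, y - z) \<in> deriv_graph j T"
    using subspace_diff[OF subspace_deriv_graph assms(2,3)] by simp
  then have "y - z \<in> L2_on T" unfolding deriv_graph_def by simp
  then have "y - z = 0"
  proof (rule L2_sin_total[OF T])
    fix k :: nat and v
    show "(y - z) \<bullet> L2_cont T (\<lambda>t. sin (real k * pi / T * t) *\<^sub>R v) = 0"
      using deriv_graph_sin[OF d _ sin_wave_number[OF T], of k v] T by simp
  qed
  then show ?thesis by simp
qed

text \<open>The time derivative as an element of \<open>L\<^sub>2(V)\<close>, by the Riesz isomorphism of \<open>V\<close>.\<close>

definition tderiv :: "('v::{real_inner,complete_space} \<Rightarrow>\<^sub>L 'h::{real_inner,complete_space}) \<Rightarrow> real \<Rightarrow>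
    'v L2fun \<Rightarrow> 'v L2fun" where
  "tderiv j T w = L2map Riesz (time_deriv j T w)"

lemma X_space_tderiv:
  assumes T: "T > 0" and w: "w \<in> X_space j T"
  shows "(w, tderiv j T w) \<in> deriv_graph j T"
proof -
  have wL: "w \<in> L2_on T" using w unfolding X_space_def by simp
  have g: "g \<in> L2_on T" if "is_time_deriv j T w g" for g
    using that unfolding is_time_deriv_def by simp
  obtain g where gd: "is_time_deriv j T w g" using w unfolding X_space_def by auto
  have "g' = g" if "is_time_deriv j T w g'" for g'
  proof -
    have "L2map Riesz g' = L2map Riesz g"
      using deriv_graph_single_valued[OF T] that gd is_time_deriv_iff_graph[OF wL] g by blast
    then show ?thesis by (metis L2map_Riesz_inverse(2))
  qed
  then have "time_deriv j T w = g" unfolding time_deriv_def using gd by (rule the_equality[rotated])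
  then show ?thesis unfolding tderiv_def using gd is_time_deriv_iff_graph[OF wL g[OF gd], of j] by simp
qed

lemma deriv_graph_X_space:
  assumes T: "T > 0" and wy: "(w, y) \<in> deriv_graph j T"
  shows "w \<in> X_space j T" "tderiv j T w = y"
proof -
  have wL: "w \<in> L2_on T" "y \<in> L2_on T" using wy unfolding deriv_graph_def by auto
  have "is_time_deriv j T w (L2map Riesz_inv y)"
    using wy is_time_deriv_iff_graph[OF wL(1) L2map_L2_on[OF wL(2), of Riesz_inv], of j]
    by (simp add: L2map_Riesz_inverse)
  then show X: "w \<in> X_space j T" unfolding X_space_def using wL(1) by auto
  show "tderiv j T w = y"
    by (rule deriv_graph_single_valued[OF T X_space_tderiv[OF T X] wy])
qed

lemma dt_eq_inner:
  assumes v: "v \<in> L2_on T"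
  shows "dt j T w v = tderiv j T w \<bullet> v"
proof -
  have sq: "square_integrable (\<lambda>t. if t \<in> {0<..<T} then rep_L2fun v t else 0)"
    by (rule square_integrable_restrict[OF square_integrable_rep interval_lebesgue_sets(1)])
  have "AE t in lebesgue. (if t \<in> {0<..<T} then rep_L2fun v t else 0) = rep_L2fun v t"
    using L2_on_AE[OF v] by eventually_elim auto
  then have "abs_L2fun (\<lambda>t. if t \<in> {0<..<T} then rep_L2fun v t else 0) = v"
    by (rule abs_L2fun_eqI[OF sq])
  then have "tderiv j T w \<bullet> v
      = (LINT t|lebesgue. rep_L2fun (time_deriv j T w) t (if t \<in> {0<..<T} then rep_L2fun v t else 0))"
    using inner_L2map_Riesz[OF sq, of "time_deriv j T w"] unfolding tderiv_def by simp
  also have "\<dots> = dt j T w v"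
    unfolding dt_def set_lebesgue_integral_def using v
    by (auto intro!: Bochner_Integration.integral_cong simp: indicator_def blinfun.zero_right)
  finally show ?thesis by simp
qed

section \<open>Continuously differentiable functions are dense in the graph\<close>

lemma integral_derivative_interval:
  fixes F F' :: "real \<Rightarrow> real"
  assumes T: "T > 0" and d: "\<And>t. (F has_real_derivative F' t) (at t)" and c: "continuous_on {0..T} F'"
  shows "(LINT t:{0<..<T}|lebesgue. F' t) = F T - F 0"
proof -
  have "(F' has_integral (F T - F 0)) {0..T}"
    using T d by (intro fundamental_theorem_of_calculus)
      (auto simp: has_real_derivative_iff_has_vector_derivative intro: has_vector_derivative_at_within)
  then have "(F' has_integral (F T - F 0)) {0<..<T}" by (simp add: has_integral_Icc_iff_Ioo)
  then have "integral {0<..<T} F' = F T - F 0" by (rule integral_unique)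
  then show ?thesis
    using set_lebesgue_integral_eq_integral(2)[OF set_integrable_continuous_interval[OF c]] by simp
qed

text \<open>The part of the graph over the continuously differentiable \<open>V\<close>-valued functions, whose
  derivative \<open>f'\<close> acts on \<open>V\<close> through the pivot space.\<close>

definition C1_graph :: "('v::{real_inner,complete_space} \<Rightarrow>\<^sub>L 'h::{real_inner,complete_space}) \<Rightarrow> real \<Rightarrow>
    ('v L2fun \<times> 'v L2fun) set" where
  "C1_graph j T = {(L2_cont T f, L2_cont T (\<lambda>t. pivot j (f' t))) | f f'.
     (\<forall>t. (f has_vector_derivative f' t) (at t)) \<and> continuous_on UNIV f'}"

lemma has_vector_derivative_imp_continuous_on:
  assumes "\<And>t. (f has_vector_derivative f' t) (at t)"
  shows "continuous_on S f"
  by (intro continuous_at_imp_continuous_on ballI has_vector_derivative_continuous[OF assms])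

lemma subspace_C1_graph: "subspace (C1_graph j T)"
  unfolding subspace_def
proof (intro conjI ballI allI)
  have "L2_cont T (\<lambda>t. 0::'a) = 0"
    using L2_cont_scaleR[OF continuous_on_const[of _ "0::'a"], of T 0] by simp
  moreover have "pivot j 0 = 0" using linear_0[OF bounded_linear.linear[OF bounded_linear_pivot]] .
  ultimately show "0 \<in> C1_graph j T"
    unfolding C1_graph_def zero_prod_def
    by (intro CollectI exI[of _ "\<lambda>t. 0"]) (auto intro!: derivative_eq_intros)
next
  fix p q assume "p \<in> C1_graph j T" "q \<in> C1_graph j T"
  then obtain f f' g g' where f: "\<And>t. (f has_vector_derivative f' t) (at t)" "continuous_on UNIV f'"
    and g: "\<And>t. (g has_vector_derivative g' t) (at t)" "continuous_on UNIV g'"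
    and pq: "p = (L2_cont T f, L2_cont T (\<lambda>t. pivot j (f' t)))" "q = (L2_cont T g, L2_cont T (\<lambda>t. pivot j (g' t)))"
    unfolding C1_graph_def by auto
  note c = has_vector_derivative_imp_continuous_on[OF f(1)] has_vector_derivative_imp_continuous_on[OF g(1)]
    continuous_on_subset[OF f(2) subset_UNIV] continuous_on_subset[OF g(2) subset_UNIV]
  have "p + q = (L2_cont T (\<lambda>t. f t + g t), L2_cont T (\<lambda>t. pivot j (f' t + g' t)))"
    unfolding pq by (simp add: L2_cont_add c continuous_on_pivot linear_add[OF bounded_linear.linear[OF bounded_linear_pivot]])
  then show "p + q \<in> C1_graph j T"
    unfolding C1_graph_def using f g
    by (intro CollectI exI[of _ "\<lambda>t. f t + g t"] exI[of _ "\<lambda>t. f' t + g' t"])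
      (auto intro!: has_vector_derivative_add continuous_intros)
next
  fix k :: real and p assume "p \<in> C1_graph j T"
  then obtain f f' where f: "\<And>t. (f has_vector_derivative f' t) (at t)" "continuous_on UNIV f'"
    and p: "p = (L2_cont T f, L2_cont T (\<lambda>t. pivot j (f' t)))"
    unfolding C1_graph_def by auto
  note c = has_vector_derivative_imp_continuous_on[OF f(1)] continuous_on_subset[OF f(2) subset_UNIV]
  have "k *\<^sub>R p = (L2_cont T (\<lambda>t. k *\<^sub>R f t), L2_cont T (\<lambda>t. pivot j (k *\<^sub>R f' t)))"
    unfolding p by (simp add: L2_cont_scaleR c continuous_on_pivot linear_scale[OF bounded_linear.linear[OF bounded_linear_pivot]])
  then show "k *\<^sub>R p \<in> C1_graph j T"
    unfolding C1_graph_def using f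
    by (intro CollectI exI[of _ "\<lambda>t. k *\<^sub>R f t"] exI[of _ "\<lambda>t. k *\<^sub>R f' t"])
      (auto intro!: derivative_eq_intros continuous_intros)
qed

lemma C1_graph_subset:
  assumes T: "T > 0"
  shows "C1_graph j T \<subseteq> deriv_graph j T"
proof
  fix p assume "p \<in> C1_graph j T"
  then obtain f f' where f: "\<And>t. (f has_vector_derivative f' t) (at t)" "continuous_on UNIV f'"
    and p: "p = (L2_cont T f, L2_cont T (\<lambda>t. pivot j (f' t)))"
    unfolding C1_graph_def by auto
  have cf: "continuous_on S f" for S by (rule has_vector_derivative_imp_continuous_on[OF f(1)])
  have cf': "continuous_on S f'" for S by (rule continuous_on_subset[OF f(2) subset_UNIV])
  have "L2_cont T f \<bullet> L2_cont T (\<lambda>t. deriv \<phi> t *\<^sub>R pivot j v)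
      + L2_cont T (\<lambda>t. pivot j (f' t)) \<bullet> L2_cont T (\<lambda>t. \<phi> t *\<^sub>R v) = 0"
    if \<phi>: "\<phi> \<in> test_functions T" for \<phi> v
  proof -
    note c\<phi> = test_function_facts(1,2)[OF \<phi>]
    define F where "F t = \<phi> t * (f t \<bullet> pivot j v)" for t
    have dF: "(F has_real_derivative (\<phi> t * (f' t \<bullet> pivot j v) + deriv \<phi> t * (f t \<bullet> pivot j v))) (at t)" for t
    proof -
      have "((\<lambda>t. f t \<bullet> pivot j v) has_real_derivative f' t \<bullet> pivot j v) (at t)"
        unfolding has_real_derivative_iff_has_vector_derivative
        by (rule bounded_linear.has_vector_derivative[OF bounded_linear_inner_left f(1)])
      from DERIV_mult'[OF test_function_facts(3)[OF \<phi>] this] show ?thesis unfolding F_def .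
    qed
    have "L2_cont T f \<bullet> L2_cont T (\<lambda>t. deriv \<phi> t *\<^sub>R pivot j v)
        = (LINT t:{0<..<T}|lebesgue. deriv \<phi> t * (f t \<bullet> pivot j v))"
      by (subst inner_L2_cont_L2_cont) (auto intro!: continuous_intros cf c\<phi>)
    moreover have "L2_cont T (\<lambda>t. pivot j (f' t)) \<bullet> L2_cont T (\<lambda>t. \<phi> t *\<^sub>R v)
        = (LINT t:{0<..<T}|lebesgue. \<phi> t * (f' t \<bullet> pivot j v))"
      by (subst inner_L2_cont_L2_cont) (auto intro!: continuous_intros cf' c\<phi> simp: pivot_selfadjoint)
    moreover have "(LINT t:{0<..<T}|lebesgue. \<phi> t * (f' t \<bullet> pivot j v)) + (LINT t:{0<..<T}|lebesgue. deriv \<phi> t * (f t \<bullet> pivot j v))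
        = (LINT t:{0<..<T}|lebesgue. \<phi> t * (f' t \<bullet> pivot j v) + deriv \<phi> t * (f t \<bullet> pivot j v))"
      by (intro set_integral_add(2)[symmetric] set_integrable_continuous_interval continuous_intros cf cf' c\<phi>)
    moreover have "\<dots> = F T - F 0"
      by (intro integral_derivative_interval[OF T dF] continuous_intros cf cf' c\<phi>)
    moreover have "F T - F 0 = 0" unfolding F_def by (simp add: test_function_facts(4,5)[OF \<phi>])
    ultimately show ?thesis by simp
  qed
  then show "p \<in> deriv_graph j T"
    unfolding p deriv_graph_def by (auto intro!: L2_cont_in_L2_on cf cf' continuous_intros)
qed

text \<open>Density is a computation in each Fourier mode. For a pair orthogonal to \<open>(cos (\<kappa> t) v, - \<kappa> sin (\<kappa> t) P v)\<close>
  with \<open>P = j\<^sup>* j\<close>, the weak derivative tested with the sine mode turns the orthogonality into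
  \<open>w\<^sub>\<kappa> + \<kappa>\<^sup>2 P\<^sup>2 w\<^sub>\<kappa> = 0\<close> for the cosine coefficient \<open>w\<^sub>\<kappa>\<close>, which forces \<open>w\<^sub>\<kappa> = 0\<close>.\<close>

lemma deriv_graph_subset_closure_C1_graph:
  fixes j :: "'v::{real_inner,complete_space} \<Rightarrow>\<^sub>L 'h::{real_inner,complete_space}"
  assumes T: "T > 0"
  shows "deriv_graph j T \<subseteq> closure (C1_graph j T)"
proof (rule dense_if_trivial_orthogonal_complement[OF subspace_deriv_graph complete_deriv_graph
    subspace_C1_graph C1_graph_subset[OF T]])
  fix x assume x: "x \<in> deriv_graph j T" and orth: "\<And>n. n \<in> C1_graph j T \<Longrightarrow> x \<bullet> n = 0"
  obtain w y where wy: "x = (w, y)" by (cases x)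
  have G: "(w, y) \<in> deriv_graph j T" using x wy by simp
  then have L: "w \<in> L2_on T" "y \<in> L2_on T" unfolding deriv_graph_def by auto
  define P where "P = (pivot j :: 'v \<Rightarrow> 'v)"
  have "w \<bullet> L2_cont T (\<lambda>t. cos (real k * pi / T * t) *\<^sub>R v) = 0" for k :: nat and v
  proof -
    define \<kappa> where "\<kappa> = real k * pi / T"
    have \<kappa>: "\<kappa> \<ge> 0" "sin (\<kappa> * T) = 0" unfolding \<kappa>_def using T by simp_all
    define C where "C v = w \<bullet> L2_cont T (\<lambda>t. cos (\<kappa> * t) *\<^sub>R v)" for v
    define S where "S v = y \<bullet> L2_cont T (\<lambda>t. sin (\<kappa> * t) *\<^sub>R v)" for v
    have CS: "\<kappa> * C (P v) = - S v" for v
      unfolding C_def S_def P_def by (rule deriv_graph_sin[OF G \<kappa>])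
    have cS: "C v = \<kappa> * S (P v)" for v
    proof -
      have d: "((\<lambda>t. cos (\<kappa> * t) *\<^sub>R v) has_vector_derivative (- \<kappa> * sin (\<kappa> * t)) *\<^sub>R v) (at t)" for t
        by (auto intro!: derivative_eq_intros)
      have "(L2_cont T (\<lambda>t. cos (\<kappa> * t) *\<^sub>R v), L2_cont T (\<lambda>t. pivot j ((- \<kappa> * sin (\<kappa> * t)) *\<^sub>R v))) \<in> C1_graph j T"
        unfolding C1_graph_def
        by (intro CollectI exI[of _ "\<lambda>t. cos (\<kappa> * t) *\<^sub>R v"]
            exI[of _ "\<lambda>t. (- \<kappa> * sin (\<kappa> * t)) *\<^sub>R v"] conjI allI refl d continuous_intros)
      from orth[OF this] have "C v + y \<bullet> L2_cont T (\<lambda>t. pivot j ((- \<kappa> * sin (\<kappa> * t)) *\<^sub>R v)) = 0"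
        unfolding wy C_def by simp
      moreover have "L2_cont T (\<lambda>t. pivot j ((- \<kappa> * sin (\<kappa> * t)) *\<^sub>R v)) = (- \<kappa>) *\<^sub>R L2_cont T (\<lambda>t. sin (\<kappa> * t) *\<^sub>R P v)"
        unfolding P_def
        by (subst L2_cont_scaleR[symmetric])
          (auto intro!: continuous_intros simp: linear_scale[OF bounded_linear.linear[OF bounded_linear_pivot]]
            linear_neg[OF bounded_linear.linear[OF bounded_linear_pivot]])
      ultimately show ?thesis unfolding S_def by simp
    qed
    have "\<exists>r\<in>UNIV. \<forall>v\<in>UNIV. C v = r \<bullet> v"
    proof (rule Riesz_representation_subspace[where C="norm w * sqrt T"])
      fix x y :: 'v and c
      show "C (x + y) = C x + C y"
        unfolding C_def
        by (simp add: scaleR_add_right L2_cont_add continuous_intros inner_add_right)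
      have "L2_cont T (\<lambda>t. cos (\<kappa> * t) *\<^sub>R (c *\<^sub>R x)) = c *\<^sub>R L2_cont T (\<lambda>t. cos (\<kappa> * t) *\<^sub>R x)"
        by (subst L2_cont_scaleR[symmetric]) (auto intro!: continuous_intros simp: mult.commute)
      then show "C (c *\<^sub>R x) = c * C x" unfolding C_def by simp
      have "norm (L2_cont T (\<lambda>t. cos (\<kappa> * t) *\<^sub>R x)) \<le> sqrt T * norm x"
        by (rule norm_L2_cont_le[OF T]) (auto intro!: continuous_intros mult_left_le_one_le)
      then have "norm w * norm (L2_cont T (\<lambda>t. cos (\<kappa> * t) *\<^sub>R x)) \<le> norm w * (sqrt T * norm x)"
        by (intro mult_left_mono) auto
      then show "\<bar>C x\<bar> \<le> norm w * sqrt T * norm x"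
        unfolding C_def using Cauchy_Schwarz_ineq2[of w "L2_cont T (\<lambda>t. cos (\<kappa> * t) *\<^sub>R x)"]
        by (simp add: mult.assoc)
    qed (auto simp: complete_UNIV)
    then obtain r where r: "\<And>v. C v = r \<bullet> v" by auto
    have "r \<bullet> r = - (\<kappa>\<^sup>2 * (r \<bullet> P (P r)))"
    proof -
      have "r \<bullet> r = \<kappa> * S (P r)" using cS[of r] r by simp
      also have "S (P r) = - (\<kappa> * (r \<bullet> P (P r)))" using CS[of "P r"] r by simp
      finally show ?thesis by (simp add: power2_eq_square mult.assoc)
    qed
    also have "r \<bullet> P (P r) = P r \<bullet> P r" unfolding P_def by (rule pivot_selfadjoint)
    finally have "r \<bullet> r \<le> 0" by simp
    then have "r = 0" by (metis inner_eq_zero_iff inner_ge_zero order_antisym)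
    then show ?thesis using r[of v] unfolding C_def \<kappa>_def by simp
  qed
  then have w: "w = 0" by (rule L2_cos_total[OF T L(1)])
  have "(0, 0) \<in> deriv_graph j T"
    using subspace_0[OF subspace_deriv_graph[of j T]] by (simp add: zero_prod_def)
  then have "y = 0" using deriv_graph_single_valued[OF T G] w by simp
  then show "x = 0" using wy w by (simp add: zero_prod_def)
qed

section \<open>The trace in the pivot space\<close>

text \<open>The energy identity \<open>d/dt \<parallel>j f\<parallel>\<^sup>2 = 2 \<langle>j f', j f\<rangle>\<close> bounds the oscillation of the energy by the
  graph norm; comparing with its mean over the interval bounds the energy itself.\<close>

lemma energy_bound:
  fixes j :: "'v::{real_inner,complete_space} \<Rightarrow>\<^sub>L 'h::{real_inner,complete_space}"
  assumes T: "T > 0" and f: "\<And>t. (f has_vector_derivative f' t) (at t)" "continuous_on UNIV f'"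
    and t: "t \<in> {0..T}"
  shows "(norm (j (f t)))\<^sup>2 \<le> ((norm j)\<^sup>2 / T + 1)
    * ((norm (L2_cont T f))\<^sup>2 + (norm (L2_cont T (\<lambda>t. pivot j (f' t))))\<^sup>2)"
proof -
  have cf: "continuous_on S f" for S by (rule has_vector_derivative_imp_continuous_on[OF f(1)])
  have cf': "continuous_on S f'" for S by (rule continuous_on_subset[OF f(2) subset_UNIV])
  define E where "E u = (norm (j (f u)))\<^sup>2" for u
  define E' where "E' u = 2 * (pivot j (f' u) \<bullet> f u)" for u
  define D where "D u = (norm (f u))\<^sup>2 + (norm (pivot j (f' u)))\<^sup>2" for u
  define M where "M = (norm (L2_cont T f))\<^sup>2 + (norm (L2_cont T (\<lambda>t. pivot j (f' t))))\<^sup>2"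
  have dE: "(E has_vector_derivative E' u) (at u)" for u
  proof -
    have d: "((\<lambda>u. j (f u)) has_vector_derivative j (f' u)) (at u)"
      by (rule bounded_linear.has_vector_derivative[OF blinfun.bounded_linear_right f(1)])
    have "((\<lambda>u. j (f u) \<bullet> j (f u)) has_vector_derivative (j (f u) \<bullet> j (f' u) + j (f' u) \<bullet> j (f u))) (at u)"
      by (rule bounded_bilinear.has_vector_derivative[OF bounded_bilinear_inner d d])
    then show ?thesis
      unfolding E_def E'_def power2_norm_eq_inner
      by (simp add: pivot_selfadjoint[symmetric] inner_pivot inner_commute)
  qed
  have cD: "continuous_on S D" for S unfolding D_def by (intro continuous_intros cf cf')
  have cE: "continuous_on S E" for S unfolding E_def by (intro continuous_intros cf)
  have iD: "integral {0..T} D = M"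
    unfolding D_def M_def norm_L2_cont_integral[OF cf] norm_L2_cont_integral[OF continuous_on_pivot[OF cf']]
    by (intro Henstock_Kurzweil_Integration.integral_add integrable_continuous_real continuous_intros cf cf')
  \<comment> \<open>Splitting the mixed term by \<open>2 x y \<le> x\<^sup>2 + y\<^sup>2\<close> makes its integral the squared graph norm.\<close>
  have E'D: "norm (E' u) \<le> D u" for u
  proof -
    have "\<bar>pivot j (f' u) \<bullet> f u\<bar> \<le> norm (pivot j (f' u)) * norm (f u)" by (rule Cauchy_Schwarz_ineq2)
    moreover have "2 * (norm (pivot j (f' u)) * norm (f u)) \<le> D u"
      unfolding D_def using zero_le_power2[of "norm (f u) - norm (pivot j (f' u))"]
      by (simp add: power2_diff mult.commute mult.left_commute)
    moreover have "norm (E' u) = 2 * \<bar>pivot j (f' u) \<bullet> f u\<bar>" unfolding E'_def by (simp add: abs_mult)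
    ultimately show ?thesis by linarith
  qed
  have osc: "\<bar>E b - E a\<bar> \<le> M" if ab: "0 \<le> a" "a \<le> b" "b \<le> T" for a b
  proof -
    have h: "(E' has_integral (E b - E a)) {a..b}"
      using ab dE by (intro fundamental_theorem_of_calculus) (auto intro: has_vector_derivative_at_within)
    have "norm (integral {a..b} E') \<le> integral {a..b} D"
      by (rule integral_norm_bound_integral)
        (use h E'D in \<open>auto intro: integrable_continuous_real cD\<close>)
    also have "\<dots> \<le> integral {0..T} D"
      using ab by (intro integral_subset_le integrable_continuous_real cD)
        (auto simp: D_def)
    finally show ?thesis using integral_unique[OF h] iD by simp
  qed
  have le: "E t \<le> E s + M" if s: "s \<in> {0..T}" for s
  proof (cases "s \<le> t")
    case True
    then show ?thesis using osc[of s t] s t by auto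
  next
    case False
    then show ?thesis using osc[of t s] s t by auto
  qed
  have "integral {0..T} (\<lambda>s. E t) \<le> integral {0..T} (\<lambda>s. E s + M)"
    by (intro integral_le integrable_continuous_real continuous_intros cE le)
  also have "\<dots> = integral {0..T} E + T * M"
    using T by (subst Henstock_Kurzweil_Integration.integral_add)
      (auto intro: integrable_continuous_real cE)
  also have "integral {0..T} E \<le> integral {0..T} (\<lambda>s. (norm j)\<^sup>2 * (norm (f s))\<^sup>2)"
  proof (intro integral_le integrable_continuous_real continuous_intros cE cf)
    fix s show "E s \<le> (norm j)\<^sup>2 * (norm (f s))\<^sup>2"
      unfolding E_def using power_mono[OF norm_blinfun[of j "f s"], of 2] by (simp add: power_mult_distrib)
  qed
  also have "\<dots> = (norm j)\<^sup>2 * (norm (L2_cont T f))\<^sup>2"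
    by (simp add: norm_L2_cont_integral[OF cf])
  also have "\<dots> \<le> (norm j)\<^sup>2 * M" unfolding M_def by (intro mult_left_mono) auto
  finally have "T * E t \<le> (norm j)\<^sup>2 * M + T * M" using T by simp
  then have "E t \<le> ((norm j)\<^sup>2 * M + T * M) / T" using T by (simp add: pos_le_divide_eq mult.commute)
  also have "\<dots> = ((norm j)\<^sup>2 / T + 1) * M" using T by (simp add: field_simps)
  finally show ?thesis unfolding E_def M_def .
qed

lemma L2map_L2_cont:
  assumes "continuous_on {0..T} f"
  shows "L2map F (L2_cont T f) = L2_cont T (\<lambda>t. F (f t))"
  unfolding L2_cont_def L2map_abs[OF square_integrable_continuous[OF assms]]
  by (rule arg_cong[where f=abs_L2fun]) (auto simp: blinfun.zero_right)

text \<open>By the energy bound, continuously differentiable approximations in the graph norm are uniformly Cauchy as functions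
  into \<open>H\<close>. Their limit represents \<open>j w\<close> and inherits the bound.\<close>

lemma continuous_representative:
  fixes j :: "'v::{real_inner,complete_space} \<Rightarrow>\<^sub>L 'h::{real_inner,complete_space}"
  assumes T: "T > 0" and G: "(w, y) \<in> deriv_graph j T"
  shows "\<exists>F. continuous_on {0..T} F \<and> (AE s in lebesgue. s \<in> {0<..<T} \<longrightarrow> F s = j (rep_L2fun w s))
    \<and> (\<forall>t\<in>{0..T}. norm (F t) \<le> sqrt ((norm j)\<^sup>2 / T + 1) * norm (w, y))"
proof -
  define C where "C = sqrt ((norm j)\<^sup>2 / T + 1)"
  have C: "C > 0" unfolding C_def using T by (simp add: add_nonneg_pos)
  have "(w, y) \<in> closure (C1_graph j T)"
    using deriv_graph_subset_closure_C1_graph[OF T, of j] G by auto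
  then obtain p where p: "\<And>n. p n \<in> C1_graph j T" and pl: "p \<longlonglongrightarrow> (w, y)"
    unfolding closure_sequential by blast
  have "\<exists>f f'. (\<forall>t. (f has_vector_derivative f' t) (at t)) \<and> continuous_on UNIV f' \<and>
      p n = (L2_cont T f, L2_cont T (\<lambda>t. pivot j (f' t)))" for n
    using p[of n] unfolding C1_graph_def by auto
  then obtain f f' where f: "\<And>n t. (f n has_vector_derivative f' n t) (at t)" "\<And>n. continuous_on UNIV (f' n)"
    and pf: "\<And>n. p n = (L2_cont T (f n), L2_cont T (\<lambda>t. pivot j (f' n t)))"
    by metis
  have cf: "continuous_on S (f n)" for S n by (rule has_vector_derivative_imp_continuous_on[OF f(1)])
  have cf': "continuous_on S (f' n)" for S n by (rule continuous_on_subset[OF f(2) subset_UNIV])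
  have bound: "norm (j (f n t)) \<le> C * norm (p n)" if "t \<in> {0..T}" for n t
  proof (rule power2_le_imp_le)
    show "(norm (j (f n t)))\<^sup>2 \<le> (C * norm (p n))\<^sup>2"
      using energy_bound[OF T f(1)[of n] f(2)[of n] that, of j] T
      unfolding pf C_def by (simp add: power_mult_distrib norm_prod_def)
  qed (use C in simp)
  have diff: "norm (j (f m t) - j (f n t)) \<le> C * norm (p m - p n)" if "t \<in> {0..T}" for m n t
  proof (rule power2_le_imp_le)
    have d: "((\<lambda>t. f m t - f n t) has_vector_derivative (f' m t - f' n t)) (at t)" for t
      by (intro has_vector_derivative_diff f(1))
    have "p m - p n = (L2_cont T (\<lambda>t. f m t - f n t), L2_cont T (\<lambda>t. pivot j (f' m t - f' n t)))"
      unfolding pf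
      by (simp add: L2_cont_diff cf cf' continuous_on_pivot linear_diff[OF bounded_linear.linear[OF bounded_linear_pivot]])
    then show "(norm (j (f m t) - j (f n t)))\<^sup>2 \<le> (C * norm (p m - p n))\<^sup>2"
      using energy_bound[OF T d continuous_on_diff[OF f(2) f(2)] that, of j] T
      unfolding C_def by (simp add: power_mult_distrib norm_prod_def blinfun.diff_right)
  qed (use C in simp)
  have "uniformly_Cauchy_on {0..T} (\<lambda>n t. j (f n t))"
    unfolding uniformly_Cauchy_on_def
  proof (intro allI impI)
    fix e :: real assume e: "e > 0"
    have "Cauchy p" using pl LIMSEQ_imp_Cauchy by blast
    then obtain M where M: "\<And>m n. m \<ge> M \<Longrightarrow> n \<ge> M \<Longrightarrow> norm (p m - p n) < e / C"
      using CauchyD[of p "e / C"] e C by auto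
    show "\<exists>M. \<forall>x\<in>{0..T}. \<forall>m\<ge>M. \<forall>n\<ge>M. dist (j (f m x)) (j (f n x)) < e"
    proof (intro exI[of _ M] ballI allI impI)
      fix t m n assume t: "t \<in> {0..T}" and mn: "m \<ge> M" "n \<ge> M"
      have "C * norm (p m - p n) < e"
        using M[OF mn] C by (simp add: pos_less_divide_eq mult.commute)
      then show "dist (j (f m t)) (j (f n t)) < e"
        using diff[OF t, of m n] by (simp add: dist_norm)
    qed
  qed
  then obtain F where F: "uniform_limit {0..T} (\<lambda>n t. j (f n t)) F sequentially"
    using Cauchy_uniformly_convergent unfolding uniformly_convergent_on_def by blast
  have cjf: "continuous_on {0..T} (\<lambda>t. j (f n t))" for n
    by (rule bounded_linear.continuous_on[OF blinfun.bounded_linear_right cf])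
  have cF: "continuous_on {0..T} F"
    by (rule uniform_limit_theorem[OF always_eventually F]) (simp_all add: cjf)
  have Fb: "norm (F t) \<le> C * norm (w, y)" if t: "t \<in> {0..T}" for t
  proof (rule LIMSEQ_le)
    show "(\<lambda>n. norm (j (f n t))) \<longlonglongrightarrow> norm (F t)"
      by (intro tendsto_norm tendsto_uniform_limitI[OF F t])
    show "(\<lambda>n. C * norm (p n)) \<longlonglongrightarrow> C * norm (w, y)"
      by (intro tendsto_intros pl)
  qed (use bound[OF t] in auto)
  have "(\<lambda>n. L2_cont T (\<lambda>t. j (f n t))) \<longlonglongrightarrow> L2map j w"
  proof -
    have "(\<lambda>n. L2map j (fst (p n))) \<longlonglongrightarrow> L2map j (fst (w, y))"
      by (intro bounded_linear.tendsto[OF bounded_linear_L2map] tendsto_fst pl)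
    then show ?thesis by (simp add: pf L2map_L2_cont[OF cf])
  qed
  moreover have "(\<lambda>n. L2_cont T (\<lambda>t. j (f n t))) \<longlonglongrightarrow> L2_cont T F"
  proof (rule LIMSEQ_I)
    fix e :: real assume e: "e > 0"
    have sT: "sqrt T > 0" using T by simp
    define d where "d = e / (2 * sqrt T)"
    have d: "d > 0" unfolding d_def using e sT by simp
    from uniform_limitD[OF F d] obtain N where N: "\<And>n t. n \<ge> N \<Longrightarrow> t \<in> {0..T} \<Longrightarrow> dist (j (f n t)) (F t) < d"
      unfolding eventually_sequentially by blast
    show "\<exists>N. \<forall>n\<ge>N. norm (L2_cont T (\<lambda>t. j (f n t)) - L2_cont T F) < e"
    proof (intro exI[of _ N] allI impI)
      fix n assume n: "n \<ge> N"
      have "norm (L2_cont T (\<lambda>t. j (f n t) - F t)) \<le> sqrt T * d"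
        using N[OF n] by (intro norm_L2_cont_le[OF T] continuous_on_diff cjf cF) (auto simp: dist_norm less_imp_le)
      also have "\<dots> = e / 2" unfolding d_def using sT by simp
      also have "\<dots> < e" using e by simp
      finally show "norm (L2_cont T (\<lambda>t. j (f n t)) - L2_cont T F) < e"
        by (simp add: L2_cont_diff[OF cjf cF])
    qed
  qed
  ultimately have eq: "L2map j w = L2_cont T F" by (rule LIMSEQ_unique)
  have "AE s in lebesgue. s \<in> {0<..<T} \<longrightarrow> F s = j (rep_L2fun w s)"
    using rep_L2map[of j w] rep_L2_cont[OF cF] unfolding eq by eventually_elim auto
  with cF Fb show ?thesis unfolding C_def by blast
qed

lemma continuous_eq_if_AE_eq:
  fixes f g :: "real \<Rightarrow> 'a::real_normed_vector"
  assumes T: "T > 0" and f: "continuous_on {0..T} f" and g: "continuous_on {0..T} g"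
    and eq: "AE s in lebesgue. s \<in> {0<..<T} \<longrightarrow> f s = g s" and t: "t \<in> {0..T}"
  shows "f t = g t"
proof -
  have c: "continuous_on {0..T} (\<lambda>t. f t - g t)" by (intro continuous_on_diff f g)
  have "AE t in lebesgue. (if t \<in> {0<..<T} then f t else 0) = (if t \<in> {0<..<T} then g t else 0)"
    using eq by eventually_elim auto
  then have "L2_cont T f = L2_cont T g"
    unfolding L2_cont_def by (intro abs_L2fun_cong square_integrable_continuous f g)
  then have "integral {0..T} (\<lambda>t. (norm (f t - g t))\<^sup>2) = 0"
    using norm_L2_cont_integral[OF c] by (simp add: L2_cont_diff[OF f g])
  moreover have "(\<lambda>t. (norm (f t - g t))\<^sup>2) integrable_on {0..T}"
    by (intro integrable_continuous_real continuous_intros f g)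
  ultimately have "((\<lambda>t. (norm (f t - g t))\<^sup>2) has_integral 0) (cbox 0 T)"
    by (metis box_real(2) integrable_integral)
  then have "(norm (f t - g t))\<^sup>2 = 0"
    by (intro has_integral_0_cbox_imp_0[where a=0 and b=T])
      (use T t in \<open>auto intro!: continuous_intros f g\<close>)
  then show ?thesis by simp
qed

lemma time_trace_eqI:
  fixes j :: "'v::{real_inner,complete_space} \<Rightarrow>\<^sub>L 'h::{real_inner,complete_space}"
  assumes T: "T > 0" and f: "continuous_on {0..T} f"
    and eq: "AE s in lebesgue. s \<in> {0<..<T} \<longrightarrow> f s = j (rep_L2fun w s)" and t: "t \<in> {0..T}"
  shows "time_trace j T t w = f t"
  unfolding time_trace_def
proof (rule the_equality)
  show "\<exists>g. continuous_on {0..T} g \<and> (AE s in lebesgue. s \<in> {0<..<T} \<longrightarrow> g s = j (rep_L2fun w s)) \<and> f t = g t"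
    using f eq by blast
  fix h assume "\<exists>g. continuous_on {0..T} g \<and> (AE s in lebesgue. s \<in> {0<..<T} \<longrightarrow> g s = j (rep_L2fun w s)) \<and> h = g t"
  then obtain g where g: "continuous_on {0..T} g" "AE s in lebesgue. s \<in> {0<..<T} \<longrightarrow> g s = j (rep_L2fun w s)" "h = g t"
    by blast
  have "AE s in lebesgue. s \<in> {0<..<T} \<longrightarrow> g s = f s"
    using g(2) eq by eventually_elim auto
  from continuous_eq_if_AE_eq[OF T g(1) f this t] g(3) show "h = f t" by simp
qed

lemma time_trace_add:
  assumes T: "T > 0" and w: "w \<in> X_space j T" and z: "z \<in> X_space j T" and t: "t \<in> {0..T}"
  shows "time_trace j T t (w + z) = time_trace j T t w + time_trace j T t z"
proof -
  obtain f where f: "continuous_on {0..T} f" "AE s in lebesgue. s \<in> {0<..<T} \<longrightarrow> f s = j (rep_L2fun w s)"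
    using continuous_representative[OF T X_space_tderiv[OF T w]] by blast
  obtain g where g: "continuous_on {0..T} g" "AE s in lebesgue. s \<in> {0<..<T} \<longrightarrow> g s = j (rep_L2fun z s)"
    using continuous_representative[OF T X_space_tderiv[OF T z]] by blast
  have "AE s in lebesgue. s \<in> {0<..<T} \<longrightarrow> f s + g s = j (rep_L2fun (w + z) s)"
    using f(2) g(2) rep_L2fun_add[of w z] by eventually_elim (simp add: blinfun.add_right)
  from time_trace_eqI[OF T continuous_on_add[OF f(1) g(1)] this t]
  show ?thesis by (simp add: time_trace_eqI[OF T f t] time_trace_eqI[OF T g t])
qed

lemma time_trace_scaleR:
  assumes T: "T > 0" and w: "w \<in> X_space j T" and t: "t \<in> {0..T}"
  shows "time_trace j T t (c *\<^sub>R w) = c *\<^sub>R time_trace j T t w"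
proof -
  obtain f where f: "continuous_on {0..T} f" "AE s in lebesgue. s \<in> {0<..<T} \<longrightarrow> f s = j (rep_L2fun w s)"
    using continuous_representative[OF T X_space_tderiv[OF T w]] by blast
  have "AE s in lebesgue. s \<in> {0<..<T} \<longrightarrow> c *\<^sub>R f s = j (rep_L2fun (c *\<^sub>R w) s)"
    using f(2) rep_L2fun_scaleR[of c w] by eventually_elim (simp add: blinfun.scaleR_right)
  from time_trace_eqI[OF T continuous_on_scaleR[OF continuous_on_const f(1)] this t]
  show ?thesis by (simp add: time_trace_eqI[OF T f t])
qed

lemma time_trace_bound:
  assumes T: "T > 0" and w: "w \<in> X_space j T" and t: "t \<in> {0..T}"
  shows "norm (time_trace j T t w) \<le> sqrt ((norm j)\<^sup>2 / T + 1) * norm (w, tderiv j T w)"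
proof -
  obtain f where f: "continuous_on {0..T} f" "AE s in lebesgue. s \<in> {0<..<T} \<longrightarrow> f s = j (rep_L2fun w s)"
    and b: "\<forall>t\<in>{0..T}. norm (f t) \<le> sqrt ((norm j)\<^sup>2 / T + 1) * norm (w, tderiv j T w)"
    using continuous_representative[OF T X_space_tderiv[OF T w]] by blast
  then show ?thesis using t by (simp add: time_trace_eqI[OF T f t])
qed

section \<open>The Schur complement of a monotone saddle point operator\<close>

definition proj :: "'a::real_inner set \<Rightarrow> 'a \<Rightarrow> 'a" where
  "proj S x = (SOME p. p \<in> S \<and> (\<forall>v\<in>S. p \<bullet> v = x \<bullet> v))"

lemma proj:
  assumes "subspace S" "complete S"
  shows "proj S x \<in> S" "v \<in> S \<Longrightarrow> proj S x \<bullet> v = x \<bullet> v"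
proof -
  have "\<exists>p. p \<in> S \<and> (\<forall>v\<in>S. p \<bullet> v = x \<bullet> v)"
    using orthogonal_projection_subspace[OF assms, of x] by (auto simp: inner_diff_left)
  then have "proj S x \<in> S \<and> (\<forall>v\<in>S. proj S x \<bullet> v = x \<bullet> v)" unfolding proj_def by (rule someI_ex)
  then show "proj S x \<in> S" "v \<in> S \<Longrightarrow> proj S x \<bullet> v = x \<bullet> v" by auto
qed

lemma eq_if_inner_eq_on_subspace:
  fixes p q :: "'a::real_inner"
  assumes "subspace S" "p \<in> S" "q \<in> S" "\<And>v. v \<in> S \<Longrightarrow> p \<bullet> v = q \<bullet> v"
  shows "p = q"
proof -
  have "(p - q) \<bullet> (p - q) = 0"
    using assms(4)[OF subspace_diff[OF assms(1-3)]] by (simp add: inner_diff_left)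
  then show ?thesis by simp
qed

lemma proj_unique:
  assumes "subspace S" "complete S" "p \<in> S" "\<And>v. v \<in> S \<Longrightarrow> p \<bullet> v = x \<bullet> v"
  shows "proj S x = p"
  by (rule eq_if_inner_eq_on_subspace[OF assms(1) proj(1)[OF assms(1,2)] assms(3)])
    (simp add: proj(2)[OF assms(1,2)] assms(4))

lemma norm_le_if_inner_le:
  fixes x :: "'a::real_inner"
  assumes "x \<bullet> x \<le> C * norm x" "C \<ge> 0"
  shows "norm x \<le> C"
proof (cases "x = 0")
  case False
  have "norm x * norm x \<le> C * norm x"
    using assms(1) by (simp add: power2_norm_eq_inner[symmetric] power2_eq_square)
  then show ?thesis using False by (simp add: mult_le_cancel_right)
qed (use assms(2) in simp)

lemma norm_proj_diff_le:
  assumes "subspace S" "complete S"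
  shows "norm (proj S x - proj S y) \<le> norm (x - y)"
proof (rule norm_le_if_inner_le)
  have d: "proj S x - proj S y \<in> S" by (intro subspace_diff proj assms)
  have "(proj S x - proj S y) \<bullet> (proj S x - proj S y) = (x - y) \<bullet> (proj S x - proj S y)"
    using proj(2)[OF assms d] by (simp add: inner_diff_left)
  then show "(proj S x - proj S y) \<bullet> (proj S x - proj S y) \<le> norm (x - y) * norm (proj S x - proj S y)"
    using norm_cauchy_schwarz[of "x - y" "proj S x - proj S y"] by simp
qed simp

text \<open>An element \<open>p = (u, d, h)\<close> of \<open>X\<close> consists of a function, its derivative functional and its
  final trace. The unknown \<open>\<theta>\<close> is eliminated through \<open>a \<theta> = r - d\<close>; what remains is the strongly monotone
  operator \<open>u \<mapsto> - d' a\<inverse> (r - d u) + \<alpha> u + \<gamma>' \<gamma> u\<close>.\<close>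

locale monotone_saddle =
  fixes X :: "('a::real_inner \<times> 'b::real_inner \<times> 'c::real_inner) set" and W :: "'a set" and Y :: "'b set"
    and \<alpha> :: "'a \<Rightarrow> 'a" and a :: "'b \<Rightarrow> 'b" and L m :: real
  assumes X: "subspace X" "complete X" and Y: "subspace Y" "complete Y"
    and XW: "p \<in> X \<Longrightarrow> fst p \<in> W" and XY: "p \<in> X \<Longrightarrow> fst (snd p) \<in> Y"
    and aY: "\<theta> \<in> Y \<Longrightarrow> a \<theta> \<in> Y"
    and L: "L > 0" and m: "m > 0"
    and a_lip: "\<theta> \<in> Y \<Longrightarrow> \<eta> \<in> Y \<Longrightarrow> norm (a \<theta> - a \<eta>) \<le> L * norm (\<theta> - \<eta>)"
    and a_mono: "\<theta> \<in> Y \<Longrightarrow> \<eta> \<in> Y \<Longrightarrow> (a \<theta> - a \<eta>) \<bullet> (\<theta> - \<eta>) \<ge> m * (norm (\<theta> - \<eta>))\<^sup>2"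
    and \<alpha>_lip: "w \<in> W \<Longrightarrow> z \<in> W \<Longrightarrow> norm (\<alpha> w - \<alpha> z) \<le> L * norm (w - z)"
    and \<alpha>_mono: "w \<in> W \<Longrightarrow> z \<in> W \<Longrightarrow> (\<alpha> w - \<alpha> z) \<bullet> (w - z) \<ge> m * (norm (w - z))\<^sup>2"
begin

lemma a_surj: "r \<in> Y \<Longrightarrow> \<exists>\<theta>\<in>Y. a \<theta> = r"
  by (rule strongly_monotone_Lipschitz_surj[OF Y aY a_lip a_mono m])

definition ainv :: "'b \<Rightarrow> 'b" where
  "ainv r = (SOME \<theta>. \<theta> \<in> Y \<and> a \<theta> = r)"

lemma ainv: "r \<in> Y \<Longrightarrow> ainv r \<in> Y" "r \<in> Y \<Longrightarrow> a (ainv r) = r"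
proof -
  assume "r \<in> Y"
  then have "\<exists>\<theta>. \<theta> \<in> Y \<and> a \<theta> = r" using a_surj by blast
  then have "ainv r \<in> Y \<and> a (ainv r) = r" unfolding ainv_def by (rule someI_ex)
  then show "ainv r \<in> Y" "a (ainv r) = r" by auto
qed

lemma a_inverse_lip:
  assumes "\<theta> \<in> Y" "\<eta> \<in> Y"
  shows "norm (\<theta> - \<eta>) \<le> norm (a \<theta> - a \<eta>) / m"
proof (rule norm_le_if_inner_le)
  have "m * (norm (\<theta> - \<eta>))\<^sup>2 \<le> norm (a \<theta> - a \<eta>) * norm (\<theta> - \<eta>)"
    using a_mono[OF assms] norm_cauchy_schwarz[of "a \<theta> - a \<eta>" "\<theta> - \<eta>"] by linarith
  then show "(\<theta> - \<eta>) \<bullet> (\<theta> - \<eta>) \<le> norm (a \<theta> - a \<eta>) / m * norm (\<theta> - \<eta>)"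
    using m by (simp add: power2_norm_eq_inner pos_le_divide_eq mult.commute)
qed (use m in simp)

lemma a_inverse_mono:
  assumes "\<theta> \<in> Y" "\<eta> \<in> Y"
  shows "(a \<theta> - a \<eta>) \<bullet> (\<theta> - \<eta>) \<ge> m / L\<^sup>2 * (norm (a \<theta> - a \<eta>))\<^sup>2"
proof -
  have "(norm (a \<theta> - a \<eta>))\<^sup>2 \<le> L\<^sup>2 * (norm (\<theta> - \<eta>))\<^sup>2"
    using power_mono[OF a_lip[OF assms] norm_ge_zero, of 2] by (simp add: power_mult_distrib)
  then have "m / L\<^sup>2 * (norm (a \<theta> - a \<eta>))\<^sup>2 \<le> m / L\<^sup>2 * (L\<^sup>2 * (norm (\<theta> - \<eta>))\<^sup>2)"
    using m L by (intro mult_left_mono) auto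
  also have "\<dots> = m * (norm (\<theta> - \<eta>))\<^sup>2" using L by simp
  finally show ?thesis using a_mono[OF assms] by linarith
qed

lemma m_S_pos: "m_S L m > 0"
  unfolding m_S_def using m L by simp

text \<open>The three summands of the Schur complement control the three components of \<open>p - q\<close>.\<close>

lemma schur_coercive:
  assumes p: "p \<in> X" and q: "q \<in> X" and \<theta>: "\<theta> \<in> Y" "\<eta> \<in> Y"
    and eq: "a \<theta> - a \<eta> = - (fst (snd p) - fst (snd q))"
  shows "m_S L m * (norm (p - q))\<^sup>2 \<le> (\<alpha> (fst p) - \<alpha> (fst q)) \<bullet> (fst p - fst q)
    - (\<theta> - \<eta>) \<bullet> (fst (snd p) - fst (snd q)) + (norm (snd (snd p) - snd (snd q)))\<^sup>2"
proof -
  let ?d = "p - q"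
  have n: "(norm ?d)\<^sup>2 = (norm (fst ?d))\<^sup>2 + ((norm (fst (snd ?d)))\<^sup>2 + (norm (snd (snd ?d)))\<^sup>2)"
    by (simp add: norm_prod_def)
  have S: "m_S L m \<le> m" "m_S L m \<le> m / L\<^sup>2" "m_S L m \<le> 1"
    unfolding m_S_def by auto
  have "m_S L m * (norm (fst ?d))\<^sup>2 \<le> (\<alpha> (fst p) - \<alpha> (fst q)) \<bullet> (fst p - fst q)"
    using mult_right_mono[OF S(1), of "(norm (fst ?d))\<^sup>2"] \<alpha>_mono[OF XW[OF p] XW[OF q]] by simp
  moreover have "m_S L m * (norm (fst (snd ?d)))\<^sup>2 \<le> - ((\<theta> - \<eta>) \<bullet> (fst (snd p) - fst (snd q)))"
  proof -
    have "m / L\<^sup>2 * (norm (fst (snd ?d)))\<^sup>2 \<le> - ((\<theta> - \<eta>) \<bullet> (fst (snd p) - fst (snd q)))"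
      using a_inverse_mono[OF \<theta>] unfolding eq
      by (simp only: norm_minus_cancel inner_minus_left inner_minus_right inner_commute fst_diff snd_diff)
    then show ?thesis
      using mult_right_mono[OF S(2), of "(norm (fst (snd ?d)))\<^sup>2"] by simp
  qed
  moreover have "m_S L m * (norm (snd (snd ?d)))\<^sup>2 \<le> (norm (snd (snd p) - snd (snd q)))\<^sup>2"
    using mult_right_mono[OF S(3), of "(norm (snd (snd ?d)))\<^sup>2"] by simp
  ultimately show ?thesis unfolding n by (simp add: distrib_left)
qed

text \<open>The saddle point system with the right-hand side of the first equation given by its Riesz
  representative \<open>r\<close>; the functional \<open>G\<close> is the right-hand side of the second equation.\<close>

definition solution :: "'b \<Rightarrow> ('a \<times> 'b \<times> 'c \<Rightarrow> real) \<Rightarrow> 'b \<Rightarrow> 'a \<times> 'b \<times> 'c \<Rightarrow> bool" where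
  "solution r G \<theta> p \<longleftrightarrow> \<theta> \<in> Y \<and> p \<in> X \<and> a \<theta> + fst (snd p) = r \<and>
     (\<forall>q\<in>X. \<theta> \<bullet> fst (snd q) - (\<alpha> (fst p) \<bullet> fst q + snd (snd p) \<bullet> snd (snd q)) = G q)"

lemma component_norm_le:
  fixes p :: "'a \<times> 'b \<times> 'c"
  shows "norm (fst p) \<le> norm p" "norm (fst (snd p)) \<le> norm p" "norm (snd (snd p)) \<le> norm p"
  using norm_fst_le[of "fst p" "snd p"] norm_snd_le[of "snd p" "fst p"]
    norm_fst_le[of "fst (snd p)" "snd (snd p)"] norm_snd_le[of "snd (snd p)" "fst (snd p)"]
  by simp_all

text \<open>Zarantonello's theorem for the Schur complement, compressed to \<open>X\<close> by the orthogonal projection.\<close>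

lemma solution_exists:
  assumes r: "r \<in> Y"
    and G: "\<And>x y. x \<in> X \<Longrightarrow> y \<in> X \<Longrightarrow> G (x + y) = G x + G y"
      "\<And>c x. x \<in> X \<Longrightarrow> G (c *\<^sub>R x) = c * G x" "\<And>x. x \<in> X \<Longrightarrow> \<bar>G x\<bar> \<le> C * norm x"
  shows "\<exists>\<theta> p. solution r G \<theta> p"
proof -
  obtain g where g: "g \<in> X" "\<And>x. x \<in> X \<Longrightarrow> G x = g \<bullet> x"
    using Riesz_representation_subspace[OF X G] by blast
  define \<Theta> where "\<Theta> p = ainv (r - fst (snd p))" for p :: "'a \<times> 'b \<times> 'c"
  have rY: "r - fst (snd p) \<in> Y" if "p \<in> X" for p
    by (intro subspace_diff[OF Y(1)] r XY that)
  have \<Theta>: "\<Theta> p \<in> Y" "a (\<Theta> p) = r - fst (snd p)" if "p \<in> X" for p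
    unfolding \<Theta>_def using ainv[OF rY[OF that]] by auto
  have \<Theta>d: "a (\<Theta> p) - a (\<Theta> q) = - (fst (snd p) - fst (snd q))" if "p \<in> X" "q \<in> X" for p q
    using \<Theta>(2)[OF that(1)] \<Theta>(2)[OF that(2)] by simp
  define F where "F p = (\<alpha> (fst p), - \<Theta> p, snd (snd p))" for p :: "'a \<times> 'b \<times> 'c"
  have "\<exists>p\<in>X. proj X (F p) = - g"
  proof (rule strongly_monotone_Lipschitz_surj[OF X, where L="L + (1 / m + 1)" and m="m_S L m"])
    fix p q assume p: "p \<in> X" and q: "q \<in> X"
    show "proj X (F p) \<in> X" by (rule proj[OF X])
    have "norm (F p - F q) \<le> norm (\<alpha> (fst p) - \<alpha> (fst q)) + (norm (\<Theta> p - \<Theta> q) + norm (snd (snd p) - snd (snd q)))"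
    proof -
      have "norm (F p - F q) \<le> norm (\<alpha> (fst p) - \<alpha> (fst q)) + norm (- \<Theta> p - - \<Theta> q, snd (snd p) - snd (snd q))"
        unfolding F_def by (simp add: norm_Pair_le)
      also have "norm (- \<Theta> p - - \<Theta> q, snd (snd p) - snd (snd q))
          \<le> norm (- \<Theta> p - - \<Theta> q) + norm (snd (snd p) - snd (snd q))" by (rule norm_Pair_le)
      also have "norm (- \<Theta> p - - \<Theta> q) = norm (\<Theta> p - \<Theta> q)"
        using norm_minus_commute[of "\<Theta> p" "\<Theta> q"] by simp
      finally show ?thesis by simp
    qed
    also have "\<dots> \<le> L * norm (p - q) + (1 / m * norm (p - q) + norm (p - q))"
    proof (intro add_mono)
      have "L * norm (fst p - fst q) \<le> L * norm (p - q)"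
        using component_norm_le(1)[of "p - q"] L by (intro mult_left_mono) auto
      then show "norm (\<alpha> (fst p) - \<alpha> (fst q)) \<le> L * norm (p - q)"
        using \<alpha>_lip[OF XW[OF p] XW[OF q]] by linarith
      have "norm (\<Theta> p - \<Theta> q) \<le> norm (fst (snd (p - q))) / m"
        using a_inverse_lip[OF \<Theta>(1)[OF p] \<Theta>(1)[OF q]] unfolding \<Theta>d[OF p q]
        by (simp only: norm_minus_cancel fst_diff snd_diff)
      also have "\<dots> \<le> norm (p - q) / m" using component_norm_le(2)[of "p - q"] m by (intro divide_right_mono) auto
      finally show "norm (\<Theta> p - \<Theta> q) \<le> 1 / m * norm (p - q)" by simp
      show "norm (snd (snd p) - snd (snd q)) \<le> norm (p - q)" using component_norm_le(3)[of "p - q"] by simp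
    qed
    finally show "norm (proj X (F p) - proj X (F q)) \<le> (L + (1 / m + 1)) * norm (p - q)"
      using norm_proj_diff_le[OF X, of "F p" "F q"] by (simp add: algebra_simps)
    have "(proj X (F p) - proj X (F q)) \<bullet> (p - q) = (F p - F q) \<bullet> (p - q)"
      using proj(2)[OF X subspace_diff[OF X(1) p q]] by (simp add: inner_diff_left)
    also have "\<dots> = (\<alpha> (fst p) - \<alpha> (fst q)) \<bullet> (fst p - fst q)
        - (\<Theta> p - \<Theta> q) \<bullet> (fst (snd p) - fst (snd q)) + (norm (snd (snd p) - snd (snd q)))\<^sup>2"
      unfolding F_def power2_norm_eq_inner
      by (simp add: inner_prod_def inner_diff_left)
    finally show "m_S L m * (norm (p - q))\<^sup>2 \<le> (proj X (F p) - proj X (F q)) \<bullet> (p - q)"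
      using schur_coercive[OF p q \<Theta>(1)[OF p] \<Theta>(1)[OF q] \<Theta>d[OF p q]] by simp
  qed (use m_S_pos subspace_neg[OF X(1) g(1)] in auto)
  then obtain p where p: "p \<in> X" "proj X (F p) = - g" by blast
  have "solution r G (\<Theta> p) p"
    unfolding solution_def
  proof (intro conjI ballI)
    fix q assume q: "q \<in> X"
    have "F p \<bullet> q = - (g \<bullet> q)" using proj(2)[OF X q, of "F p"] p(2) by simp
    then show "\<Theta> p \<bullet> fst (snd q) - (\<alpha> (fst p) \<bullet> fst q + snd (snd p) \<bullet> snd (snd q)) = G q"
      unfolding F_def g(2)[OF q] by (simp add: inner_prod_def)
  qed (use p \<Theta>[OF p(1)] in auto)
  then show ?thesis by blast
qed

text \<open>Comparing with the intermediate state \<open>\<zeta> = a\<inverse> (r - d q)\<close> separates the effect of the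
  difference of the right-hand sides \<open>r\<close> and \<open>s\<close> from that of \<open>p - q\<close>.\<close>

lemma solution_stable:
  assumes 1: "solution r G \<theta> p" and 2: "solution s H \<eta> q"
    and K: "\<bar>G (p - q) - H (p - q)\<bar> \<le> K * norm (p - q)" "K \<ge> 0" and rs: "r \<in> Y"
  shows "norm (p - q) \<le> 1 / m_S L m * (K + norm (r - s) / m)"
    and "norm (\<theta> - \<eta>) \<le> (norm (r - s) + norm (p - q)) / m"
proof -
  note \<theta> = 1[unfolded solution_def] and \<eta> = 2[unfolded solution_def]
  have pq: "p \<in> X" "q \<in> X" and Yt: "\<theta> \<in> Y" "\<eta> \<in> Y" using \<theta> \<eta> by auto
  have d: "p - q \<in> X" by (rule subspace_diff[OF X(1) pq])
  define \<zeta> where "\<zeta> = ainv (r - fst (snd q))"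
  have \<zeta>: "\<zeta> \<in> Y" "a \<zeta> = r - fst (snd q)"
    unfolding \<zeta>_def using ainv[OF subspace_diff[OF Y(1) rs XY[OF pq(2)]]] by auto
  have a1: "a \<theta> = r - fst (snd p)" and a2: "a \<eta> = s - fst (snd q)"
    using \<theta> \<eta> by (auto simp: algebra_simps)
  have eq: "a \<theta> - a \<zeta> = - (fst (snd p) - fst (snd q))"
    unfolding a1 \<zeta>(2) by simp
  have \<zeta>\<eta>: "norm (\<zeta> - \<eta>) \<le> norm (r - s) / m"
    using a_inverse_lip[OF \<zeta>(1) Yt(2)] unfolding \<zeta>(2) a2 by simp
  have G: "G (p - q) = \<theta> \<bullet> fst (snd (p - q)) - (\<alpha> (fst p) \<bullet> fst (p - q) + snd (snd p) \<bullet> snd (snd (p - q)))"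
    by (rule \<theta>[THEN conjunct2, THEN conjunct2, THEN conjunct2, rule_format, OF d, symmetric])
  have H: "H (p - q) = \<eta> \<bullet> fst (snd (p - q)) - (\<alpha> (fst q) \<bullet> fst (p - q) + snd (snd q) \<bullet> snd (snd (p - q)))"
    by (rule \<eta>[THEN conjunct2, THEN conjunct2, THEN conjunct2, rule_format, OF d, symmetric])
  have "m_S L m * (norm (p - q))\<^sup>2 \<le> - (G (p - q) - H (p - q)) + (\<zeta> - \<eta>) \<bullet> fst (snd (p - q))"
    using schur_coercive[OF pq Yt(1) \<zeta>(1) eq] unfolding G H power2_norm_eq_inner[of "snd (snd p) - snd (snd q)"]
    by (simp add: inner_diff_left)
  also have "\<dots> \<le> K * norm (p - q) + norm (r - s) / m * norm (p - q)"
  proof (rule add_mono)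
    show "- (G (p - q) - H (p - q)) \<le> K * norm (p - q)" using K(1) by linarith
    have "(\<zeta> - \<eta>) \<bullet> fst (snd (p - q)) \<le> norm (\<zeta> - \<eta>) * norm (fst (snd (p - q)))"
      by (rule norm_cauchy_schwarz)
    also have "\<dots> \<le> norm (r - s) / m * norm (p - q)"
      using \<zeta>\<eta> component_norm_le(2)[of "p - q"] m by (intro mult_mono) auto
    finally show "(\<zeta> - \<eta>) \<bullet> fst (snd (p - q)) \<le> norm (r - s) / m * norm (p - q)" .
  qed
  finally have "(norm (p - q))\<^sup>2 \<le> (K * norm (p - q) + norm (r - s) / m * norm (p - q)) / m_S L m"
    using m_S_pos by (simp only: pos_le_divide_eq mult.commute[of _ "m_S L m"])
  also have "\<dots> = 1 / m_S L m * (K + norm (r - s) / m) * norm (p - q)"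
    by (simp add: distrib_right)
  finally have "(p - q) \<bullet> (p - q) \<le> 1 / m_S L m * (K + norm (r - s) / m) * norm (p - q)"
    unfolding power2_norm_eq_inner .
  then show "norm (p - q) \<le> 1 / m_S L m * (K + norm (r - s) / m)"
    by (rule norm_le_if_inner_le) (use m_S_pos m K(2) in auto)
  have "norm (\<theta> - \<eta>) \<le> norm (a \<theta> - a \<eta>) / m" by (rule a_inverse_lip[OF Yt])
  also have "a \<theta> - a \<eta> = (r - s) - fst (snd (p - q))" unfolding a1 a2 by simp
  also have "norm ((r - s) - fst (snd (p - q))) \<le> norm (r - s) + norm (p - q)"
    using norm_triangle_ineq4[of "r - s" "fst (snd (p - q))"] component_norm_le(2)[of "p - q"] by linarith
  finally show "norm (\<theta> - \<eta>) \<le> (norm (r - s) + norm (p - q)) / m"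
    using m by (simp add: divide_right_mono)
qed

lemma solution_Lipschitz:
  assumes "solution r G \<theta> p" "solution s H \<eta> q"
    and "\<bar>G (p - q) - H (p - q)\<bar> \<le> K * norm (p - q)" "K \<ge> 0" "r \<in> Y"
  shows "norm (\<theta> - \<eta>) + norm (p - q) \<le> L_N_inv L m * (norm (r - s) + K)"
proof -
  define R U M where "R = norm (r - s)" and "U = norm (p - q)" and "M = max 1 (1 / m)"
  have nn: "R \<ge> 0" "K \<ge> 0" "M \<ge> 1" "M \<ge> 1 / m" using assms(4) unfolding R_def M_def by auto
  have U: "U \<le> 1 / m_S L m * (K + R / m)" and \<Theta>: "norm (\<theta> - \<eta>) \<le> (R + U) / m"
    using solution_stable[OF assms] unfolding R_def U_def by auto
  have "K + R / m \<le> M * (R + K)"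
    using mult_right_mono[OF nn(3,2)] mult_right_mono[OF nn(4,1)] by (simp add: distrib_left)
  then have "1 / m_S L m * (K + R / m) \<le> 1 / m_S L m * (M * (R + K))"
    using m_S_pos by (intro mult_left_mono) auto
  with U have "U \<le> 1 / m_S L m * (M * (R + K))" by linarith
  then have "(1 + 1 / m) * U \<le> (1 + 1 / m) * (1 / m_S L m * (M * (R + K)))"
    using m by (intro mult_left_mono) auto
  moreover have "R / m \<le> 1 / m * (R + K)" using nn m by (simp add: divide_right_mono)
  moreover have "norm (\<theta> - \<eta>) + U \<le> R / m + (1 + 1 / m) * U"
    using \<Theta> by (simp add: add_divide_distrib distrib_right)
  ultimately have "norm (\<theta> - \<eta>) + U \<le> 1 / m * (R + K) + (1 + 1 / m) * (1 / m_S L m * (M * (R + K)))"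
    by linarith
  also have "\<dots> = L_N_inv L m * (R + K)" unfolding L_N_inv_def M_def by (simp add: algebra_simps add_divide_distrib)
  finally show ?thesis unfolding R_def U_def .
qed

end

section \<open>The parabolic saddle point problem\<close>

lemma dual_norm_upper:
  assumes n: "\<And>x. x \<in> S \<Longrightarrow> 0 \<le> n x" and F: "\<And>x. x \<in> S \<Longrightarrow> \<bar>F x\<bar> \<le> C * n x"
    and y: "y \<in> S" "n y \<le> 1"
  shows "\<bar>F y\<bar> \<le> dual_norm S n F"
  unfolding dual_norm_def
proof (rule cSUP_upper)
  show "bdd_above ((\<lambda>x. \<bar>F x\<bar>) ` {x \<in> S. n x \<le> 1})"
  proof (rule bdd_aboveI2)
    fix z assume "z \<in> {x \<in> S. n x \<le> 1}"
    then have z: "z \<in> S" "0 \<le> n z" "n z \<le> 1" using n by auto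
    have "\<bar>F z\<bar> \<le> \<bar>C\<bar> * n z"
      using F[OF z(1)] mult_right_mono[OF abs_ge_self[of C] z(2)] by linarith
    also have "\<dots> \<le> \<bar>C\<bar> * 1" using z(3) by (intro mult_left_mono) auto
    finally show "\<bar>F z\<bar> \<le> \<bar>C\<bar>" by simp
  qed
qed (use y in simp)

lemma dual_norm_le:
  assumes S: "subspace S" and hom: "\<And>c x. x \<in> S \<Longrightarrow> n (c *\<^sub>R x) = \<bar>c\<bar> * n x" and n: "\<And>x. x \<in> S \<Longrightarrow> 0 \<le> n x"
    and F: "\<And>c x. x \<in> S \<Longrightarrow> F (c *\<^sub>R x) = c * F x" "\<And>x. x \<in> S \<Longrightarrow> \<bar>F x\<bar> \<le> C * n x" and x: "x \<in> S"
  shows "\<bar>F x\<bar> \<le> dual_norm S n F * n x"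
proof (cases "n x = 0")
  case True
  then show ?thesis using F(2)[OF x] by simp
next
  case False
  then have nx: "n x > 0" using n[OF x] by simp
  define y where "y = (1 / n x) *\<^sub>R x"
  have y: "y \<in> S" "n y = 1"
    unfolding y_def using subspace_scale[OF S x] hom[OF x, of "1 / n x"] nx by simp_all
  have "\<bar>F y\<bar> \<le> dual_norm S n F"
    by (rule dual_norm_upper[OF n F(2) y(1)]) (simp_all add: y(2))
  moreover have "F y = F x / n x" unfolding y_def using F(1)[OF x, of "1 / n x"] by simp
  ultimately show ?thesis using nx by (simp add: pos_divide_le_eq)
qed

lemma dual_norm_nonneg:
  assumes S: "subspace S" and hom: "\<And>c x. x \<in> S \<Longrightarrow> n (c *\<^sub>R x) = \<bar>c\<bar> * n x" and n: "\<And>x. x \<in> S \<Longrightarrow> 0 \<le> n x"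
    and F: "\<And>x. x \<in> S \<Longrightarrow> \<bar>F x\<bar> \<le> C * n x"
  shows "0 \<le> dual_norm S n F"
proof -
  have "n 0 = 0" using hom[OF subspace_0[OF S], of 0] by simp
  then have "\<bar>F 0\<bar> \<le> dual_norm S n F" by (intro dual_norm_upper[OF n F subspace_0[OF S]]) simp_all
  then show ?thesis by linarith
qed

lemma dual_norm_inner:
  fixes S :: "'a::real_inner set"
  assumes S: "subspace S" and r: "r \<in> S" and F: "\<And>v. v \<in> S \<Longrightarrow> F v = r \<bullet> v"
  shows "dual_norm S norm F = norm r"
proof (rule antisym)
  show "dual_norm S norm F \<le> norm r"
    unfolding dual_norm_def
  proof (rule cSUP_least)
    show "{x \<in> S. norm x \<le> 1} \<noteq> {}" using subspace_0[OF S] by auto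
    fix x assume x: "x \<in> {x \<in> S. norm x \<le> 1}"
    have "\<bar>r \<bullet> x\<bar> \<le> norm r * norm x" by (rule Cauchy_Schwarz_ineq2)
    also have "\<dots> \<le> norm r * 1" using x by (intro mult_left_mono) auto
    finally show "\<bar>F x\<bar> \<le> norm r" using F x by simp
  qed
  have *: "\<bar>F r\<bar> \<le> dual_norm S norm F * norm r"
    by (rule dual_norm_le[where C="norm r", OF S _ _ _ _ r])
      (auto simp: F subspace_scale[OF S] Cauchy_Schwarz_ineq2)
  have nn: "0 \<le> dual_norm S norm F"
    by (rule dual_norm_nonneg[where C="norm r", OF S]) (auto simp: F Cauchy_Schwarz_ineq2)
  have "r \<bullet> r \<le> dual_norm S norm F * norm r" using * F[OF r] by simp
  then show "norm r \<le> dual_norm S norm F" by (rule norm_le_if_inner_le[OF _ nn])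
qed

lemma dual_spaceD:
  assumes "F \<in> dual_space S n"
  shows "F \<in> extensional S" "x \<in> S \<Longrightarrow> y \<in> S \<Longrightarrow> F (x + y) = F x + F y" "x \<in> S \<Longrightarrow> F (c *\<^sub>R x) = c * F x"
    "\<exists>C. \<forall>x\<in>S. \<bar>F x\<bar> \<le> C * n x"
  using assms unfolding dual_space_def by auto

lemma dual_space_representation:
  fixes S :: "'a::real_inner set"
  assumes S: "subspace S" "complete S" and F: "F \<in> dual_space S norm"
  shows "\<exists>r\<in>S. \<forall>v\<in>S. F v = r \<bullet> v"
proof -
  obtain C where C: "\<And>x. x \<in> S \<Longrightarrow> \<bar>F x\<bar> \<le> C * norm x" using dual_spaceD(4)[OF F] by blast
  show ?thesis
    by (rule Riesz_representation_subspace[OF S dual_spaceD(2,3)[OF F] C])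
qed

text \<open>The nonlinear operator as a self-map of \<open>L\<^sub>2(V)\<close>.\<close>

definition rep_A :: "real \<Rightarrow> (real \<Rightarrow> 'v::{real_inner,complete_space} \<Rightarrow> ('v \<Rightarrow>\<^sub>L real)) \<Rightarrow> 'v L2fun \<Rightarrow> 'v L2fun" where
  "rep_A T A w = (SOME r. r \<in> L2_on T \<and> (\<forall>v\<in>L2_on T. op_A T A w v = r \<bullet> v))"

lemma rep_A:
  assumes "A_well_defined T A" "w \<in> L2_on T"
  shows "rep_A T A w \<in> L2_on T" "v \<in> L2_on T \<Longrightarrow> op_A T A w v = rep_A T A w \<bullet> v"
proof -
  have "op_A T A w \<in> dual_space (L2_on T) norm" using assms unfolding A_well_defined_def by blast
  from dual_space_representation[OF subspace_L2_on complete_L2_on this]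
  have "\<exists>r. r \<in> L2_on T \<and> (\<forall>v\<in>L2_on T. op_A T A w v = r \<bullet> v)" by blast
  then have "rep_A T A w \<in> L2_on T \<and> (\<forall>v\<in>L2_on T. op_A T A w v = rep_A T A w \<bullet> v)"
    unfolding rep_A_def by (rule someI_ex)
  then show "rep_A T A w \<in> L2_on T" "v \<in> L2_on T \<Longrightarrow> op_A T A w v = rep_A T A w \<bullet> v" by auto
qed

lemma rep_A_diff:
  assumes A: "A_well_defined T A" and w: "w \<in> L2_on T" "z \<in> L2_on T"
  shows "v \<in> L2_on T \<Longrightarrow> (op_A T A w - op_A T A z) v = (rep_A T A w - rep_A T A z) \<bullet> v"
  by (simp add: rep_A(2)[OF A w(1)] rep_A(2)[OF A w(2)] inner_diff_left)

lemma rep_A_Lipschitz: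
  assumes A: "A_well_defined T A" "A_Lipschitz T A L" and w: "w \<in> L2_on T" "z \<in> L2_on T"
  shows "norm (rep_A T A w - rep_A T A z) \<le> L * norm (w - z)"
proof -
  have d: "rep_A T A w - rep_A T A z \<in> L2_on T"
    by (intro subspace_diff subspace_L2_on rep_A A w)
  have "dual_norm (L2_on T) norm (op_A T A w - op_A T A z) = norm (rep_A T A w - rep_A T A z)"
    by (rule dual_norm_inner[OF subspace_L2_on d rep_A_diff[OF A(1) w]])
  then show ?thesis using A(2) w unfolding A_Lipschitz_def by metis
qed

lemma rep_A_monotone:
  assumes A: "A_well_defined T A" "A_strongly_monotone T A m" and w: "w \<in> L2_on T" "z \<in> L2_on T"
  shows "(rep_A T A w - rep_A T A z) \<bullet> (w - z) \<ge> m * (norm (w - z))\<^sup>2"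
  using A(2) w rep_A_diff[OF A(1) w subspace_diff[OF subspace_L2_on w]]
  unfolding A_strongly_monotone_def by metis

lemma subspace_X_space:
  assumes "T > 0" shows "subspace (X_space j T)"
proof -
  have "X_space j T = fst ` deriv_graph j T"
    using X_space_tderiv[OF assms, of _ j] deriv_graph_X_space(1)[OF assms, of _ _ j] by force
  then show ?thesis
    using linear_subspace_image[OF bounded_linear.linear[OF bounded_linear_fst] subspace_deriv_graph] by simp
qed

lemma tderiv_add:
  assumes T: "T > 0" and w: "w \<in> X_space j T" "z \<in> X_space j T"
  shows "tderiv j T (w + z) = tderiv j T w + tderiv j T z"
  using subspace_add[OF subspace_deriv_graph X_space_tderiv[OF T w(1)] X_space_tderiv[OF T w(2)]]
  by (intro deriv_graph_X_space(2)[OF T]) simp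

lemma tderiv_scaleR:
  assumes T: "T > 0" and w: "w \<in> X_space j T"
  shows "tderiv j T (c *\<^sub>R w) = c *\<^sub>R tderiv j T w"
  using subspace_scale[OF subspace_deriv_graph X_space_tderiv[OF T w], of c]
  by (intro deriv_graph_X_space(2)[OF T]) simp

text \<open>The isometric embedding of \<open>X\<^sup>\<delta>\<close> into \<open>L\<^sub>2(V) \<times> L\<^sub>2(V) \<times> H\<close> that turns the norm of \<open>X\<^sup>\<delta>\<close> into a
  Hilbert space norm.\<close>

definition embed_X :: "('v::{real_inner,complete_space} \<Rightarrow>\<^sub>L 'h::{real_inner,complete_space}) \<Rightarrow> real \<Rightarrow>
    'v L2fun set \<Rightarrow> 'v L2fun \<Rightarrow> 'v L2fun \<times> 'v L2fun \<times> 'h" where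
  "embed_X j T Yd z = (z, proj Yd (tderiv j T z), time_trace j T T z)"

context
  fixes j :: "'v::{real_inner,complete_space} \<Rightarrow>\<^sub>L 'h::{real_inner,complete_space}" and T :: real
    and Yd :: "'v L2fun set"
  assumes T: "T > 0" and Yd: "subspace Yd" "complete Yd" "Yd \<subseteq> L2_on T"
begin

lemma dt_delta_eq_inner: "v \<in> Yd \<Longrightarrow> dt_delta j T Yd z v = proj Yd (tderiv j T z) \<bullet> v"
  using Yd(3) by (auto simp: dt_delta_def dt_eq_inner proj(2)[OF Yd(1,2)])

lemma Xd_norm_eq: "Xd_norm j T Yd z = norm (embed_X j T Yd z)"
  unfolding Xd_norm_def embed_X_def
  using dual_norm_inner[OF Yd(1) proj(1)[OF Yd(1,2)] dt_delta_eq_inner, of z]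
  by (simp add: norm_prod_def)

lemma embed_X_add:
  assumes "w \<in> X_space j T" "z \<in> X_space j T"
  shows "embed_X j T Yd (w + z) = embed_X j T Yd w + embed_X j T Yd z"
proof -
  have "proj Yd (tderiv j T (w + z)) = proj Yd (tderiv j T w) + proj Yd (tderiv j T z)"
    by (rule proj_unique[OF Yd(1,2)])
      (simp_all add: subspace_add[OF Yd(1)] proj[OF Yd(1,2)] tderiv_add[OF T assms] inner_add_left)
  then show ?thesis
    unfolding embed_X_def using time_trace_add[OF T assms, of T] T by simp
qed

lemma embed_X_scaleR:
  assumes "w \<in> X_space j T"
  shows "embed_X j T Yd (c *\<^sub>R w) = c *\<^sub>R embed_X j T Yd w"
proof -
  have "proj Yd (tderiv j T (c *\<^sub>R w)) = c *\<^sub>R proj Yd (tderiv j T w)"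
    by (rule proj_unique[OF Yd(1,2)])
      (simp_all add: subspace_scale[OF Yd(1)] proj[OF Yd(1,2)] tderiv_scaleR[OF T assms])
  then show ?thesis
    unfolding embed_X_def using time_trace_scaleR[OF T assms, of T] T by simp
qed

lemma embed_X_diff:
  assumes w: "w \<in> X_space j T" and z: "z \<in> X_space j T"
  shows "embed_X j T Yd (w - z) = embed_X j T Yd w - embed_X j T Yd z"
  using embed_X_add[OF w subspace_scale[OF subspace_X_space[OF T] z, of "-1"]] embed_X_scaleR[OF z, of "-1"]
  by simp

lemma subspace_embed_X:
  assumes Xd: "subspace Xd" "Xd \<subseteq> X_space j T"
  shows "subspace (embed_X j T Yd ` Xd)"
  unfolding subspace_def
proof (intro conjI ballI allI)
  have "embed_X j T Yd 0 = 0"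
    using embed_X_scaleR[of 0 0] subspace_0[OF Xd(1)] Xd(2) by auto
  then show "0 \<in> embed_X j T Yd ` Xd" using subspace_0[OF Xd(1)] by (metis imageI)
next
  fix p q assume "p \<in> embed_X j T Yd ` Xd" "q \<in> embed_X j T Yd ` Xd"
  then obtain x y where "x \<in> Xd" "y \<in> Xd" "p = embed_X j T Yd x" "q = embed_X j T Yd y" by blast
  moreover from this have "p + q = embed_X j T Yd (x + y)" using embed_X_add Xd(2) by (metis subsetD)
  ultimately show "p + q \<in> embed_X j T Yd ` Xd" using subspace_add[OF Xd(1)] by blast
next
  fix c p assume "p \<in> embed_X j T Yd ` Xd"
  then obtain x where "x \<in> Xd" "p = embed_X j T Yd x" by blast
  moreover from this have "c *\<^sub>R p = embed_X j T Yd (c *\<^sub>R x)" using embed_X_scaleR Xd(2) by (metis subsetD)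
  ultimately show "c *\<^sub>R p \<in> embed_X j T Yd ` Xd" using subspace_scale[OF Xd(1)] by blast
qed

lemma complete_embed_X_finite:
  assumes Xd: "subspace Xd" "Xd \<subseteq> X_space j T" "finite_dim Xd"
  shows "complete (embed_X j T Yd ` Xd)"
proof -
  obtain B where B: "finite B" "B \<subseteq> Xd" "Xd = span B"
    using finite_dim_subspace_span[OF Xd(1,3)] by blast
  have "x \<in> Xd \<and> embed_X j T Yd x \<in> span (embed_X j T Yd ` B)" if "x \<in> span B" for x
    using that
  proof (induction rule: span_induct_alt)
    case base
    have "embed_X j T Yd 0 = 0"
      using embed_X_scaleR[of 0 0] subspace_0[OF Xd(1)] Xd(2) by auto
    then show ?case using subspace_0[OF Xd(1)] span_zero by metis
  next
    case (step c x y)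
    have x: "x \<in> Xd" "c *\<^sub>R x \<in> Xd" using B(2) step(1) subspace_scale[OF Xd(1)] by blast+
    have "embed_X j T Yd (c *\<^sub>R x + y) = c *\<^sub>R embed_X j T Yd x + embed_X j T Yd y"
      using embed_X_add[of "c *\<^sub>R x" y] embed_X_scaleR[of x c] subsetD[OF Xd(2) x(1)]
        subsetD[OF Xd(2) x(2)] subsetD[OF Xd(2), of y] step by simp
    moreover have "c *\<^sub>R embed_X j T Yd x + embed_X j T Yd y \<in> span (embed_X j T Yd ` B)"
      by (rule span_add[OF span_scale[OF span_base[OF imageI[OF step(1)]]]]) (use step in simp)
    ultimately show ?case using step x subspace_add[OF Xd(1)] by simp
  qed
  then have sub: "embed_X j T Yd ` Xd \<subseteq> span (embed_X j T Yd ` B)" using B(3) by auto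
  then have "finite_dim (embed_X j T Yd ` Xd)" unfolding finite_dim_def using B(1) by blast
  from finite_dim_subspace_span[OF subspace_embed_X[OF Xd(1,2)] this]
  show ?thesis using complete_span_finite by metis
qed

text \<open>Limits of derivatives are derivatives of limits since the graph is closed, and the traces
  converge by the boundedness of the trace.\<close>

lemma complete_embed_X_full:
  assumes full: "Yd = L2_on T"
  shows "complete (embed_X j T Yd ` X_space j T)"
proof -
  have em: "embed_X j T Yd u = (u, tderiv j T u, time_trace j T T u)" if "u \<in> X_space j T" for u
  proof -
    have "tderiv j T u \<in> Yd" using X_space_tderiv[OF T that] unfolding full deriv_graph_def by simp
    then have "proj Yd (tderiv j T u) = tderiv j T u" by (intro proj_unique[OF Yd(1,2)]) auto
    then show ?thesis unfolding embed_X_def by simp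
  qed
  have "closed (embed_X j T Yd ` X_space j T)"
    unfolding closed_sequential_limits
  proof (intro allI impI)
    fix x l assume xl: "(\<forall>n. x n \<in> embed_X j T Yd ` X_space j T) \<and> x \<longlonglongrightarrow> l"
    obtain w y h where l: "l = (w, y, h)" by (cases l)
    have "\<forall>n. \<exists>u. u \<in> X_space j T \<and> x n = embed_X j T Yd u" using xl by blast
    then obtain u where u: "\<And>n. u n \<in> X_space j T" and xu: "\<And>n. x n = embed_X j T Yd (u n)"
      by metis
    have x: "x n = (u n, tderiv j T (u n), time_trace j T T (u n))" for n using em[OF u] xu by simp
    have lim: "x \<longlonglongrightarrow> (w, y, h)" using xl l by simp
    have l1: "u \<longlonglongrightarrow> w" and l2: "(\<lambda>n. tderiv j T (u n)) \<longlonglongrightarrow> y" and l3: "(\<lambda>n. time_trace j T T (u n)) \<longlonglongrightarrow> h"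
      using tendsto_fst[OF lim] tendsto_fst[OF tendsto_snd[OF lim]] tendsto_snd[OF tendsto_snd[OF lim]]
      by (simp_all add: x)
    have g: "(w, y) \<in> deriv_graph j T"
      using complete_imp_closed[OF complete_deriv_graph[of j T]] X_space_tderiv[OF T u] tendsto_Pair[OF l1 l2]
      by (rule closed_sequentially)
    have wX: "w \<in> X_space j T" and yw: "tderiv j T w = y" using deriv_graph_X_space[OF T g] by auto
    have "(\<lambda>n. time_trace j T T (u n)) \<longlonglongrightarrow> time_trace j T T w"
    proof (rule LIM_zero_cancel, rule Lim_null_comparison)
      have d: "time_trace j T T (u n) - time_trace j T T w = time_trace j T T (u n - w)"
        "tderiv j T (u n) - tderiv j T w = tderiv j T (u n - w)" for n
        using embed_X_diff[OF u wX, of n] em[OF u, of n] em[OF wX]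
          em[OF subspace_diff[OF subspace_X_space[OF T] u wX], of n] by simp_all
      show "eventually (\<lambda>n. norm (time_trace j T T (u n) - time_trace j T T w)
          \<le> sqrt ((norm j)\<^sup>2 / T + 1) * norm ((u n, tderiv j T (u n)) - (w, y))) sequentially"
      proof (intro always_eventually allI)
        fix n
        have "(u n, tderiv j T (u n)) - (w, y) = (u n - w, tderiv j T (u n - w))"
          using d(2)[of n] yw by simp
        then show "norm (time_trace j T T (u n) - time_trace j T T w)
            \<le> sqrt ((norm j)\<^sup>2 / T + 1) * norm ((u n, tderiv j T (u n)) - (w, y))"
          unfolding d(1)
          using time_trace_bound[OF T subspace_diff[OF subspace_X_space[OF T] u wX], of T n] T by simp
      qed
      show "(\<lambda>n. sqrt ((norm j)\<^sup>2 / T + 1) * norm ((u n, tderiv j T (u n)) - (w, y))) \<longlonglongrightarrow> 0"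
        by (intro tendsto_mult_right_zero tendsto_norm_zero LIM_zero tendsto_Pair l1 l2)
    qed
    with l3 have "h = time_trace j T T w" by (rule LIMSEQ_unique)
    then have "l = embed_X j T Yd w" unfolding l em[OF wX] yw by simp
    then show "l \<in> embed_X j T Yd ` X_space j T" using wX by blast
  qed
  then show ?thesis by (simp add: complete_eq_closed)
qed

end

theorem corollary4p9:
  fixes j :: "'v::{real_inner,complete_space} \<Rightarrow>\<^sub>L 'h::{real_inner,complete_space}"
    and T L_A m_A :: real
    and A :: "real \<Rightarrow> 'v \<Rightarrow> ('v \<Rightarrow>\<^sub>L real)"
    and Xd Yd :: "'v L2fun set"
  assumes "gelfand_triple j" and "T > 0"
    and "A_well_defined T A"
    and "L_A > 0" and "A_Lipschitz T A L_A"
    and "m_A > 0" and "A_strongly_monotone T A m_A"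
    and "subspace Yd" and "Yd \<subseteq> L2_on T" and "closed Yd" and "Yd \<noteq> {0}"
    and "subspace Xd" and "Xd \<subseteq> X_space j T" and "closed_in_X j T Xd" and "Xd \<noteq> {0}"
    and "finite_dim Xd \<and> finite_dim Yd \<or> Xd = X_space j T \<and> Yd = L2_on T"
  shows "bij_betw (N_delta j T A Yd Xd) (Yd \<times> Xd)
           (dual_space Yd norm \<times> dual_space Xd (Xd_norm j T Yd))
       \<and> (\<forall>p \<in> dual_space Yd norm \<times> dual_space Xd (Xd_norm j T Yd).
          \<forall>q \<in> dual_space Yd norm \<times> dual_space Xd (Xd_norm j T Yd).
            prod_norm norm (Xd_norm j T Yd)
              (inv_into (Yd \<times> Xd) (N_delta j T A Yd Xd) p - inv_into (Yd \<times> Xd) (N_delta j T A Yd Xd) q)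
            \<le> L_N_inv L_A m_A *
              prod_norm (dual_norm Yd norm) (dual_norm Xd (Xd_norm j T Yd)) (p - q))"
proof -
  note T = \<open>T > 0\<close> and wd = \<open>A_well_defined T A\<close>
  have Ydc: "complete Yd" using \<open>closed Yd\<close> by (simp add: complete_eq_closed)
  note Y = \<open>subspace Yd\<close> Ydc \<open>Yd \<subseteq> L2_on T\<close>
  note Xs = \<open>subspace Xd\<close> \<open>Xd \<subseteq> X_space j T\<close>
  have YL: "v \<in> L2_on T" if "v \<in> Yd" for v using that Y(3) by blast
  have XX: "z \<in> X_space j T" if "z \<in> Xd" for z using that Xs(2) by blast
  have XL: "z \<in> L2_on T" if "z \<in> Xd" for z using XX[OF that] unfolding X_space_def by simp
  define \<Phi> where "\<Phi> = embed_X j T Yd"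
  define X where "X = \<Phi> ` Xd"
  define a where "a \<theta> = proj Yd (rep_A T A \<theta>)" for \<theta>
  have \<Phi>: "\<Phi> z = (z, proj Yd (tderiv j T z), time_trace j T T z)" for z
    unfolding \<Phi>_def embed_X_def ..
  have n\<Phi>: "Xd_norm j T Yd z = norm (\<Phi> z)" for z
    unfolding \<Phi>_def by (rule Xd_norm_eq[OF T Y])
  have \<Phi>diff: "\<Phi> (z - w) = \<Phi> z - \<Phi> w" if "z \<in> Xd" "w \<in> Xd" for z w
    unfolding \<Phi>_def by (intro embed_X_diff[OF T Y] XX that)
  have \<Phi>add: "\<Phi> (z + w) = \<Phi> z + \<Phi> w" if "z \<in> Xd" "w \<in> Xd" for z w
    unfolding \<Phi>_def by (intro embed_X_add[OF T Y] XX that)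
  have \<Phi>scale: "\<Phi> (c *\<^sub>R z) = c *\<^sub>R \<Phi> z" if "z \<in> Xd" for c z
    unfolding \<Phi>_def by (intro embed_X_scaleR[OF T Y] XX that)
  have Xc: "complete X"
    using assms(16)
  proof
    assume "finite_dim Xd \<and> finite_dim Yd"
    then show ?thesis unfolding X_def \<Phi>_def by (intro complete_embed_X_finite[OF T Y Xs]) simp
  next
    assume "Xd = X_space j T \<and> Yd = L2_on T"
    then show ?thesis unfolding X_def \<Phi>_def using complete_embed_X_full[OF T Y] by simp
  qed
  have a: "a \<theta> \<in> Yd" "v \<in> Yd \<Longrightarrow> a \<theta> \<bullet> v = rep_A T A \<theta> \<bullet> v" for \<theta> v
    unfolding a_def by (simp_all add: proj[OF Y(1,2)])
  interpret S: monotone_saddle X "L2_on T" Yd "rep_A T A" a L_A m_A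
  proof
    show "subspace X" unfolding X_def \<Phi>_def by (rule subspace_embed_X[OF T Y Xs])
    fix p assume "p \<in> X"
    then show "fst p \<in> L2_on T" "fst (snd p) \<in> Yd"
      unfolding X_def by (auto simp: \<Phi> XL proj[OF Y(1,2)])
  next
    fix \<theta> \<eta> assume \<theta>: "\<theta> \<in> Yd" "\<eta> \<in> Yd"
    show "norm (a \<theta> - a \<eta>) \<le> L_A * norm (\<theta> - \<eta>)"
      using norm_proj_diff_le[OF Y(1,2), of "rep_A T A \<theta>" "rep_A T A \<eta>"]
        rep_A_Lipschitz[OF wd \<open>A_Lipschitz T A L_A\<close> YL[OF \<theta>(1)] YL[OF \<theta>(2)]]
      unfolding a_def by linarith
    have "(a \<theta> - a \<eta>) \<bullet> (\<theta> - \<eta>) = (rep_A T A \<theta> - rep_A T A \<eta>) \<bullet> (\<theta> - \<eta>)"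
      using a(2)[OF subspace_diff[OF Y(1) \<theta>]] by (simp add: inner_diff_left)
    then show "m_A * (norm (\<theta> - \<eta>))\<^sup>2 \<le> (a \<theta> - a \<eta>) \<bullet> (\<theta> - \<eta>)"
      using rep_A_monotone[OF wd \<open>A_strongly_monotone T A m_A\<close> YL[OF \<theta>(1)] YL[OF \<theta>(2)]] by simp
  qed (use Xc Y a \<open>L_A > 0\<close> \<open>m_A > 0\<close> rep_A_Lipschitz[OF wd \<open>A_Lipschitz T A L_A\<close>]
      rep_A_monotone[OF wd \<open>A_strongly_monotone T A m_A\<close>] in auto)
  let ?N = "N_delta j T A Yd Xd" and ?DY = "dual_space Yd norm" and ?DX = "dual_space Xd (Xd_norm j T Yd)"
  have N1: "fst (?N (\<theta>, u)) v = (a \<theta> + fst (snd (\<Phi> u))) \<bullet> v" if "\<theta> \<in> Yd" "v \<in> Yd" for \<theta> u v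
    using that by (simp add: N_delta_def A_delta_def rep_A(2)[OF wd YL YL] a(2) \<Phi>
        dt_delta_eq_inner[OF T Y] inner_add_left)
  have N2: "snd (?N (\<theta>, u)) z = \<theta> \<bullet> fst (snd (\<Phi> z))
      - (rep_A T A (fst (\<Phi> u)) \<bullet> fst (\<Phi> z) + snd (snd (\<Phi> u)) \<bullet> snd (snd (\<Phi> z)))"
    if "\<theta> \<in> Yd" "u \<in> Xd" "z \<in> Xd" for \<theta> u z
    using that by (simp add: N_delta_def A_delta_def dt_delta_adj_def trace_adj_def
        rep_A(2)[OF wd XL XL] \<Phi> dt_delta_eq_inner[OF T Y] inner_commute)
  have Next: "fst (?N (\<theta>, u)) \<in> extensional Yd" "snd (?N (\<theta>, u)) \<in> extensional Xd" for \<theta> u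
    unfolding N_delta_def by simp_all
  \<comment> \<open>The pair \<open>(\<theta>, \<Phi> u)\<close> solves the abstract problem whose data are the image of \<open>(\<theta>, u)\<close>.\<close>
  have sol: "S.solution (a \<theta> + fst (snd (\<Phi> u))) (\<lambda>q. snd (?N (\<theta>, u)) (fst q)) \<theta> (\<Phi> u)"
    if "\<theta> \<in> Yd" "u \<in> Xd" for \<theta> u
    unfolding S.solution_def
  proof (intro conjI ballI refl)
    fix q assume "q \<in> X"
    then obtain z where z: "z \<in> Xd" "q = \<Phi> z" unfolding X_def by blast
    have "fst (\<Phi> z) = z" by (simp add: \<Phi>)
    then show "\<theta> \<bullet> fst (snd q) - (rep_A T A (fst (\<Phi> u)) \<bullet> fst q + snd (snd (\<Phi> u)) \<bullet> snd (snd q))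
        = snd (?N (\<theta>, u)) (fst q)"
      unfolding z(2) using N2[OF that z(1)] by simp
  qed (use that in \<open>auto simp: X_def\<close>)
  have rY: "a \<theta> + fst (snd (\<Phi> u)) \<in> Yd" for \<theta> u
    by (intro subspace_add[OF Y(1)] a) (simp add: \<Phi> proj[OF Y(1,2)])
  have maps: "?N (\<theta>, u) \<in> ?DY \<times> ?DX" if \<theta>: "\<theta> \<in> Yd" and u: "u \<in> Xd" for \<theta> u
  proof -
    let ?r = "a \<theta> + fst (snd (\<Phi> u))"
    have "fst (?N (\<theta>, u)) \<in> ?DY"
      unfolding dual_space_def
    proof (intro CollectI conjI ballI allI exI[of _ "norm ?r"])
      fix x y c assume xy: "x \<in> Yd"
      show "fst (?N (\<theta>, u)) (c *\<^sub>R x) = c * fst (?N (\<theta>, u)) x"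
        using xy by (simp add: N1[OF \<theta>] subspace_scale[OF Y(1)])
      show "\<bar>fst (?N (\<theta>, u)) x\<bar> \<le> norm ?r * norm x"
        using xy by (simp add: N1[OF \<theta>] Cauchy_Schwarz_ineq2)
      assume "y \<in> Yd"
      then show "fst (?N (\<theta>, u)) (x + y) = fst (?N (\<theta>, u)) x + fst (?N (\<theta>, u)) y"
        using xy by (simp add: N1[OF \<theta>] subspace_add[OF Y(1)] inner_add_right)
    qed (rule Next)
    moreover have "snd (?N (\<theta>, u)) \<in> ?DX"
    proof -
      define g where "g = (- rep_A T A u, \<theta>, - time_trace j T T u)"
      have N2g: "snd (?N (\<theta>, u)) z = g \<bullet> \<Phi> z" if "z \<in> Xd" for z
        unfolding g_def using N2[OF \<theta> u that] by (simp add: \<Phi>)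
      show ?thesis
        unfolding dual_space_def
      proof (intro CollectI conjI ballI allI exI[of _ "norm g"])
        fix x y c assume xy: "x \<in> Xd"
        show "snd (?N (\<theta>, u)) (c *\<^sub>R x) = c * snd (?N (\<theta>, u)) x"
          using xy by (simp add: N2g subspace_scale[OF Xs(1)] \<Phi>scale)
        show "\<bar>snd (?N (\<theta>, u)) x\<bar> \<le> norm g * Xd_norm j T Yd x"
          using xy by (simp add: N2g n\<Phi> Cauchy_Schwarz_ineq2)
        assume "y \<in> Xd"
        then show "snd (?N (\<theta>, u)) (x + y) = snd (?N (\<theta>, u)) x + snd (?N (\<theta>, u)) y"
          using xy by (simp add: N2g subspace_add[OF Xs(1)] \<Phi>add inner_add_right)
      qed (rule Next)
    qed
    ultimately show ?thesis by (simp add: mem_Times_iff)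
  qed
  have surj: "\<exists>x\<in>Yd \<times> Xd. ?N x = p" if p: "p \<in> ?DY \<times> ?DX" for p
  proof -
    obtain F G where FG: "p = (F, G)" and F: "F \<in> ?DY" and G: "G \<in> ?DX" using p by auto
    obtain r where r: "r \<in> Yd" "\<And>v. v \<in> Yd \<Longrightarrow> F v = r \<bullet> v"
      using dual_space_representation[OF Y(1,2) F] by blast
    obtain C where C: "\<And>z. z \<in> Xd \<Longrightarrow> \<bar>G z\<bar> \<le> C * Xd_norm j T Yd z"
      using dual_spaceD(4)[OF G] by blast
    have "\<exists>\<theta> p. S.solution r (\<lambda>q. G (fst q)) \<theta> p"
      by (rule S.solution_exists[OF r(1), where C=C])
        (auto simp: X_def \<Phi> dual_spaceD(2,3)[OF G] C n\<Phi>[unfolded \<Phi>, symmetric])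
    then obtain \<theta> q where s: "S.solution r (\<lambda>q. G (fst q)) \<theta> q" by blast
    then have \<theta>: "\<theta> \<in> Yd" and qX: "q \<in> X" and qr: "a \<theta> + fst (snd q) = r"
      unfolding S.solution_def by auto
    obtain u where u: "u \<in> Xd" "q = \<Phi> u" using qX unfolding X_def by blast
    have eq: "a \<theta> + fst (snd (\<Phi> u)) = r" using qr u(2) by simp
    have "fst (?N (\<theta>, u)) = F"
      by (rule extensionalityI[OF Next(1) dual_spaceD(1)[OF F]]) (simp add: N1[OF \<theta>] eq r(2))
    moreover have "snd (?N (\<theta>, u)) = G"
    proof (rule extensionalityI[OF Next(2) dual_spaceD(1)[OF G]])
      fix z assume z: "z \<in> Xd"
      then have "\<Phi> z \<in> X" unfolding X_def by blast
      with s have "\<theta> \<bullet> fst (snd (\<Phi> z)) - (rep_A T A (fst q) \<bullet> fst (\<Phi> z) + snd (snd q) \<bullet> snd (snd (\<Phi> z))) = G (fst (\<Phi> z))"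
        unfolding S.solution_def by blast
      then show "snd (?N (\<theta>, u)) z = G z" unfolding N2[OF \<theta> u(1) z] u(2) by (simp add: \<Phi>)
    qed
    ultimately have "?N (\<theta>, u) = p" unfolding FG by (simp add: prod_eq_iff)
    then show ?thesis using \<theta> u(1) by blast
  qed
  \<comment> \<open>Injectivity is the case of equal images in this estimate.\<close>
  have stable: "prod_norm norm (Xd_norm j T Yd) (x - y)
      \<le> L_N_inv L_A m_A * prod_norm (dual_norm Yd norm) (dual_norm Xd (Xd_norm j T Yd)) (?N x - ?N y)"
    if x: "x \<in> Yd \<times> Xd" and y: "y \<in> Yd \<times> Xd" for x y
  proof -
    obtain \<theta> u \<eta> w where xy: "x = (\<theta>, u)" "y = (\<eta>, w)" and Yt: "\<theta> \<in> Yd" "\<eta> \<in> Yd" and Xu: "u \<in> Xd" "w \<in> Xd"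
      using x y by auto
    let ?r = "a \<theta> + fst (snd (\<Phi> u))" and ?s = "a \<eta> + fst (snd (\<Phi> w))"
    let ?G = "snd (?N x)" and ?H = "snd (?N y)"
    have R: "dual_norm Yd norm (fst (?N x - ?N y)) = norm (?r - ?s)"
    proof (rule dual_norm_inner[OF Y(1) subspace_diff[OF Y(1) rY rY]])
      fix v assume v: "v \<in> Yd"
      show "fst (?N x - ?N y) v = (?r - ?s) \<bullet> v"
        unfolding xy using N1[OF Yt(1) v] N1[OF Yt(2) v] by (simp add: inner_diff_left)
    qed
    have GD: "?G \<in> ?DX" "?H \<in> ?DX"
      using maps[OF Yt(1) Xu(1)] maps[OF Yt(2) Xu(2)] unfolding xy by (auto simp: mem_Times_iff)
    obtain C D where C: "\<And>z. z \<in> Xd \<Longrightarrow> \<bar>?G z\<bar> \<le> C * Xd_norm j T Yd z"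
      and D: "\<And>z. z \<in> Xd \<Longrightarrow> \<bar>?H z\<bar> \<le> D * Xd_norm j T Yd z"
      using dual_spaceD(4)[OF GD(1)] dual_spaceD(4)[OF GD(2)] by blast
    have CD: "\<bar>snd (?N x - ?N y) z\<bar> \<le> (C + D) * Xd_norm j T Yd z" if z: "z \<in> Xd" for z
      using C[OF z] D[OF z] by (simp add: distrib_right)
    have hom: "Xd_norm j T Yd (c *\<^sub>R z) = \<bar>c\<bar> * Xd_norm j T Yd z" if "z \<in> Xd" for c z
      by (simp add: n\<Phi> \<Phi>scale[OF that])
    define K where "K = dual_norm Xd (Xd_norm j T Yd) (snd (?N x - ?N y))"
    have K0: "K \<ge> 0"
      unfolding K_def by (rule dual_norm_nonneg[OF Xs(1) hom _ CD]) (simp_all add: n\<Phi>)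
    have KG: "\<bar>snd (?N x - ?N y) z\<bar> \<le> K * Xd_norm j T Yd z" if "z \<in> Xd" for z
      unfolding K_def
      by (rule dual_norm_le[OF Xs(1) hom _ _ CD that])
        (simp_all add: n\<Phi> dual_spaceD(3)[OF GD(1)] dual_spaceD(3)[OF GD(2)] right_diff_distrib)
    have d: "fst (\<Phi> u - \<Phi> w) = u - w" by (simp add: \<Phi>)
    have "\<bar>?G (fst (\<Phi> u - \<Phi> w)) - ?H (fst (\<Phi> u - \<Phi> w))\<bar> \<le> K * norm (\<Phi> u - \<Phi> w)"
      using KG[OF subspace_diff[OF Xs(1) Xu]] unfolding d n\<Phi> \<Phi>diff[OF Xu] by simp
    from S.solution_Lipschitz[OF sol[OF Yt(1) Xu(1), folded xy] sol[OF Yt(2) Xu(2), folded xy] this K0 rY]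
    show ?thesis unfolding prod_norm_def R K_def[symmetric] unfolding xy by (simp add: n\<Phi> \<Phi>diff[OF Xu])
  qed
  have inj: "inj_on ?N (Yd \<times> Xd)"
  proof (rule inj_onI)
    fix x y assume x: "x \<in> Yd \<times> Xd" and y: "y \<in> Yd \<times> Xd" and eq: "?N x = ?N y"
    have Xu: "snd x \<in> Xd" "snd y \<in> Xd" using x y by auto
    have "dual_norm Yd norm (fst (?N x - ?N y)) = 0"
      using dual_norm_inner[OF Y(1) subspace_0[OF Y(1)], of "fst (?N x - ?N y)"] eq by simp
    moreover have "dual_norm Xd (Xd_norm j T Yd) (snd (?N x - ?N y)) = 0"
    proof -
      have "Xd_norm j T Yd 0 = 0" using \<Phi>scale[OF subspace_0[OF Xs(1)], of 0] by (simp add: n\<Phi>)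
      then have ne: "{z \<in> Xd. Xd_norm j T Yd z \<le> 1} \<noteq> {}" using subspace_0[OF Xs(1)] by auto
      show ?thesis unfolding dual_norm_def eq using ne by simp
    qed
    ultimately have le: "norm (fst (x - y)) + Xd_norm j T Yd (snd (x - y)) \<le> 0"
      using stable[OF x y] unfolding prod_norm_def by simp
    have "norm (snd (x - y)) \<le> Xd_norm j T Yd (snd (x - y))"
      using norm_fst_le[of "snd (x - y)" "snd (\<Phi> (snd (x - y)))"] unfolding n\<Phi> by (simp add: \<Phi>)
    with le have "norm (fst (x - y)) = 0" "norm (snd (x - y)) = 0"
      using norm_ge_zero[of "fst (x - y)"] norm_ge_zero[of "snd (x - y)"] by linarith+
    then show "x = y" by (simp add: prod_eq_iff)
  qed
  have "?N ` (Yd \<times> Xd) = ?DY \<times> ?DX"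
  proof
    show "?N ` (Yd \<times> Xd) \<subseteq> ?DY \<times> ?DX" using maps by blast
    show "?DY \<times> ?DX \<subseteq> ?N ` (Yd \<times> Xd)" using surj by (metis image_eqI subsetI)
  qed
  with inj have bij: "bij_betw ?N (Yd \<times> Xd) (?DY \<times> ?DX)" unfolding bij_betw_def by simp
  show ?thesis
  proof (intro conjI ballI)
    fix p q assume p: "p \<in> ?DY \<times> ?DX" and q: "q \<in> ?DY \<times> ?DX"
    have im: "?N ` (Yd \<times> Xd) = ?DY \<times> ?DX" using bij unfolding bij_betw_def by simp
    have *: "inv_into (Yd \<times> Xd) ?N x \<in> Yd \<times> Xd" "?N (inv_into (Yd \<times> Xd) ?N x) = x" if "x \<in> ?DY \<times> ?DX" for x
      using that im by (metis inv_into_into, metis f_inv_into_f)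
    show "prod_norm norm (Xd_norm j T Yd) (inv_into (Yd \<times> Xd) ?N p - inv_into (Yd \<times> Xd) ?N q)
        \<le> L_N_inv L_A m_A * prod_norm (dual_norm Yd norm) (dual_norm Xd (Xd_norm j T Yd)) (p - q)"
      using stable[OF *(1)[OF p] *(1)[OF q]] unfolding *(2)[OF p] *(2)[OF q] .
  qed (rule bij)
qed

end
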